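(* The interpolation Macdonald symmetric functions $I_\mu(\cdot;q,t)$ and the dual interpolation functions $H_\mu(\cdot;q,t)$ satisfy $$ \sum_{\mu\in\mathbb Y}I_\mu(x_1,x_2,\dots;q,t)\,H_\mu(y_1,y_2,\dots;q,t)=\prod_{i=1}^\infty\prod_{j=1}^\infty\frac{(x_iy_jt;q)_\infty}{(x_iy_j;q)_\infty}, $$ where both sides are regarded as formal power series in the indeterminates $x_i$ and $y_j$, with coefficients in the field $\mathbb F=\mathbb Q(q,t)$.
   Context: General notation. $\mathbb F=\mathbb Q(q,t)$ with $q,t$ formal variables; $\mathbb Y$ is the set of partitions, $\ell(\mu)$ the number of nonzero parts, $|\mu|$ the size, $\mathbb Y(N)=\{\mu\in\mathbb Y:\ell(\mu)\le N\}$. $\mathrm{Sym}_{\mathbb F}$ is the algebra of symmetric functions over $\mathbb F$, $p_n$ the power sums, $\mathrm{Sym}_{\mathbb F}(N)$ the algebra of symmetric polynomials in $N$ variables over $\mathbb F$. $P_{\mu|N}(x_1,\dots,x_N;q,t)$ are the Macdonald polynomials (Macdonald's book, Ch. VI), and $\langle p_\lambda,p_\mu\rangle_{q,t}=\delta_{\lambda\mu}z_\lambda\prod_{i}\frac{1-q^{\lambda_i}}{1-t^{\lambda_i}}$ is the Macdonald scalar product. $(z;q)_\infty=\prod_{n\ge0}(1-zq^n)$ is regarded as a power series in $z$ over $\mathbb Q(q)$, namely $\exp\bigl(-\sum_{m\ge1}\frac1m\frac{z^m}{1-q^m}\bigr)$. Interpolation functions. For $\lambda\in\mathbb Y(N)$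 put $X_N(\lambda)=(q^{-\lambda_1},q^{-\lambda_2}t,\dots,q^{-\lambda_N}t^{N-1})$. For $\mu\in\mathbb Y(N)$, $I_{\mu|N}(\cdot;q,t)\in\mathrm{Sym}_{\mathbb F}(N)$ is the unique symmetric polynomial of degree $|\mu|$ that vanishes at $X_N(\lambda)$ for all $\lambda\in\mathbb Y(N)$ with $\lambda\ne\mu$, $|\lambda|\le|\mu|$, and whose top-degree homogeneous component is $P_{\mu|N}(\cdot;q,t)$. Let $\phi_N:\mathrm{Sym}_{\mathbb F}\to\mathrm{Sym}_{\mathbb F}(N)$ be the algebra morphism with $\phi_N(p_n)=x_1^n+\dots+x_N^n+\frac{t^{Nn}}{1-t^n}$. $I_\mu(\cdot;q,t)\in\mathrm{Sym}_{\mathbb F}$ is the unique element with $\phi_N(I_\mu)=I_{\mu|N}$ for all $N\ge\ell(\mu)$. These elements form a basis of $\mathrm{Sym}_{\mathbb F}$. Dual functions. $\widehat{\mathrm{Sym}}_{\mathbb F}$ is the completion of $\mathrm{Sym}_{\mathbb F}$ consisting of symmetric formal power series in $y_1,y_2,\dots$ of possibly unbounded degree; $\langle\cdot,\cdot\rangle_{q,t}$ extends to a pairing of $\mathrm{Sym}_{\mathbb F}$ with $\widehat{\mathrm{Sym}}_{\mathbb F}$. The dual interpolation functions $H_\mu(\cdot;q,t)\in\widehat{\mathrm{Sym}}_{\mathbb F}$ are defined by $\langle I_\mu(\cdot;q,t),H_\nu(\cdot;q,t)\rangle_{q,t}=\delta_{\mu\nu}$ for all $\mu,\nu\in\mathbb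 Y$. (All terms of $H_\mu$ have degree at least $|\mu|$, so the sum over $\mu$ is finite in each degree in the $y_j$.) *)

theory Defs
  imports
    "HOL-Analysis.Infinite_Sum"
    "HOL-Analysis.Infinite_Products"
    "HOL-Library.Poly_Mapping"
    "HOL-Computational_Algebra.Computational_Algebra"
    "HOL-Combinatorics.Permutations"
begin

section \<open>Formal power series in an arbitrary set of variables\<close>

text \<open>
  Variables are the elements of \<open>'v\<close>; a monomial is its exponent vector, of type
  \<open>'v \<Rightarrow>\<^sub>0 nat\<close>. The type \<open>'v\<close> may be infinite. There is no degree bound.
\<close>

typedef ('v, 'a) mps = "UNIV :: (('v \<Rightarrow>\<^sub>0 nat) \<Rightarrow> 'a) set"
  morphisms mcoeff Abs_mps ..

setup_lifting type_definition_mps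

lemma mps_eqI: "(\<And>m. mcoeff f m = mcoeff g m) \<Longrightarrow> f = g"
  by transfer blast

lemma mcoeff_Abs_mps [simp]: "mcoeff (Abs_mps f) = f"
  by (simp add: Abs_mps_inverse)

lemma finite_exponents_le:
  fixes m :: "'v \<Rightarrow>\<^sub>0 nat"
  shows "finite {a. \<forall>i. Poly_Mapping.lookup a i \<le> Poly_Mapping.lookup m i}"
proof -
  let ?k = "Poly_Mapping.keys m"
  let ?B = "{.. Max (insert 0 (Poly_Mapping.lookup m ` ?k))}"
  let ?S = "{a. \<forall>i. Poly_Mapping.lookup a i \<le> Poly_Mapping.lookup m i}"
  have "Poly_Mapping.lookup ` ?S \<subseteq>
      {f. \<forall>x. (x \<in> ?k \<longrightarrow> f x \<in> ?B) \<and> (x \<notin> ?k \<longrightarrow> f x = 0)}"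
  proof safe
    fix a x assume a: "\<forall>i. Poly_Mapping.lookup a i \<le> Poly_Mapping.lookup m i"
    { assume "x \<in> ?k"
      then have "Poly_Mapping.lookup m x \<le> Max (insert 0 (Poly_Mapping.lookup m ` ?k))"
        by (intro Max_ge) auto
      then show "Poly_Mapping.lookup a x \<le> Max (insert 0 (Poly_Mapping.lookup m ` ?k))"
        using a le_trans by blast }
    { assume "x \<notin> ?k"
      then show "Poly_Mapping.lookup a x = 0"
        using a by (metis in_keys_iff le_zero_eq) }
  qed
  moreover have "finite {f. \<forall>x. (x \<in> ?k \<longrightarrow> f x \<in> ?B) \<and> (x \<notin> ?k \<longrightarrow> f x = (0::nat))}"
    by (rule finite_set_of_finite_funs) auto
  ultimately have "finite (Poly_Mapping.lookup ` ?S)"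
    by (rule finite_subset)
  then show ?thesis
    by (rule finite_imageD) (simp add: inj_on_def lookup_inject)
qed

lemma finite_exponent_splittings:
  fixes m :: "'v \<Rightarrow>\<^sub>0 nat"
  shows "finite {(a, b). a + b = m}"
proof -
  let ?S = "{a. \<forall>i. Poly_Mapping.lookup a i \<le> Poly_Mapping.lookup m i}"
  have "{(a, b). a + b = m} \<subseteq> ?S \<times> ?S"
    by (auto simp: lookup_add)
  then show ?thesis
    using finite_exponents_le[of m] by (meson finite_SigmaI finite_subset)
qed

instantiation mps :: (type, comm_ring_1) comm_ring_1
begin

lift_definition zero_mps :: "('a, 'b) mps" is "\<lambda>_. 0" .
lift_definition one_mps :: "('a, 'b) mps" is "\<lambda>m. if m = 0 then 1 else 0" .
lift_definition plus_mps :: "('a, 'b) mps \<Rightarrow> ('a, 'b) mps \<Rightarrow> ('a, 'b) mps"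
  is "\<lambda>f g m. f m + g m" .
lift_definition uminus_mps :: "('a, 'b) mps \<Rightarrow> ('a, 'b) mps" is "\<lambda>f m. - f m" .
lift_definition minus_mps :: "('a, 'b) mps \<Rightarrow> ('a, 'b) mps \<Rightarrow> ('a, 'b) mps"
  is "\<lambda>f g m. f m - g m" .
lift_definition times_mps :: "('a, 'b) mps \<Rightarrow> ('a, 'b) mps \<Rightarrow> ('a, 'b) mps"
  is "\<lambda>f g m. \<Sum>(a, b) \<in> {(a, b). a + b = m}. f a * g b" .

instance
proof
  fix f g h :: "('a, 'b) mps"
  show "f + g + h = f + (g + h)" by transfer (simp add: add.assoc)
  show "f + g = g + f" by transfer (simp add: add.commute)
  show "0 + f = f" by transfer simp
  show "- f + f = 0" by transfer simp
  show "f - g = f + - g" by transfer simp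
  show "(f + g) * h = f * h + g * h"
    by transfer (simp add: distrib_right sum.distrib split_def)
  show "f * g = g * f"
  proof (transfer, rule ext)
    fix f g :: "('a \<Rightarrow>\<^sub>0 nat) \<Rightarrow> 'b" and m
    show "(\<Sum>(a, b)\<in>{(a, b). a + b = m}. f a * g b) = (\<Sum>(a, b)\<in>{(a, b). a + b = m}. g a * f b)"
      by (rule sum.reindex_bij_witness[of _ prod.swap prod.swap]) (auto simp: ac_simps)
  qed
  show "f * g * h = f * (g * h)"
  proof (transfer, rule ext)
    fix f g h :: "('a \<Rightarrow>\<^sub>0 nat) \<Rightarrow> 'b" and m
    let ?D = "\<lambda>m::'a \<Rightarrow>\<^sub>0 nat. {(a, b). a + b = m}"
    have "(\<Sum>(d, c)\<in>?D m. (\<Sum>(a, b)\<in>?D d. f a * g b) * h c)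
        = (\<Sum>p\<in>?D m. \<Sum>r\<in>?D (fst p). f (fst r) * g (snd r) * h (snd p))"
      by (simp add: split_def sum_distrib_right)
    also have "\<dots> = (\<Sum>(p, r)\<in>Sigma (?D m) (\<lambda>p. ?D (fst p)). f (fst r) * g (snd r) * h (snd p))"
      by (rule sum.Sigma) (auto simp: finite_exponent_splittings)
    also have "\<dots> = (\<Sum>(p, r)\<in>Sigma (?D m) (\<lambda>p. ?D (snd p)). f (fst p) * g (fst r) * h (snd r))"
      by (rule sum.reindex_bij_witness
          [of _ "\<lambda>((a, e), (b, c)). ((a + b, c), (a, b))" "\<lambda>((d, c), (a, b)). ((a, b + c), (b, c))"])
        (auto simp: ac_simps)
    also have "\<dots> = (\<Sum>p\<in>?D m. \<Sum>r\<in>?D (snd p). f (fst p) * g (fst r) * h (snd r))"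
      by (rule sum.Sigma[symmetric]) (auto simp: finite_exponent_splittings)
    also have "\<dots> = (\<Sum>(a, e)\<in>?D m. f a * (\<Sum>(b, c)\<in>?D e. g b * h c))"
      by (simp add: split_def sum_distrib_left mult.assoc)
    finally show "(\<Sum>(d, c)\<in>?D m. (\<Sum>(a, b)\<in>?D d. f a * g b) * h c)
        = (\<Sum>(a, e)\<in>?D m. f a * (\<Sum>(b, c)\<in>?D e. g b * h c))" .
  qed
  show "1 * f = f"
  proof (transfer, rule ext)
    fix f :: "('a \<Rightarrow>\<^sub>0 nat) \<Rightarrow> 'b" and m
    have "(\<Sum>(a, b)\<in>{(a, b). a + b = m}. (if a = 0 then 1 else 0) * f b)
        = (\<Sum>(a, b)\<in>{(0 :: 'a \<Rightarrow>\<^sub>0 nat, m)}. (if a = 0 then 1 else 0) * f b)"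
      by (rule sum.mono_neutral_right)
        (auto simp: finite_exponent_splittings split: if_splits)
    then show "(\<Sum>(a, b)\<in>{(a, b). a + b = m}. (if a = 0 then 1 else 0) * f b) = f m"
      by simp
  qed
  show "(0 :: ('a, 'b) mps) \<noteq> 1"
    by transfer (metis zero_neq_one)
qed

end

text \<open>
  The topology of coefficientwise eventual constancy, that is, the product topology for discrete
  coefficients. A family is summable in it iff every monomial receives only finitely many
  nonzero contributions.
\<close>

instantiation mps :: (type, type) t2_space
begin

definition open_mps :: "('a, 'b) mps set \<Rightarrow> bool" where
  "open_mps U \<longleftrightarrow>
     (\<forall>f\<in>U. \<exists>S. finite S \<and> {g. \<forall>m\<in>S. mcoeff g m = mcoeff f m} \<subseteq> U)"

instance
proof
  show "open (UNIV :: ('a, 'b) mps set)"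
    unfolding open_mps_def by blast
next
  fix U V :: "('a, 'b) mps set" assume U: "open U" and V: "open V"
  show "open (U \<inter> V)"
    unfolding open_mps_def
  proof
    fix f assume f: "f \<in> U \<inter> V"
    obtain S where S: "finite S" "{g. \<forall>m\<in>S. mcoeff g m = mcoeff f m} \<subseteq> U"
      using U f unfolding open_mps_def by blast
    obtain T where T: "finite T" "{g. \<forall>m\<in>T. mcoeff g m = mcoeff f m} \<subseteq> V"
      using V f unfolding open_mps_def by blast
    show "\<exists>S. finite S \<and> {g. \<forall>m\<in>S. mcoeff g m = mcoeff f m} \<subseteq> U \<inter> V"
      by (rule exI[of _ "S \<union> T"]) (use S T in auto)
  qed
next
  fix K :: "('a, 'b) mps set set" assume "\<forall>U\<in>K. open U"
  then show "open (\<Union>K)"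
    unfolding open_mps_def by (meson Union_iff Union_upper subset_trans)
next
  fix f g :: "('a, 'b) mps" assume "f \<noteq> g"
  then obtain m where m: "mcoeff f m \<noteq> mcoeff g m"
    using mps_eqI by blast
  have op: "open {h :: ('a, 'b) mps. mcoeff h m = c}" for c
    unfolding open_mps_def by (intro ballI exI[of _ "{m}"]) auto
  show "\<exists>U V. open U \<and> open V \<and> f \<in> U \<and> g \<in> V \<and> U \<inter> V = {}"
    by (rule exI[of _ "{h. mcoeff h m = mcoeff f m}"],
        rule exI[of _ "{h. mcoeff h m = mcoeff g m}"])
      (use m op in auto)
qed

end

definition mconst :: "'a::zero \<Rightarrow> ('v, 'a) mps" where
  "mconst c = Abs_mps (\<lambda>m. if m = 0 then c else 0)"

definition mvar :: "'v \<Rightarrow> ('v, 'a::zero_neq_one) mps" where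
  "mvar v = Abs_mps (\<lambda>m. if m = Poly_Mapping.single v 1 then 1 else 0)"

definition msupp :: "('v, 'a::zero) mps \<Rightarrow> ('v \<Rightarrow>\<^sub>0 nat) set" where
  "msupp f = {m. mcoeff f m \<noteq> 0}"

definition total_degree :: "('v \<Rightarrow>\<^sub>0 nat) \<Rightarrow> nat" where
  "total_degree m = (\<Sum>i\<in>Poly_Mapping.keys m. Poly_Mapping.lookup m i)"

definition hom_component :: "nat \<Rightarrow> ('v, 'a::zero) mps \<Rightarrow> ('v, 'a) mps" where
  "hom_component k f = Abs_mps (\<lambda>m. if total_degree m = k then mcoeff f m else 0)"

text \<open>Renaming of variables along an injection.\<close>

definition mrename :: "('v \<Rightarrow> 'w) \<Rightarrow> ('v, 'a::zero) mps \<Rightarrow> ('w, 'a) mps" where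
  "mrename h f = Abs_mps (\<lambda>m. if Poly_Mapping.keys m \<subseteq> range h
                               then mcoeff f (Poly_Mapping.map_key h m) else 0)"

text \<open>Substitution of a series without constant term into a univariate power series.\<close>

definition fps_subst :: "'a::comm_ring_1 fps \<Rightarrow> ('v, 'a) mps \<Rightarrow> ('v, 'a) mps" where
  "fps_subst g z = suminf (\<lambda>k. mconst (fps_nth g k) * z ^ k)"

text \<open>The following two are meaningful for polynomials, i.e. when \<^term>\<open>msupp f\<close> is finite.\<close>

definition mpoly_degree :: "('v, 'a::zero) mps \<Rightarrow> nat" where
  "mpoly_degree f = Max (insert 0 (total_degree ` msupp f))"

definition mpoly_eval :: "('v, 'a::comm_ring_1) mps \<Rightarrow> ('v \<Rightarrow> 'a) \<Rightarrow> 'a" where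
  "mpoly_eval f x =
     (\<Sum>m\<in>msupp f. mcoeff f m * (\<Prod>i\<in>Poly_Mapping.keys m. x i ^ Poly_Mapping.lookup m i))"


section \<open>The field of rational functions in \<open>q\<close> and \<open>t\<close>\<close>

text \<open>Fractions of polynomials in \<open>t\<close> whose coefficients are polynomials in \<open>q\<close> over the rationals.\<close>

type_synonym qt = "rat poly poly fract"

definition qv :: qt where "qv = Fract [:[:0, 1:]:] 1"
definition tv :: qt where "tv = Fract [:0, 1:] 1"


section \<open>Partitions\<close>

text \<open>
  The index set of the variables \<open>x\<^sub>1, x\<^sub>2, \<dots>\<close> and of the parts \<open>\<lambda>\<^sub>1 \<ge> \<lambda>\<^sub>2 \<ge> \<dots>\<close> is shifted to
  start at 0. A partition is a weakly decreasing exponent vector, so that it is also the exponent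
  of its leading monomial, and its size is its \<^const>\<open>total_degree\<close>.
\<close>

type_synonym npart = "nat \<Rightarrow>\<^sub>0 nat"

definition partitions :: "npart set" where
  "partitions = {l. antimono (Poly_Mapping.lookup l)}"

definition plength :: "npart \<Rightarrow> nat" where
  "plength l = card (Poly_Mapping.keys l)"

definition partitions_upto :: "nat \<Rightarrow> npart set" where
  "partitions_upto N = {l \<in> partitions. plength l \<le> N}"

definition dominance_le :: "npart \<Rightarrow> npart \<Rightarrow> bool" where
  "dominance_le m l \<longleftrightarrow> total_degree m = total_degree l \<and>
     (\<forall>k. (\<Sum>i<k. Poly_Mapping.lookup m i) \<le> (\<Sum>i<k. Poly_Mapping.lookup l i))"

definition zee :: "npart \<Rightarrow> nat" where
  "zee l = (\<Prod>r\<in>Poly_Mapping.lookup l ` Poly_Mapping.keys l.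
     let k = card {i. Poly_Mapping.lookup l i = r} in r ^ k * fact k)"


section \<open>Symmetric functions\<close>

type_synonym series = "(nat, qt) mps"

definition symmetric_in :: "'v set \<Rightarrow> ('v, 'a) mps \<Rightarrow> bool" where
  "symmetric_in A f \<longleftrightarrow>
     (\<forall>\<pi>. \<pi> permutes A \<longrightarrow> (\<forall>m. mcoeff f (Poly_Mapping.map_key \<pi> m) = mcoeff f m))"

definition Sym_hat :: "series set" where
  "Sym_hat = {f. symmetric_in UNIV f}"

definition Sym :: "series set" where
  "Sym = {f \<in> Sym_hat. \<exists>d. \<forall>m\<in>msupp f. total_degree m \<le> d}"

definition Sym_poly :: "nat \<Rightarrow> series set" where
  "Sym_poly N = {f. symmetric_in {..<N} f \<and> finite (msupp f) \<and>
                    (\<forall>m\<in>msupp f. Poly_Mapping.keys m \<subseteq> {..<N})}"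

text \<open>The image of a symmetric function under \<open>x\<^sub>i \<mapsto> 0\<close> for all but the first \<open>N\<close> variables.\<close>

definition restrict_vars :: "nat \<Rightarrow> series \<Rightarrow> series" where
  "restrict_vars N f =
     Abs_mps (\<lambda>m. if Poly_Mapping.keys m \<subseteq> {..<N} then mcoeff f m else 0)"

definition msym :: "npart \<Rightarrow> series" where
  "msym l = Abs_mps (\<lambda>m. if \<exists>\<pi>. \<pi> permutes UNIV \<and> m = Poly_Mapping.map_key \<pi> l then 1 else 0)"

definition psum :: "nat \<Rightarrow> series" where
  "psum n = suminf (\<lambda>i. mvar i ^ n)"

definition psum_part :: "npart \<Rightarrow> series" where
  "psum_part l = (\<Prod>i\<in>Poly_Mapping.keys l. psum (Poly_Mapping.lookup l i))"

text \<open>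
  The Macdonald scalar product is the bilinear form on \<^const>\<open>Sym\<close> prescribed on the power sum
  basis. The conventional value 0 outside \<^const>\<open>Sym\<close> makes the form unique as a function on
  the whole type.
\<close>

definition is_macdonald_form :: "(series \<Rightarrow> series \<Rightarrow> qt) \<Rightarrow> bool" where
  "is_macdonald_form B \<longleftrightarrow>
     (\<forall>f g. f \<notin> Sym \<or> g \<notin> Sym \<longrightarrow> B f g = 0) \<and>
     (\<forall>f\<in>Sym. \<forall>g\<in>Sym. \<forall>h\<in>Sym. B (f + g) h = B f h + B g h \<and> B h (f + g) = B h f + B h g) \<and>
     (\<forall>c. \<forall>f\<in>Sym. \<forall>g\<in>Sym. B (mconst c * f) g = c * B f g \<and> B f (mconst c * g) = c * B f g) \<and>
     (\<forall>l\<in>partitions. \<forall>m\<in>partitions. B (psum_part l) (psum_part m) =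
        (if l = m then of_nat (zee l) *
           (\<Prod>i\<in>Poly_Mapping.keys l.
              (1 - qv ^ Poly_Mapping.lookup l i) / (1 - tv ^ Poly_Mapping.lookup l i))
         else 0))"

definition macdonald_form :: "series \<Rightarrow> series \<Rightarrow> qt" where
  "macdonald_form = (THE B. is_macdonald_form B)"

text \<open>Its extension to a pairing of \<^const>\<open>Sym\<close> with \<^const>\<open>Sym_hat\<close>; distinct degrees are orthogonal.\<close>

definition macdonald_pairing :: "series \<Rightarrow> series \<Rightarrow> qt" where
  "macdonald_pairing f g =
     (\<Sum>k | hom_component k f \<noteq> 0. macdonald_form (hom_component k f) (hom_component k g))"


section \<open>Macdonald and interpolation functions\<close>

text \<open>
  The Macdonald functions \<open>P\<^sub>\<lambda>(\<cdot>; q, t)\<close> are the orthogonal family that is unitriangular in the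
  monomial functions with respect to the dominance order; the Macdonald polynomial
  \<open>P\<^bsub>\<lambda>|N\<^esub>\<close> is \<^term>\<open>restrict_vars N (P l)\<close>.
\<close>

definition macdonald_functions :: "(npart \<Rightarrow> series) \<Rightarrow> bool" where
  "macdonald_functions P \<longleftrightarrow>
     (\<forall>l\<in>partitions. \<exists>u. P l =
        msym l + (\<Sum>m | m \<in> partitions \<and> dominance_le m l \<and> m \<noteq> l. mconst (u m) * msym m)) \<and>
     (\<forall>l\<in>partitions. \<forall>m\<in>partitions. l \<noteq> m \<longrightarrow> macdonald_form (P l) (P m) = 0)"

text \<open>The point \<open>X\<^sub>N(\<lambda>)\<close>, with coordinates \<open>q\<^bsup>-\<lambda>\<^sub>i\<^esup> t\<^bsup>i-1\<^esup>\<close>. Only the coordinates \<open>i < N\<close> matter.\<close>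

definition interpolation_node :: "npart \<Rightarrow> nat \<Rightarrow> qt" where
  "interpolation_node l i = inverse qv ^ Poly_Mapping.lookup l i * tv ^ i"

definition is_interpolation_polynomial ::
    "(npart \<Rightarrow> series) \<Rightarrow> nat \<Rightarrow> npart \<Rightarrow> series \<Rightarrow> bool" where
  "is_interpolation_polynomial P N \<mu> f \<longleftrightarrow>
     f \<in> Sym_poly N \<and>
     mpoly_degree f = total_degree \<mu> \<and>
     (\<forall>l\<in>partitions_upto N. l \<noteq> \<mu> \<and> total_degree l \<le> total_degree \<mu> \<longrightarrow>
        mpoly_eval f (interpolation_node l) = 0) \<and>
     hom_component (mpoly_degree f) f = restrict_vars N (P \<mu>)"

text \<open>As above, the value 0 outside \<^const>\<open>Sym\<close> is a convention ensuring uniqueness.\<close>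

definition is_phi :: "nat \<Rightarrow> (series \<Rightarrow> series) \<Rightarrow> bool" where
  "is_phi N \<phi> \<longleftrightarrow>
     (\<forall>f. f \<notin> Sym \<longrightarrow> \<phi> f = 0) \<and>
     (\<forall>f\<in>Sym. \<phi> f \<in> Sym_poly N) \<and>
     \<phi> 1 = 1 \<and>
     (\<forall>f\<in>Sym. \<forall>g\<in>Sym. \<phi> (f + g) = \<phi> f + \<phi> g \<and> \<phi> (f * g) = \<phi> f * \<phi> g) \<and>
     (\<forall>c. \<forall>f\<in>Sym. \<phi> (mconst c * f) = mconst c * \<phi> f) \<and>
     (\<forall>n\<ge>1. \<phi> (psum n) = (\<Sum>i<N. mvar i ^ n) + mconst (tv ^ (N * n) / (1 - tv ^ n)))"

definition phi :: "nat \<Rightarrow> series \<Rightarrow> series" where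
  "phi N = (THE \<phi>. is_phi N \<phi>)"

text \<open>
  \<open>IN N \<mu>\<close> stands for the interpolation polynomial \<open>I\<^bsub>\<mu>|N\<^esub>\<close> and \<open>I \<mu>\<close> for the interpolation
  function \<open>I\<^sub>\<mu>\<close>.
\<close>

definition interpolation_functions ::
    "(nat \<Rightarrow> npart \<Rightarrow> series) \<Rightarrow> (npart \<Rightarrow> series) \<Rightarrow> bool" where
  "interpolation_functions IN I \<longleftrightarrow>
     (\<forall>\<mu>\<in>partitions. I \<mu> \<in> Sym \<and> (\<forall>N\<ge>plength \<mu>. phi N (I \<mu>) = IN N \<mu>))"

definition dual_functions :: "(npart \<Rightarrow> series) \<Rightarrow> (npart \<Rightarrow> series) \<Rightarrow> bool" where
  "dual_functions I H \<longleftrightarrow>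
     (\<forall>\<nu>\<in>partitions. H \<nu> \<in> Sym_hat) \<and>
     (\<forall>\<mu>\<in>partitions. \<forall>\<nu>\<in>partitions. macdonald_pairing (I \<mu>) (H \<nu>) = (if \<mu> = \<nu> then 1 else 0))"


section \<open>The two alphabets and the kernel\<close>

text \<open>Series in the \<open>x\<^sub>i\<close> and \<open>y\<^sub>j\<close> jointly have the variables \<^term>\<open>Inl i\<close> and \<^term>\<open>Inr j\<close>.\<close>

definition in_x :: "series \<Rightarrow> (nat + nat, qt) mps" where
  "in_x = mrename Inl"

definition in_y :: "series \<Rightarrow> (nat + nat, qt) mps" where
  "in_y = mrename Inr"

text \<open>\<open>(z; q)\<^sub>\<infinity> = exp (- \<Sum>\<^bsub>m\<ge>1\<^esub> z\<^bsup>m\<^esup> / (m (1 - q\<^bsup>m\<^esup>)))\<close> as a power series in \<open>z\<close>.\<close>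

definition qpoch_inf :: "qt fps" where
  "qpoch_inf = fps_compose (fps_exp 1)
     (- Abs_fps (\<lambda>m. if m = 0 then 0 else 1 / of_nat m * (1 / (1 - qv ^ m))))"

text \<open>\<open>(tz; q)\<^sub>\<infinity> / (z; q)\<^sub>\<infinity>\<close> as a power series in \<open>z\<close>.\<close>

definition qpoch_ratio :: "qt fps" where
  "qpoch_ratio = fps_compose qpoch_inf (fps_const tv * fps_X) / qpoch_inf"

definition cauchy_factor :: "nat \<Rightarrow> nat \<Rightarrow> (nat + nat, qt) mps" where
  "cauchy_factor i j = fps_subst qpoch_ratio (mvar (Inl i) * mvar (Inr j))"

end

theory Submission
  imports Defs
begin

text \<open>
  Both sides equal \<open>\<Sum>\<^sub>\<lambda> p\<^sub>\<lambda>(x) p\<^sub>\<lambda>(y) / \<langle>p\<^sub>\<lambda>, p\<^sub>\<lambda>\<rangle>\<close>. On the left, \<open>\<phi>\<^sub>N\<close> does not change the top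
  degree, so \<open>I\<^sub>\<mu>\<close> has top component \<open>P\<^sub>\<mu>\<close>; hence the \<open>I\<^sub>\<mu>\<close> with \<open>|\<mu>| \<le> d\<close> span the symmetric
  functions of degree at most \<open>d\<close>, duality gives \<open>p\<^sub>\<lambda> = \<Sum>\<^sub>\<mu> \<langle>p\<^sub>\<lambda>, H\<^sub>\<mu>\<rangle> I\<^sub>\<mu>\<close>, and this is substituted
  into the kernel, while \<open>H\<^sub>\<mu> = \<Sum>\<^sub>\<lambda> \<langle>p\<^sub>\<lambda>, H\<^sub>\<mu>\<rangle> p\<^sub>\<lambda> / \<langle>p\<^sub>\<lambda>, p\<^sub>\<lambda>\<rangle>\<close>. On the right, the product and the
  kernel have constant term 1 and the same logarithmic derivative with respect to the Euler
  operator \<open>\<Sum>\<^sub>v v \<partial>/\<partial>v\<close>, which determines a series in characteristic 0; this also yields the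
  convergence of the products. Partitions are handled through the multiset of their parts.
\<close>

text \<open>\<open>macdonald_form\<close> and \<open>phi N\<close> are definite descriptions, so
  neither can be evaluated before a model is built and shown to be the only one. Both models are
  written in the coefficients \<open>psum_coeff f M\<close> of f in the power sum products. These
  exist degree by degree, hence also for series of unbounded degree, and are unique because the
  transition to monomial orbits is triangular.

  The functions \<open>I \<mu>\<close> are reached only through their images in N variables. A
  monomial of degree d involves at most d variables, so by symmetry its coefficient can be read off
  as soon as N \<ge> d; this is how the top component is lifted to infinitely many variables.

  \<open>prodinf\<close> is a definite description as well. The logarithmic derivative takes the
  place of estimates: at a monomial m the equation \<open>euler F = A * F\<close> involves only the
  finitely many divisors of m, so convergence and equality can both be tested one monomial at a
  time. The sum on the left converges because duality forces \<open>H \<mu>\<close> to have no terms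
  of degree below the size of \<mu>.\<close>

abbreviation lookup :: "('a \<Rightarrow>\<^sub>0 'b::zero) \<Rightarrow> 'a \<Rightarrow> 'b" where "lookup \<equiv> Poly_Mapping.lookup"
abbreviation keys :: "('a \<Rightarrow>\<^sub>0 'b::zero) \<Rightarrow> 'a set" where "keys \<equiv> Poly_Mapping.keys"
abbreviation single :: "'a \<Rightarrow> 'b \<Rightarrow> ('a \<Rightarrow>\<^sub>0 'b::zero)" where "single \<equiv> Poly_Mapping.single"
abbreviation map_key :: "('a \<Rightarrow> 'b) \<Rightarrow> ('b \<Rightarrow>\<^sub>0 'c::zero) \<Rightarrow> ('a \<Rightarrow>\<^sub>0 'c)"
  where "map_key \<equiv> Poly_Mapping.map_key"

section \<open>Coefficients and degrees\<close>

lemma mcoeff_zero [simp]: "mcoeff (0 :: ('v, 'a::comm_ring_1) mps) m = 0"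
  by (simp add: zero_mps.rep_eq)

lemma mcoeff_one: "mcoeff (1 :: ('v, 'a::comm_ring_1) mps) m = (if m = 0 then 1 else 0)"
  by (simp add: one_mps.rep_eq)

lemma mcoeff_add [simp]: "mcoeff (f + g :: ('v, 'a::comm_ring_1) mps) m = mcoeff f m + mcoeff g m"
  by (simp add: plus_mps.rep_eq)

lemma mcoeff_diff [simp]: "mcoeff (f - g :: ('v, 'a::comm_ring_1) mps) m = mcoeff f m - mcoeff g m"
  by (simp add: minus_mps.rep_eq)

lemma mcoeff_sum [simp]:
  "mcoeff (sum f A :: ('v, 'a::comm_ring_1) mps) m = (\<Sum>x\<in>A. mcoeff (f x) m)"
  by (induction A rule: infinite_finite_induct) auto

lemma mcoeff_times:
  "mcoeff (f * g :: ('v, 'a::comm_ring_1) mps) m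
     = (\<Sum>p | fst p + snd p = m. mcoeff f (fst p) * mcoeff g (snd p))"
  by (simp add: times_mps.rep_eq split_def)

lemma finite_splittings [simp, intro]: "finite {p :: ('v \<Rightarrow>\<^sub>0 nat) \<times> ('v \<Rightarrow>\<^sub>0 nat). fst p + snd p = m}"
  using finite_exponent_splittings[of m] by (simp add: split_def)

lemma mcoeff_mconst: "mcoeff (mconst c) m = (if m = 0 then c else 0)"
  by (simp add: mconst_def)

lemma mcoeff_times_0: "mcoeff (f * g :: ('v, 'a::comm_ring_1) mps) 0 = mcoeff f 0 * mcoeff g 0"
proof -
  have "{p. fst p + snd p = (0 :: 'v \<Rightarrow>\<^sub>0 nat)} = {(0, 0)}"
    by (auto simp: poly_mapping_eq_iff lookup_add fun_eq_iff)
  then show ?thesis by (simp add: mcoeff_times)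
qed

text \<open>Subtraction of exponents is truncated, so b = m - a recovers the cofactor only under the
  pointwise bound, which is divisibility of monomials.\<close>

lemma exponent_split_iff:
  fixes a b m :: "'v \<Rightarrow>\<^sub>0 nat"
  shows "a + b = m \<longleftrightarrow> (\<forall>i. lookup a i \<le> lookup m i) \<and> b = m - a"
proof -
  have "lookup a i + lookup b i = lookup m i
      \<longleftrightarrow> lookup a i \<le> lookup m i \<and> lookup b i = lookup m i - lookup a i" for i
    by linarith
  then show ?thesis
    unfolding poly_mapping_eq_iff fun_eq_iff lookup_add lookup_minus by blast
qed

lemma exponent_dvd_iff:
  fixes a m :: "'v \<Rightarrow>\<^sub>0 nat"
  shows "(\<exists>b. a + b = m) \<longleftrightarrow> (\<forall>i. lookup a i \<le> lookup m i)"
  by (simp add: exponent_split_iff)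

lemma single_dvd_iff: "(\<forall>j. lookup (single i r) j \<le> lookup m j) \<longleftrightarrow> r \<le> lookup m i"
  for m :: "'v \<Rightarrow>\<^sub>0 nat"
  by (auto simp: lookup_single when_def)

text \<open>The monomial is kept in the raw form \<open>Abs_mps\<close> so that one shift formula
  serves constants (a = 0) and powers of variables alike.\<close>

lemma mcoeff_monomial_times:
  fixes f :: "('v, 'a::comm_ring_1) mps"
  shows "mcoeff (Abs_mps (\<lambda>m. if m = a then c else 0) * f) m
           = (if \<forall>i. lookup a i \<le> lookup m i then c * mcoeff f (m - a) else 0)"
proof -
  have "mcoeff (Abs_mps (\<lambda>m. if m = a then c else 0) * f) m
      = (\<Sum>p\<in>{p. fst p + snd p = m} \<inter> {p. fst p = a}. c * mcoeff f (snd p))"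
    unfolding mcoeff_times by (rule sum.mono_neutral_cong_right) auto
  also have "{p. fst p + snd p = m} \<inter> {p. fst p = a}
      = (if \<forall>i. lookup a i \<le> lookup m i then {(a, m - a)} else {})"
    by (auto simp: exponent_split_iff)
  finally show ?thesis by simp
qed

lemma mcoeff_mconst_times [simp]:
  "mcoeff (mconst c * f :: ('v, 'a::comm_ring_1) mps) m = c * mcoeff f m"
  unfolding mconst_def mcoeff_monomial_times by simp

lemma mconst_0 [simp]: "mconst 0 = (0 :: ('v, 'a::comm_ring_1) mps)"
  by (rule mps_eqI) (simp add: mcoeff_mconst)

lemma mconst_1 [simp]: "mconst 1 = (1 :: ('v, 'a::comm_ring_1) mps)"
  by (rule mps_eqI) (simp add: mcoeff_mconst mcoeff_one)

lemma mconst_add: "mconst (c + d) = (mconst c + mconst d :: ('v, 'a::comm_ring_1) mps)"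
  by (rule mps_eqI) (simp add: mcoeff_mconst)

lemma mconst_mult: "mconst (c * d) = (mconst c * mconst d :: ('v, 'a::comm_ring_1) mps)"
  by (rule mps_eqI) (simp add: mcoeff_mconst)

lemma mconst_sum: "mconst (sum c A) = (\<Sum>x\<in>A. mconst (c x) :: ('v, 'a::comm_ring_1) mps)"
  by (rule mps_eqI) (simp add: mcoeff_mconst)

lemma monomial_mult_monomial:
  "Abs_mps (\<lambda>m. if m = a then c else 0) * Abs_mps (\<lambda>m. if m = b then d else 0)
     = (Abs_mps (\<lambda>m. if m = a + b then c * d else 0) :: ('v, 'a::comm_ring_1) mps)"
proof (rule mps_eqI)
  fix m :: "'v \<Rightarrow>\<^sub>0 nat"
  have "m - a = b \<and> (\<forall>i. lookup a i \<le> lookup m i) \<longleftrightarrow> m = a + b"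
    using exponent_split_iff[of a b m] by auto
  then show "mcoeff (Abs_mps (\<lambda>m. if m = a then c else 0) * Abs_mps (\<lambda>m. if m = b then d else 0)) m
     = mcoeff (Abs_mps (\<lambda>m. if m = a + b then c * d else 0) :: ('v, 'a::comm_ring_1) mps) m"
    unfolding mcoeff_monomial_times by auto
qed

lemma mvar_power:
  "mvar v ^ n = (Abs_mps (\<lambda>m. if m = single v n then 1 else 0) :: ('v, 'a::comm_ring_1) mps)"
proof (induction n)
  case 0
  show ?case by (rule mps_eqI) (simp add: mcoeff_one)
next
  case (Suc n)
  show ?case
    unfolding power_Suc Suc.IH
    by (simp add: mvar_def monomial_mult_monomial single_add[symmetric] cong: if_cong)
qed

lemma mcoeff_mvar_power:
  "mcoeff (mvar v ^ n :: ('v, 'a::comm_ring_1) mps) m = (if m = single v n then 1 else 0)"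
  by (simp add: mvar_power)

lemma total_degree_superset:
  "finite K \<Longrightarrow> keys m \<subseteq> K \<Longrightarrow> total_degree m = (\<Sum>i\<in>K. lookup m i)"
  unfolding total_degree_def by (rule sum.mono_neutral_left) (auto simp: in_keys_iff)

lemma total_degree_add [simp]: "total_degree (a + b) = total_degree a + total_degree b"
proof -
  let ?K = "keys a \<union> keys b"
  have "total_degree (a + b) = (\<Sum>i\<in>?K. lookup (a + b) i)"
    by (rule total_degree_superset) (auto simp: keys_add)
  also have "\<dots> = total_degree a + total_degree b"
    by (simp add: lookup_add sum.distrib total_degree_superset[of ?K a] total_degree_superset[of ?K b])
  finally show ?thesis .
qed

lemma total_degree_single [simp]: "total_degree (single i r) = r"
  by (auto simp: total_degree_def)

lemma total_degree_zero [simp]: "total_degree 0 = 0"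
  by (simp add: total_degree_def)

lemma total_degree_eq_0_iff [simp]: "total_degree m = 0 \<longleftrightarrow> m = 0"
proof
  assume "total_degree m = 0"
  then have "\<forall>i\<in>keys m. lookup m i = 0" by (simp add: total_degree_def)
  then show "m = 0" by (auto simp: poly_mapping_eq_iff in_keys_iff fun_eq_iff)
qed simp

lemma lookup_le_total_degree: "lookup m i \<le> total_degree m"
proof (cases "i \<in> keys m")
  case True
  then show ?thesis unfolding total_degree_def by (intro member_le_sum) auto
qed (simp add: in_keys_iff)

section \<open>Convergence\<close>

lemma open_mcoeff: "open {h :: ('v, 'a) mps. mcoeff h m = c}"
  unfolding open_mps_def by (intro ballI exI[of _ "{m}"]) auto

text \<open>A basic neighbourhood fixes finitely many coefficients, and finitely many eventual
  conditions hold simultaneously; no uniformity over m is involved.\<close>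

lemma tendsto_mps_iff:
  fixes L :: "('v, 'a) mps"
  shows "(f \<longlongrightarrow> L) F \<longleftrightarrow> (\<forall>m. eventually (\<lambda>x. mcoeff (f x) m = mcoeff L m) F)"
proof
  assume "(f \<longlongrightarrow> L) F"
  then show "\<forall>m. eventually (\<lambda>x. mcoeff (f x) m = mcoeff L m) F"
    using topological_tendstoD[OF _ open_mcoeff] by fastforce
next
  assume *: "\<forall>m. eventually (\<lambda>x. mcoeff (f x) m = mcoeff L m) F"
  show "(f \<longlongrightarrow> L) F"
  proof (rule topological_tendstoI)
    fix U :: "('v, 'a) mps set" assume "open U" "L \<in> U"
    then obtain S where S: "finite S" "{g. \<forall>m\<in>S. mcoeff g m = mcoeff L m} \<subseteq> U"
      unfolding open_mps_def by blast
    have "eventually (\<lambda>x. \<forall>m\<in>S. mcoeff (f x) m = mcoeff L m) F"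
      using S(1) * by (simp add: eventually_ball_finite)
    then show "eventually (\<lambda>x. f x \<in> U) F"
      by eventually_elim (use S(2) in auto)
  qed
qed

lemma sums_mps:
  fixes f :: "nat \<Rightarrow> ('v, 'a::comm_ring_1) mps"
  assumes "\<And>m. finite {i. mcoeff (f i) m \<noteq> 0}"
    and "\<And>m. mcoeff S m = (\<Sum>i | mcoeff (f i) m \<noteq> 0. mcoeff (f i) m)"
  shows "f sums S"
  unfolding sums_def tendsto_mps_iff
proof
  fix m
  obtain N where N: "{i. mcoeff (f i) m \<noteq> 0} \<subseteq> {..<N}"
    using assms(1) finite_nat_iff_bounded by blast
  have "mcoeff (\<Sum>i<n. f i) m = mcoeff S m" if "n \<ge> N" for n
  proof -
    have "(\<Sum>i | mcoeff (f i) m \<noteq> 0. mcoeff (f i) m) = (\<Sum>i<n. mcoeff (f i) m)"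
      by (rule sum.mono_neutral_left) (use N that in auto)
    then show ?thesis by (simp add: assms(2))
  qed
  then show "\<forall>\<^sub>F n in sequentially. mcoeff (\<Sum>i<n. f i) m = mcoeff S m"
    unfolding eventually_sequentially by blast
qed

text \<open>\<open>T m\<close> may be larger than the set of indices that contribute to m, so a
  degree bound on the indices is enough and the exact support need not be known.\<close>

lemma has_sum_mps:
  fixes f :: "'i \<Rightarrow> ('v, 'a::comm_ring_1) mps"
  assumes "\<And>m. finite (T m)" "\<And>m. T m \<subseteq> A"
    and "\<And>m i. i \<in> A \<Longrightarrow> i \<notin> T m \<Longrightarrow> mcoeff (f i) m = 0"
    and "\<And>m. mcoeff S m = (\<Sum>i\<in>T m. mcoeff (f i) m)"
  shows "(f has_sum S) A"
  unfolding has_sum_def tendsto_mps_iff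
proof
  fix m
  have "mcoeff (sum f X) m = mcoeff S m" if "finite X" "T m \<subseteq> X" "X \<subseteq> A" for X
  proof -
    have "(\<Sum>i\<in>T m. mcoeff (f i) m) = (\<Sum>i\<in>X. mcoeff (f i) m)"
      by (rule sum.mono_neutral_left) (use that assms(3) in auto)
    then show ?thesis by (simp add: assms(4))
  qed
  then show "\<forall>\<^sub>F X in finite_subsets_at_top A. mcoeff (sum f X) m = mcoeff S m"
    unfolding eventually_finite_subsets_at_top using assms(1,2) by metis
qed

section \<open>Logarithmic derivatives and infinite products\<close>

text \<open>Given by its eigenvalues on monomials, which avoids an infinite sum of partial
  derivatives when there are infinitely many variables.\<close>

definition euler :: "('v, 'a::comm_ring_1) mps \<Rightarrow> ('v, 'a) mps" where
  "euler f = Abs_mps (\<lambda>m. of_nat (total_degree m) * mcoeff f m)"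

lemma mcoeff_euler [simp]: "mcoeff (euler f) m = of_nat (total_degree m) * mcoeff f m"
  by (simp add: euler_def)

lemma euler_mult: "euler (f * g) = euler f * g + f * euler g"
proof (rule mps_eqI)
  fix m
  have "of_nat (total_degree m) * (\<Sum>p | fst p + snd p = m. mcoeff f (fst p) * mcoeff g (snd p))
    = (\<Sum>p | fst p + snd p = m. of_nat (total_degree (fst p)) * mcoeff f (fst p) * mcoeff g (snd p)
        + mcoeff f (fst p) * (of_nat (total_degree (snd p)) * mcoeff g (snd p)))"
    unfolding sum_distrib_left
  proof (rule sum.cong[OF refl], goal_cases)
    case (1 p)
    then have "m = fst p + snd p" by simp
    then show ?case by (simp add: algebra_simps)
  qed
  then show "mcoeff (euler (f * g)) m = mcoeff (euler f * g + f * euler g) m"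
    by (simp add: mcoeff_times sum.distrib)
qed

text \<open>As A has no constant term, the coefficient of m in A * F uses F only at proper divisors
  of m. In characteristic 0 the equation is therefore a recursion on the degree. Since A and B have
  to agree only at divisors of m, it can be applied to partial products whose logarithmic
  derivatives have stabilised there and nowhere else.\<close>

lemma log_derivative_local:
  fixes F G A B :: "('v, 'a::{idom, ring_char_0}) mps"
  assumes F: "euler F = A * F" and G: "euler G = B * G" and "mcoeff F 0 = mcoeff G 0"
    and "mcoeff A 0 = 0"
    and "\<forall>a. (\<exists>b. a + b = m) \<longrightarrow> mcoeff A a = mcoeff B a"
  shows "mcoeff F m = mcoeff G m"
  using assms(5)
proof (induction "total_degree m" arbitrary: m rule: less_induct)
  case less
  show ?case
  proof (cases "m = 0")
    case False
    have "mcoeff A (fst p) * mcoeff F (snd p) = mcoeff B (fst p) * mcoeff G (snd p)"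
      if p: "fst p + snd p = m" for p
    proof -
      have AB: "mcoeff A (fst p) = mcoeff B (fst p)" using less.prems p by blast
      show ?thesis
      proof (cases "fst p = 0")
        case True
        then show ?thesis using AB assms(4) by simp
      next
        case nz: False
        have "total_degree (fst p) + total_degree (snd p) = total_degree m"
          using p total_degree_add by metis
        then have "total_degree (snd p) < total_degree m"
          using nz total_degree_eq_0_iff[of "fst p"] by linarith
        moreover have "\<exists>c. a + c = m" if "\<exists>c. a + c = snd p" for a
          using that p by (metis add.assoc add.commute)
        ultimately have "mcoeff F (snd p) = mcoeff G (snd p)"
          using less by blast
        then show ?thesis using AB by simp
      qed
    qed
    then have "mcoeff (A * F) m = mcoeff (B * G) m"
      unfolding mcoeff_times by (intro sum.cong) auto
    then have "of_nat (total_degree m) * mcoeff F m = of_nat (total_degree m) * mcoeff G m"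
      using F G by (metis mcoeff_euler)
    then show ?thesis using False by simp
  qed (use assms(3) in simp)
qed

text \<open>The partial products G n satisfy the same equation with the partial sums B n. On the
  finite set of divisors of m the B n are eventually constant, so by
  \<open>log_derivative_local\<close> the coefficients of G n at m are too: convergence of the
  product follows from that of the sum.\<close>

lemma has_prod_log_derivative:
  fixes g A :: "nat \<Rightarrow> ('v, 'a::{idom, ring_char_0}) mps"
  assumes g: "\<And>n. euler (g n) = A n * g n" "\<And>n. mcoeff (g n) 0 = 1"
    and A0: "\<And>n. mcoeff (A n) 0 = 0"
    and fin: "\<And>m. finite {n. mcoeff (A n) m \<noteq> 0}"
    and S: "\<And>m. mcoeff S m = (\<Sum>n | mcoeff (A n) m \<noteq> 0. mcoeff (A n) m)"
  shows "euler (prodinf g) = S * prodinf g \<and> mcoeff (prodinf g) 0 = 1"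
proof -
  define G where "G n = (\<Prod>i\<le>n. g i)" for n
  define B where "B n = (\<Sum>i\<le>n. A i)" for n
  have G: "euler (G n) = B n * G n" "mcoeff (G n) 0 = 1" "mcoeff (B n) 0 = 0" for n
    by (induction n) (simp_all add: G_def B_def g A0 euler_mult mcoeff_times_0 algebra_simps)
  have S0: "mcoeff S 0 = 0" by (simp add: S A0)
  have "A sums S" by (rule sums_mps) (use fin S in auto)
  then have B: "B \<longlonglongrightarrow> S" unfolding B_def sums_def_le .
  have "\<forall>m. \<exists>N. \<forall>n\<ge>N. mcoeff (G n) m = mcoeff (G N) m"
  proof
    fix m
    have "\<forall>\<^sub>F n in sequentially. \<forall>a\<in>{a. \<forall>i. lookup a i \<le> lookup m i}. mcoeff (B n) a = mcoeff S a"
      using B finite_exponents_le unfolding tendsto_mps_iff by (intro eventually_ball_finite) auto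
    then obtain N where N: "\<forall>n\<ge>N. \<forall>a. (\<exists>b. a + b = m) \<longrightarrow> mcoeff (B n) a = mcoeff S a"
      unfolding eventually_sequentially exponent_dvd_iff by auto
    have "mcoeff (G n) m = mcoeff (G N) m" if "n \<ge> N" for n
      by (rule log_derivative_local[OF G(1) G(1)]) (use G(2,3) N that in auto)
    then show "\<exists>N. \<forall>n\<ge>N. mcoeff (G n) m = mcoeff (G N) m" by blast
  qed
  then obtain N where N: "\<And>m n. n \<ge> N m \<Longrightarrow> mcoeff (G n) m = mcoeff (G (N m)) m"
    by metis
  define L where "L = Abs_mps (\<lambda>m. mcoeff (G (N m)) m)"
  have lim: "G \<longlonglongrightarrow> L"
    unfolding tendsto_mps_iff eventually_sequentially L_def mcoeff_Abs_mps using N by blast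
  have L0: "mcoeff L 0 = 1" by (simp add: L_def G(2))
  have prod: "g has_prod L"
    unfolding has_prod_def raw_has_prod_def
  proof (intro disjI1 conjI)
    show "L \<noteq> 0" using L0 by force
    show "(\<lambda>n. \<Prod>i\<le>n. g (i + 0)) \<longlonglongrightarrow> L" using lim by (simp add: G_def[abs_def])
  qed
  \<comment> \<open>\<open>has_prod\<close> also allows a value 0 caused by a zero factor. Constant
    terms 1 exclude zero factors, which leaves the plain limit, and that is unique.\<close>
  have "p = L" if "g has_prod p" for p
  proof -
    have "g i \<noteq> 0" for i using g(2)[of i] by force
    then have "raw_has_prod g 0 p" using that unfolding has_prod_def by blast
    then have "G \<longlonglongrightarrow> p" by (simp add: raw_has_prod_def G_def[abs_def])
    then show ?thesis using lim by (rule LIMSEQ_unique)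
  qed
  with prod have L: "prodinf g = L" unfolding prodinf_def by (rule the_equality)
  have "euler L = S * L"
  proof (rule mps_eqI)
    fix m
    \<comment> \<open>Only finitely many splittings of m enter the product, so a single n serves all
      of them and the equation passes to the limit.\<close>
    have "\<forall>\<^sub>F n in sequentially. \<forall>p\<in>{p. fst p + snd p = m}.
        mcoeff (B n) (fst p) = mcoeff S (fst p) \<and> mcoeff (G n) (snd p) = mcoeff L (snd p)"
      using B lim unfolding tendsto_mps_iff
      by (intro eventually_ball_finite ballI eventually_conj) auto
    moreover have "\<forall>\<^sub>F n in sequentially. mcoeff (G n) m = mcoeff L m"
      using lim unfolding tendsto_mps_iff by blast
    ultimately have "\<forall>\<^sub>F n in sequentially. mcoeff (euler L) m = mcoeff (S * L) m"
    proof eventually_elim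
      case (elim n)
      have "mcoeff (euler L) m = mcoeff (B n * G n) m"
        using elim(2) G(1) by (metis mcoeff_euler)
      also have "\<dots> = mcoeff (S * L) m"
        unfolding mcoeff_times by (rule sum.cong) (use elim(1) in auto)
      finally show ?case .
    qed
    then show "mcoeff (euler L) m = mcoeff (S * L) m" by simp
  qed
  then show ?thesis using L L0 by simp
qed

section \<open>Exponents and multisets of parts\<close>

text \<open>The complete invariant of exponents under permutation of the variables. A symmetric
  series is a function of it, and a partition is the sorted representative of one of its
  values.\<close>

definition parts_mset :: "('v \<Rightarrow>\<^sub>0 nat) \<Rightarrow> nat multiset" where
  "parts_mset m = image_mset (lookup m) (mset_set (keys m))"

lemma size_parts_mset [simp]: "size (parts_mset m) = card (keys m)"
  by (simp add: parts_mset_def)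

lemma sum_mset_parts_mset [simp]: "sum_mset (parts_mset m) = total_degree m"
  by (simp add: parts_mset_def total_degree_def sum_unfold_sum_mset)

lemma zero_notin_parts_mset [simp]: "0 \<notin># parts_mset m"
  by (auto simp: parts_mset_def in_keys_iff)

lemma parts_mset_zero [simp]: "parts_mset 0 = {#}"
  by (simp add: parts_mset_def)

lemma parts_mset_eq_empty_iff [simp]: "parts_mset m = {#} \<longleftrightarrow> m = 0"
  by (simp add: parts_mset_def mset_set_empty_iff)

text \<open>Padding with zeros brings two exponents with different supports over one finite set,
  where they can be compared by a permutation.\<close>

lemma parts_mset_superset:
  assumes "finite A" "keys m \<subseteq> A"
  shows "image_mset (lookup m) (mset_set A) = parts_mset m + replicate_mset (card A - card (keys m)) 0"
proof -
  have "mset_set A = mset_set (keys m) + mset_set (A - keys m)"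
    using assms mset_set_Union[of "keys m" "A - keys m"] by (simp add: Un_absorb1)
  moreover have "image_mset (lookup m) (mset_set (A - keys m)) = image_mset (\<lambda>_. 0) (mset_set (A - keys m))"
    by (rule image_mset_cong) (use assms(1) in \<open>auto simp: in_keys_iff\<close>)
  ultimately show ?thesis
    using assms by (simp add: parts_mset_def image_mset_const_eq card_Diff_subset)
qed

lemma parts_mset_add_single:
  assumes "i \<notin> keys m" "r \<noteq> 0"
  shows "parts_mset (m + single i r) = add_mset r (parts_mset m)"
proof -
  have "lookup m i = 0" using assms by (simp add: in_keys_iff)
  moreover have "keys (m + single i r) = insert i (keys m)"
    using assms by (auto simp: in_keys_iff lookup_add lookup_single when_def split: if_splits)
  moreover have "image_mset (lookup (m + single i r)) (mset_set (keys m)) = parts_mset m"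
    unfolding parts_mset_def
    by (rule image_mset_cong) (use assms in \<open>auto simp: lookup_add lookup_single when_def\<close>)
  ultimately show ?thesis
    using assms by (simp add: parts_mset_def lookup_add)
qed

lemma parts_mset_map_key:
  assumes "bij \<pi>"
  shows "parts_mset (map_key \<pi> m) = parts_mset m"
proof -
  have inj: "inj \<pi>" and surj: "surj \<pi>" using assms by (auto simp: bij_def)
  have "parts_mset m = image_mset (lookup m) (mset_set (\<pi> ` (\<pi> -` keys m)))"
    using surj by (simp add: parts_mset_def surj_image_vimage_eq)
  also have "\<dots> = image_mset (lookup m) (image_mset \<pi> (mset_set (\<pi> -` keys m)))"
    by (simp add: image_mset_mset_set inj_on_subset[OF inj])
  also have "\<dots> = parts_mset (map_key \<pi> m)"
    unfolding parts_mset_def using inj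
    by (simp add: keys_map_key map_key.rep_eq multiset.map_comp)
  finally show ?thesis ..
qed

text \<open>Equal multisets have equally many parts, hence the same zero padding over the union of
  the two supports. A permutation of this finite set then matches the exponents and is the identity
  elsewhere.\<close>

lemma parts_mset_eq_imp_permuted:
  assumes "parts_mset m = parts_mset m'"
  obtains \<pi> where "\<pi> permutes UNIV" "m' = map_key \<pi> m"
proof -
  let ?A = "keys m \<union> keys m'"
  have "card (keys m) = card (keys m')" using assms by (metis size_parts_mset)
  then have "image_mset (lookup m') (mset_set ?A) = image_mset (lookup m) (mset_set ?A)"
    using assms parts_mset_superset[of ?A m] parts_mset_superset[of ?A m'] by simp
  then obtain p where p: "p permutes ?A" "\<forall>x\<in>?A. lookup m' x = lookup m (p x)"
    using image_mset_eq_implies_permutes[of ?A "lookup m'" "lookup m"] by auto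
  have "lookup m' x = lookup m (p x)" for x
  proof (cases "x \<in> ?A")
    case False
    then have "p x = x" using p(1) by (simp add: permutes_not_in)
    then show ?thesis using False by (simp add: in_keys_iff)
  qed (use p(2) in blast)
  then have "m' = map_key p m"
    using p(1) by (intro poly_mapping_eqI) (simp add: map_key.rep_eq permutes_inj)
  moreover have "p permutes UNIV" using p(1) permutes_subset by blast
  ultimately show ?thesis using that by blast
qed

lemma permuted_iff_parts_mset: "(\<exists>\<pi>. \<pi> permutes UNIV \<and> m' = map_key \<pi> m) \<longleftrightarrow> parts_mset m' = parts_mset m"
  using parts_mset_eq_imp_permuted[of m m'] parts_mset_map_key permutes_bij by metis

lemma mcoeff_msym: "mcoeff (msym l) m = (if parts_mset m = parts_mset l then 1 else 0)"
  by (simp add: msym_def permuted_iff_parts_mset)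

lemma Sym_hat_iff: "f \<in> Sym_hat \<longleftrightarrow> (\<forall>m m'. parts_mset m = parts_mset m' \<longrightarrow> mcoeff f m = mcoeff f m')"
  unfolding Sym_hat_def symmetric_in_def mem_Collect_eq
  by (metis parts_mset_eq_imp_permuted parts_mset_map_key permutes_bij)

section \<open>Partitions as sorted representatives of multisets\<close>

lemma keys_partition:
  assumes "l \<in> partitions"
  shows "keys l = {..<plength l}"
proof -
  define n where "n = (LEAST n. n \<notin> keys l)"
  have "\<exists>n. n \<notin> keys l"
    using ex_new_if_finite infinite_UNIV_nat finite_keys by metis
  then have n: "n \<notin> keys l" unfolding n_def by (rule LeastI_ex)
  have "keys l = {..<n}"
  proof safe
    fix i assume i: "i \<in> keys l"
    show "i < n"
    proof (rule ccontr)
      assume "\<not> i < n"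
      then have "lookup l i \<le> lookup l n"
        using assms antimonoD[of "lookup l" n i] by (simp add: partitions_def)
      then show False using i n by (simp add: in_keys_iff)
    qed
  next
    fix i assume "i < n"
    then show "i \<in> keys l" unfolding n_def using not_less_Least by blast
  qed
  then show ?thesis by (simp add: plength_def)
qed

lemma plength_le_total_degree: "plength l \<le> total_degree l"
proof -
  have "plength l = (\<Sum>i\<in>keys l. 1)" by (simp add: plength_def)
  also have "\<dots> \<le> total_degree l"
    unfolding total_degree_def by (intro sum_mono) (simp add: in_keys_iff Suc_le_eq)
  finally show ?thesis .
qed

text \<open>Read backwards, the parts of a partition form an increasing list, and a sorted list is
  determined by its multiset.\<close>

lemma parts_mset_inj_partitions:
  assumes "l \<in> partitions" "l' \<in> partitions" "parts_mset l = parts_mset l'"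
  shows "l = l'"
proof -
  have parts: "rev (map (lookup l) [0..<plength l]) = sorted_list_of_multiset (parts_mset l)"
    if l: "l \<in> partitions" for l
  proof -
    have "sorted (rev (map (lookup l) [0..<plength l]))"
      using l antimonoD[of "lookup l"] by (simp add: sorted_rev_iff_nth_mono partitions_def)
    then have "rev (map (lookup l) [0..<plength l])
        = sorted_list_of_multiset (mset (rev (map (lookup l) [0..<plength l])))"
      by (simp only: sorted_list_of_multiset_mset sorted_sort_id)
    then show ?thesis
      by (simp add: parts_mset_def keys_partition[OF l] mset_set_upto_eq_mset_upto)
  qed
  have len: "plength l = plength l'"
    using assms(3) unfolding plength_def by (metis size_parts_mset)
  have "rev (map (lookup l) [0..<plength l]) = rev (map (lookup l') [0..<plength l'])"
    using parts assms by simp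
  then have *: "lookup l i = lookup l' i" if "i < plength l" for i
    using that len by simp
  show "l = l'"
  proof (rule poly_mapping_eqI)
    fix i
    show "lookup l i = lookup l' i"
    proof (cases "i < plength l")
      case False
      then have "i \<notin> keys l" "i \<notin> keys l'" using keys_partition assms len by auto
      then show ?thesis by (simp add: in_keys_iff)
    qed (rule *)
  qed
qed

text \<open>The decreasing list of the elements of M, continued by the default value 0. Absence of 0
  from M makes the support exactly the index range of the list.\<close>

lemma partition_with_parts_mset:
  assumes "0 \<notin># M"
  obtains l where "l \<in> partitions" "parts_mset l = M"
proof
  let ?xs = "rev (sorted_list_of_multiset M)"
  let ?l = "Poly_Mapping.nth ?xs"
  have pos: "?xs ! i \<noteq> 0" if "i < length ?xs" for i
  proof -
    have "?xs ! i \<in> set ?xs" using that by (rule nth_mem)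
    then show ?thesis using assms by (metis mset_rev mset_sorted_list_of_multiset set_mset_mset)
  qed
  show "?l \<in> partitions"
    unfolding partitions_def mem_Collect_eq
  proof (rule antimonoI)
    fix i j :: nat assume "i \<le> j"
    then show "lookup ?l j \<le> lookup ?l i"
      using sorted_rev_nth_mono[of ?xs i j] by (auto simp: nth_default_def simp del: length_rev)
  qed
  have "keys ?l = {..<length ?xs}"
    using pos by (auto simp: in_keys_iff nth_default_def simp del: length_rev keys_nth split: if_splits)
  then have "parts_mset ?l = mset (map (nth_default 0 ?xs) [0..<length ?xs])"
    by (simp add: parts_mset_def mset_set_upto_eq_mset_upto del: keys_nth length_rev)
  also have "map (nth_default 0 ?xs) [0..<length ?xs] = ?xs"
    by (rule nth_equalityI) (simp_all add: nth_default_def del: length_rev)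
  finally show "parts_mset ?l = M" by simp
qed

text \<open>Multisets index the power sum products because inserting or deleting a part is then a
  primitive operation that needs no resorting; partitions serve only to meet the
  definitions.\<close>

definition multisets_of_sum :: "nat \<Rightarrow> nat multiset set" where
  "multisets_of_sum d = {M. 0 \<notin># M \<and> sum_mset M = d}"

lemma finite_partitions_le: "finite {l \<in> partitions. total_degree l \<le> d}"
proof (rule finite_subset)
  \<comment> \<open>A partition of size at most d has at most d parts, each at most d, so it lies
    below this square box.\<close>
  let ?c = "\<Sum>i<d. single i d"
  have c: "lookup ?c i = (if i < d then d else 0)" for i
    by (simp add: lookup_sum lookup_single when_def)
  show "{l \<in> partitions. total_degree l \<le> d} \<subseteq> {a. \<forall>i. lookup a i \<le> lookup ?c i}"
  proof safe
    fix l i assume l: "l \<in> partitions" "total_degree l \<le> d"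
    show "lookup l i \<le> lookup ?c i"
    proof (cases "i < d")
      case True
      then show ?thesis using lookup_le_total_degree[of l i] l(2) by (simp add: c)
    next
      case False
      then have "i \<notin> keys l"
        using keys_partition[OF l(1)] plength_le_total_degree[of l] l(2) by auto
      then show ?thesis by (simp add: in_keys_iff)
    qed
  qed
qed (rule finite_exponents_le)

lemma finite_multisets_of_sum [simp]: "finite (multisets_of_sum d)"
proof (rule finite_subset)
  show "multisets_of_sum d \<subseteq> parts_mset ` {l \<in> partitions. total_degree l \<le> d}"
  proof
    fix M assume "M \<in> multisets_of_sum d"
    then obtain l where "l \<in> partitions" "parts_mset l = M" "sum_mset M = d"
      using partition_with_parts_mset unfolding multisets_of_sum_def by blast
    then show "M \<in> parts_mset ` {l \<in> partitions. total_degree l \<le> d}"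
      by force
  qed
qed (use finite_partitions_le in blast)

section \<open>Power sum expansions\<close>

lemma single_eq_single_iff:
  assumes "r \<noteq> 0"
  shows "single i r = single j r \<longleftrightarrow> i = j"
  using assms by (auto simp: poly_mapping_eq_iff fun_eq_iff lookup_single when_def split: if_splits)

lemma mcoeff_psum:
  assumes "r \<noteq> 0"
  shows "mcoeff (psum r) m = (if \<exists>i. m = single i r then 1 else 0)"
proof -
  let ?S = "Abs_mps (\<lambda>m. if \<exists>i. m = single i r then 1 else 0) :: series"
  note inj = single_eq_single_iff[OF assms]
  have set: "{i. mcoeff (mvar i ^ r :: series) m \<noteq> 0} = {i. m = single i r}" for m
    by (simp add: mcoeff_mvar_power)
  have fin: "finite {i. m = single i r}" for m :: npart
    by (cases "\<exists>j. m = single j r") (auto simp: inj)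
  have "(\<lambda>i. mvar i ^ r) sums ?S"
  proof (rule sums_mps)
    show "finite {i. mcoeff (mvar i ^ r :: series) m \<noteq> 0}" for m
      using fin by (simp add: set)
    show "mcoeff ?S m = (\<Sum>i | mcoeff (mvar i ^ r :: series) m \<noteq> 0. mcoeff (mvar i ^ r) m)" for m
      unfolding set by (cases "\<exists>j. m = single j r") (auto simp: inj mcoeff_mvar_power)
  qed
  then have "psum r = ?S" unfolding psum_def by (rule sums_unique[symmetric])
  then show ?thesis by simp
qed

text \<open>The index i records which term of \<open>psum r\<close> is used. For r \<noteq> 0
  different indices give different splittings, so the convolution becomes a sum over the variables
  whose exponent is at least r.\<close>

lemma mcoeff_psum_times:
  assumes "r \<noteq> 0"
  shows "mcoeff (psum r * f) m = (\<Sum>i | r \<le> lookup m i. mcoeff f (m - single i r))"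
proof -
  let ?h = "\<lambda>i. (single i r, m - single i r)"
  have "inj_on ?h {i. r \<le> lookup m i}"
    using assms by (auto simp: inj_on_def poly_mapping_eq_iff fun_eq_iff lookup_single when_def split: if_splits)
  moreover have im: "?h ` {i. r \<le> lookup m i} = {p. fst p + snd p = m} \<inter> {p. \<exists>i. fst p = single i r}"
  proof -
    have "fst p + snd p = m \<and> fst p = single i r \<longleftrightarrow> r \<le> lookup m i \<and> p = ?h i" for p i
      unfolding exponent_split_iff using single_dvd_iff[of i r m] by (cases p) auto
    then show ?thesis by blast
  qed
  moreover have "mcoeff (psum r * f) m
      = (\<Sum>p\<in>{p. fst p + snd p = m} \<inter> {p. \<exists>i. fst p = single i r}. mcoeff f (snd p))"
    unfolding mcoeff_times
    by (rule sum.mono_neutral_cong_right) (auto simp: mcoeff_psum[OF assms])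
  ultimately show ?thesis by (simp add: sum.reindex flip: im)
qed

definition psum_mset :: "nat multiset \<Rightarrow> series" where
  "psum_mset M = prod_mset (image_mset psum M)"

lemma psum_mset_empty [simp]: "psum_mset {#} = 1"
  by (simp add: psum_mset_def)

lemma psum_mset_add_mset [simp]: "psum_mset (add_mset r M) = psum r * psum_mset M"
  by (simp add: psum_mset_def)

lemma psum_mset_union: "psum_mset (M + M') = psum_mset M * psum_mset M'"
  by (simp add: psum_mset_def)

lemma psum_part_parts_mset: "psum_part l = psum_mset (parts_mset l)"
  unfolding psum_part_def psum_mset_def parts_mset_def
  by (simp add: prod_unfold_prod_mset multiset.map_comp comp_def)

text \<open>
  A power sum product expands into monomials obtained by merging its factors, so the transition
  matrix to monomial functions is triangular with respect to the number of parts.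
\<close>

lemma mcoeff_psum_mset_nat:
  assumes "0 \<notin># M"
  shows "\<exists>n::nat. mcoeff (psum_mset M) m = of_nat n \<and> (parts_mset m = M \<longrightarrow> n \<noteq> 0) \<and>
    (n \<noteq> 0 \<longrightarrow> sum_mset M = total_degree m \<and> card (keys m) \<le> size M \<and>
       (card (keys m) = size M \<longrightarrow> parts_mset m = M))"
  using assms
proof (induction M arbitrary: m)
  case empty
  show ?case by (rule exI[of _ "if m = 0 then 1 else 0"]) (auto simp: mcoeff_one)
next
  case (add r M)
  have r: "r \<noteq> 0" using add.prems by auto
  let ?S = "{i. r \<le> lookup m i}"
  have "?S \<subseteq> keys m" using r by (auto simp: in_keys_iff)
  then have fin: "finite ?S" using finite_subset finite_keys by blast
  have "\<forall>i. \<exists>n::nat. mcoeff (psum_mset M) (m - single i r) = of_nat n \<and>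
      (parts_mset (m - single i r) = M \<longrightarrow> n \<noteq> 0) \<and>
      (n \<noteq> 0 \<longrightarrow> sum_mset M = total_degree (m - single i r) \<and> card (keys (m - single i r)) \<le> size M \<and>
         (card (keys (m - single i r)) = size M \<longrightarrow> parts_mset (m - single i r) = M))"
    using add by simp
  then obtain n where n: "\<And>i. mcoeff (psum_mset M) (m - single i r) = of_nat (n i)"
      "\<And>i. parts_mset (m - single i r) = M \<Longrightarrow> n i \<noteq> 0"
      "\<And>i. n i \<noteq> 0 \<Longrightarrow> sum_mset M = total_degree (m - single i r) \<and> card (keys (m - single i r)) \<le> size M \<and>
         (card (keys (m - single i r)) = size M \<longrightarrow> parts_mset (m - single i r) = M)"
    by metis
  have split: "m = (m - single i r) + single i r" if "i \<in> ?S" for i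
    using that exponent_split_iff[of "single i r" "m - single i r" m] single_dvd_iff[of i r m]
    by (simp add: add.commute)
  \<comment> \<open>Coefficients are tracked as naturals because then nothing cancels: this sum is
    nonzero as soon as one summand is.\<close>
  have "mcoeff (psum_mset (add_mset r M)) m = of_nat (\<Sum>i\<in>?S. n i)"
    by (simp add: mcoeff_psum_times[OF r] n(1))
  moreover have "(\<Sum>i\<in>?S. n i) \<noteq> 0" if c: "parts_mset m = add_mset r M"
  proof -
    have "r \<in># parts_mset m" using c by simp
    then obtain i where i: "i \<in> keys m" "lookup m i = r" by (auto simp: parts_mset_def)
    then have iS: "i \<in> ?S" by simp
    have "i \<notin> keys (m - single i r)" using i by (simp add: in_keys_iff lookup_minus)
    from parts_mset_add_single[OF this r] have "parts_mset (m - single i r) = M"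
      using c split[OF iS] by simp
    then show ?thesis using n(2) iS fin by auto
  qed
  moreover have "sum_mset (add_mset r M) = total_degree m \<and> card (keys m) \<le> size (add_mset r M) \<and>
      (card (keys m) = size (add_mset r M) \<longrightarrow> parts_mset m = add_mset r M)"
    if nz: "(\<Sum>i\<in>?S. n i) \<noteq> 0"
  proof -
    obtain i where iS: "i \<in> ?S" and "n i \<noteq> 0"
      using nz by (rule sum.not_neutral_contains_not_neutral)
    define m' where "m' = m - single i r"
    have m: "m = m' + single i r" using split[OF iS] by (simp add: m'_def)
    have m': "sum_mset M = total_degree m'" "card (keys m') \<le> size M"
        "card (keys m') = size M \<Longrightarrow> parts_mset m' = M"
      using n(3)[OF \<open>n i \<noteq> 0\<close>] by (auto simp: m'_def)
    have keys: "keys m = insert i (keys m')"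
      using r by (auto simp: m in_keys_iff lookup_add lookup_single when_def split: if_splits)
    show ?thesis
    \<comment> \<open>Either the new power merges with a variable already present, and the number of
      variables falls strictly behind the number of factors, or it opens a new part.\<close>
    proof (cases "i \<in> keys m'")
      case True
      then have "keys m = keys m'" using keys by auto
      then show ?thesis using m' by (simp add: m)
    next
      case False
      then show ?thesis
        using m' keys parts_mset_add_single[OF False r] by (simp add: m)
    qed
  qed
  ultimately show ?case by blast
qed

lemma mcoeff_psum_mset_same: "mcoeff (psum_mset (parts_mset m)) m \<noteq> 0"
proof -
  obtain n :: nat where "mcoeff (psum_mset (parts_mset m)) m = of_nat n" "n \<noteq> 0"
    using mcoeff_psum_mset_nat[of "parts_mset m" m] by auto
  then show ?thesis by simp
qed

lemma mcoeff_psum_mset_nonzero: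
  assumes "0 \<notin># M" "mcoeff (psum_mset M) m \<noteq> 0"
  shows "sum_mset M = total_degree m" "M = parts_mset m \<or> card (keys m) < size M"
  using mcoeff_psum_mset_nat[OF assms(1), of m] assms(2) by auto

text \<open>Elimination from the top: if x has maximal rank s, then a i x = 0 for every other i, so
  the equation at x alone determines c x. The rest is a smaller triangular system with corrected
  right-hand side.\<close>

lemma triangular_solve:
  fixes s :: "'i \<Rightarrow> nat" and a :: "'i \<Rightarrow> 'i \<Rightarrow> 'a::field"
  assumes "finite S"
    and "\<And>i. i \<in> S \<Longrightarrow> a i i \<noteq> 0"
    and "\<And>i j. i \<in> S \<Longrightarrow> j \<in> S \<Longrightarrow> a i j \<noteq> 0 \<Longrightarrow> i = j \<or> s j < s i"
  shows "\<exists>c. \<forall>j\<in>S. F j = (\<Sum>i\<in>S. c i * a i j)"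
  using assms
proof (induction S arbitrary: F rule: finite_ranking_induct[where f = s])
  case empty
  then show ?case by simp
next
  case (insert x S)
  show ?case
  proof (cases "x \<in> S")
    case True
    then show ?thesis using insert by (simp add: insert_absorb)
  next
    case x: False
    define F' where "F' j = F j - F x / a x x * a x j" for j
    obtain c where c: "\<forall>j\<in>S. F' j = (\<Sum>i\<in>S. c i * a i j)"
      using insert.IH[of F'] insert.prems by auto
    have "a i x = 0" if "i \<in> S" for i
      using insert.prems(2)[of i x] insert.hyps(2)[OF that] that x by force
    then have "\<forall>j\<in>insert x S. F j = (\<Sum>i\<in>insert x S. (c(x := F x / a x x)) i * a i j)"
      using x insert.hyps(1) insert.prems(1) c
      by (auto simp: F'_def algebra_simps cong: sum.cong_simp intro!: sum.cong)
    then show ?thesis by blast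
  qed
qed

text \<open>Among the indices with nonzero c, let j have maximal rank. The equation at j then
  reduces to the single term c j * a j j.\<close>

lemma triangular_unique:
  fixes s :: "'i \<Rightarrow> nat" and a :: "'i \<Rightarrow> 'i \<Rightarrow> 'a::field"
  assumes "finite S"
    and "\<And>i. i \<in> S \<Longrightarrow> a i i \<noteq> 0"
    and "\<And>i j. i \<in> S \<Longrightarrow> j \<in> S \<Longrightarrow> a i j \<noteq> 0 \<Longrightarrow> i = j \<or> s j < s i"
    and "\<And>j. j \<in> S \<Longrightarrow> (\<Sum>i\<in>S. c i * a i j) = 0"
    and "x \<in> S"
  shows "c x = 0"
proof (rule ccontr)
  assume "c x \<noteq> 0"
  let ?T = "{i \<in> S. c i \<noteq> 0}"
  have "finite ?T" "?T \<noteq> {}" using assms(1,5) \<open>c x \<noteq> 0\<close> by auto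
  then have "Max (s ` ?T) \<in> s ` ?T" by simp
  then obtain j where "j \<in> ?T" "s j = Max (s ` ?T)" by fastforce
  then have j: "j \<in> ?T" "\<And>i. i \<in> ?T \<Longrightarrow> s i \<le> s j"
    using \<open>finite ?T\<close> by simp_all
  have "(\<Sum>i\<in>S. c i * a i j) = (\<Sum>i\<in>{j}. c i * a i j)"
  proof (rule sum.mono_neutral_right)
    show "\<forall>i\<in>S - {j}. c i * a i j = 0"
      using j assms(3) by (force simp: not_less)
  qed (use assms(1) j in auto)
  then show False using assms(2,4) j by auto
qed

section \<open>Closure properties and degree bounds of symmetric series\<close>

lemma symmetric_in_mult:
  fixes f g :: "('v, 'a::comm_ring_1) mps"
  assumes f: "symmetric_in A f" and g: "symmetric_in A g"
  shows "symmetric_in A (f * g)"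
  unfolding symmetric_in_def
proof (intro allI impI)
  fix \<pi> m assume \<pi>: "\<pi> permutes A"
  have inv: "inv \<pi> permutes A" using \<pi> by (rule permutes_inv)
  have inj: "inj \<pi>" "inj (inv \<pi>)" using \<pi> inv by (auto intro: permutes_inj)
  have cancel: "map_key \<pi> (map_key (inv \<pi>) a) = a" "map_key (inv \<pi>) (map_key \<pi> a) = a"
    for a :: "'v \<Rightarrow>\<^sub>0 nat"
    using inj permutes_inverses[OF \<pi>] by (auto intro!: poly_mapping_eqI simp: map_key.rep_eq)
  show "mcoeff (f * g) (map_key \<pi> m) = mcoeff (f * g) m"
    unfolding mcoeff_times
  proof (rule sum.reindex_bij_witness[of _ "\<lambda>p. (map_key \<pi> (fst p), map_key \<pi> (snd p))"
          "\<lambda>p. (map_key (inv \<pi>) (fst p), map_key (inv \<pi>) (snd p))"])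
    fix p assume "p \<in> {p. fst p + snd p = map_key \<pi> m}"
    then have "map_key (inv \<pi>) (fst p + snd p) = m" by (simp add: cancel)
    then show "(map_key (inv \<pi>) (fst p), map_key (inv \<pi>) (snd p)) \<in> {p. fst p + snd p = m}"
      using inj(2) by (simp add: map_key_plus)
    show "mcoeff f (fst (map_key (inv \<pi>) (fst p), map_key (inv \<pi>) (snd p))) *
        mcoeff g (snd (map_key (inv \<pi>) (fst p), map_key (inv \<pi>) (snd p)))
        = mcoeff f (fst p) * mcoeff g (snd p)"
      using f g inv unfolding symmetric_in_def by simp
  next
    fix p assume "p \<in> {p. fst p + snd p = m}"
    then have "map_key \<pi> (fst p + snd p) = map_key \<pi> m" by simp
    then show "(map_key \<pi> (fst p), map_key \<pi> (snd p)) \<in> {p. fst p + snd p = map_key \<pi> m}"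
      using inj(1) by (simp add: map_key_plus)
  qed (simp_all add: cancel)
qed

text \<open>A bound in place of the degree itself: \<open>mpoly_degree\<close> is a maximum over the
  support, which is infinite for symmetric functions in infinitely many variables, and two series
  often need a common bound.\<close>

definition degree_le :: "nat \<Rightarrow> ('v, 'a::zero) mps \<Rightarrow> bool" where
  "degree_le d f \<longleftrightarrow> (\<forall>m. d < total_degree m \<longrightarrow> mcoeff f m = 0)"

lemma degree_leD: "degree_le d f \<Longrightarrow> d < total_degree m \<Longrightarrow> mcoeff f m = 0"
  by (simp add: degree_le_def)

lemma degree_le_mono: "degree_le d f \<Longrightarrow> d \<le> e \<Longrightarrow> degree_le e f"
  by (simp add: degree_le_def)

lemma degree_le_mult:
  fixes f g :: "('v, 'a::comm_ring_1) mps"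
  assumes "degree_le d f" "degree_le e g"
  shows "degree_le (d + e) (f * g)"
  unfolding degree_le_def
proof (intro allI impI)
  fix m :: "'v \<Rightarrow>\<^sub>0 nat" assume m: "d + e < total_degree m"
  show "mcoeff (f * g) m = 0"
    unfolding mcoeff_times
  proof (rule sum.neutral, safe)
    fix a b :: "'v \<Rightarrow>\<^sub>0 nat" assume "m = fst (a, b) + snd (a, b)"
    then have "d < total_degree a \<or> e < total_degree b" using m by auto
    then show "mcoeff f (fst (a, b)) * mcoeff g (snd (a, b)) = 0"
      using assms by (auto dest: degree_leD)
  qed
qed

lemma Sym_iff: "f \<in> Sym \<longleftrightarrow> f \<in> Sym_hat \<and> (\<exists>d. degree_le d f)"
  by (auto simp: Sym_def degree_le_def msupp_def not_less[symmetric])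

lemma Sym_hat_closed:
  assumes "f \<in> Sym_hat" "g \<in> Sym_hat"
  shows "f + g \<in> Sym_hat" "f * g \<in> Sym_hat"
  using assms by (simp_all add: Sym_hat_def symmetric_in_mult) (simp add: symmetric_in_def)

lemma mconst_in_Sym: "mconst c \<in> Sym"
  by (auto simp: Sym_iff Sym_hat_iff degree_le_def mcoeff_mconst dest: arg_cong[of _ _ "\<lambda>M. M = {#}"])

lemma Sym_closed [simp]:
  assumes "f \<in> Sym" "g \<in> Sym"
  shows "f + g \<in> Sym" "f * g \<in> Sym"
proof -
  obtain d e where "degree_le d f" "degree_le e g" using assms by (auto simp: Sym_iff)
  then have "degree_le (max d e) (f + g)" "degree_le (d + e) (f * g)"
    by (auto simp: degree_le_mult) (auto simp: degree_le_def)
  then show "f + g \<in> Sym" "f * g \<in> Sym"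
    using assms Sym_hat_closed by (auto simp: Sym_iff)
qed

lemma Sym_simps [simp]: "0 \<in> Sym" "1 \<in> Sym" "f \<in> Sym \<Longrightarrow> mconst c * f \<in> Sym"
  using mconst_in_Sym[of 0] mconst_in_Sym[of 1] mconst_in_Sym[of c] by auto

lemma Sym_sum [simp]: "(\<And>i. i \<in> S \<Longrightarrow> h i \<in> Sym) \<Longrightarrow> sum h S \<in> Sym"
  by (induction S rule: infinite_finite_induct) auto

lemma Sym_imp_Sym_hat: "f \<in> Sym \<Longrightarrow> f \<in> Sym_hat"
  by (simp add: Sym_iff)

lemma psum_in_Sym: "r \<noteq> 0 \<Longrightarrow> psum r \<in> Sym"
proof -
  assume r: "r \<noteq> 0"
  have "(\<exists>i. m = single i r) \<longleftrightarrow> parts_mset m = {#r#}" for m :: npart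
  proof
    assume "parts_mset m = {#r#}"
    also have "\<dots> = parts_mset (single (0::nat) r)"
      using parts_mset_add_single[of "0::nat" 0 r] r by simp
    finally obtain \<pi> where \<pi>: "\<pi> permutes UNIV" "m = map_key \<pi> (single 0 r)"
      using parts_mset_eq_imp_permuted by metis
    have "map_key \<pi> (single (\<pi> (inv \<pi> 0)) r) = single (inv \<pi> 0) r"
      using \<pi> by (intro map_key_single permutes_inj)
    then show "\<exists>i. m = single i r"
      using \<pi> permutes_inverses(1)[OF \<pi>(1)] by auto
  next
    assume "\<exists>i. m = single i r"
    then obtain i where "m = 0 + single i r" by auto
    then show "parts_mset m = {#r#}" using parts_mset_add_single[of i 0 r] r by simp
  qed
  then have "psum r \<in> Sym_hat" by (simp add: Sym_hat_iff mcoeff_psum r)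
  moreover have "degree_le r (psum r)" by (auto simp: degree_le_def mcoeff_psum r)
  ultimately show ?thesis by (auto simp: Sym_iff)
qed

lemma psum_mset_in_Sym [simp]: "0 \<notin># M \<Longrightarrow> psum_mset M \<in> Sym"
  by (induction M) (auto simp: psum_in_Sym)

section \<open>Coefficients with respect to power sum products\<close>

lemma multisets_of_sumD: "M \<in> multisets_of_sum d \<Longrightarrow> 0 \<notin># M" "M \<in> multisets_of_sum d \<Longrightarrow> sum_mset M = d"
  by (auto simp: multisets_of_sum_def)

lemma parts_mset_in_multisets_of_sum [simp]: "parts_mset m \<in> multisets_of_sum (total_degree m)"
  by (simp add: multisets_of_sum_def)

text \<open>One equation for each monomial orbit of degree d, tested at a representative
  \<open>rep M'\<close>. The system is triangular for the rank \<open>size\<close>: the orbit M'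
  occurs in \<open>psum_mset M\<close> only if M' = M or M' has fewer parts.\<close>

lemma psum_expansion_degree:
  fixes F :: "nat multiset \<Rightarrow> qt"
  shows "\<exists>c. \<forall>m. total_degree m = d \<longrightarrow>
    F (parts_mset m) = (\<Sum>M\<in>multisets_of_sum d. c M * mcoeff (psum_mset M) m)"
proof -
  define rep :: "nat multiset \<Rightarrow> npart" where "rep M = (SOME m. parts_mset m = M)" for M
  have rep: "parts_mset (rep M) = M" if "0 \<notin># M" for M
    using partition_with_parts_mset[OF that] unfolding rep_def by (metis (mono_tags) someI)
  have "\<exists>c. \<forall>M'\<in>multisets_of_sum d. F M' =
      (\<Sum>M\<in>multisets_of_sum d. c M * mcoeff (psum_mset M) (rep M'))"
  proof (rule triangular_solve[where s = size])
    fix M assume "M \<in> multisets_of_sum d"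
    then show "mcoeff (psum_mset M) (rep M) \<noteq> 0"
      using mcoeff_psum_mset_same[of "rep M"] by (simp add: rep multisets_of_sumD)
  next
    fix M M' assume "M \<in> multisets_of_sum d" "M' \<in> multisets_of_sum d"
      and "mcoeff (psum_mset M) (rep M') \<noteq> 0"
    then show "M = M' \<or> size M' < size M"
      using mcoeff_psum_mset_nonzero(2)[of M "rep M'"] rep[of M'] size_parts_mset[of "rep M'"]
      by (auto simp: multisets_of_sumD)
  qed simp
  then obtain c where c: "\<And>M'. M' \<in> multisets_of_sum d \<Longrightarrow> F M' =
      (\<Sum>M\<in>multisets_of_sum d. c M * mcoeff (psum_mset M) (rep M'))" by blast
  have "F (parts_mset m) = (\<Sum>M\<in>multisets_of_sum d. c M * mcoeff (psum_mset M) m)"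
    if "total_degree m = d" for m
  proof -
    have "mcoeff (psum_mset M) (rep (parts_mset m)) = mcoeff (psum_mset M) m"
      if "M \<in> multisets_of_sum d" for M
    proof -
      have "psum_mset M \<in> Sym_hat" using that by (simp add: Sym_imp_Sym_hat multisets_of_sumD)
      moreover have "parts_mset (rep (parts_mset m)) = parts_mset m" by (rule rep) simp
      ultimately show ?thesis unfolding Sym_hat_iff by blast
    qed
    then show ?thesis using c[of "parts_mset m"] parts_mset_in_multisets_of_sum[of m] that by simp
  qed
  then show ?thesis by blast
qed

lemma psum_expansion_unique:
  assumes "\<And>m. total_degree m = d \<Longrightarrow> (\<Sum>M\<in>multisets_of_sum d. c M * mcoeff (psum_mset M) m) = 0"
    and "M \<in> multisets_of_sum d"
  shows "c M = 0"
proof -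
  define rep :: "nat multiset \<Rightarrow> npart" where "rep M = (SOME m. parts_mset m = M)" for M
  have rep: "parts_mset (rep M) = M" if "0 \<notin># M" for M
    using partition_with_parts_mset[OF that] unfolding rep_def by (metis (mono_tags) someI)
  show ?thesis
  proof (rule triangular_unique[where S = "multisets_of_sum d" and s = size
        and a = "\<lambda>M M'. mcoeff (psum_mset M) (rep M')"])
    fix M assume "M \<in> multisets_of_sum d"
    then show "mcoeff (psum_mset M) (rep M) \<noteq> 0"
      using mcoeff_psum_mset_same[of "rep M"] by (simp add: rep multisets_of_sumD)
  next
    fix M M' assume "M \<in> multisets_of_sum d" "M' \<in> multisets_of_sum d"
      and "mcoeff (psum_mset M) (rep M') \<noteq> 0"
    then show "M = M' \<or> size M' < size M"
      using mcoeff_psum_mset_nonzero(2)[of M "rep M'"] rep[of M'] size_parts_mset[of "rep M'"]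
      by (auto simp: multisets_of_sumD)
  next
    fix M' assume "M' \<in> multisets_of_sum d"
    then have "total_degree (rep M') = d"
      using sum_mset_parts_mset[of "rep M'"] rep[of M'] by (simp add: multisets_of_sumD del: sum_mset_parts_mset)
    then show "(\<Sum>M\<in>multisets_of_sum d. c M * mcoeff (psum_mset M) (rep M')) = 0"
      using assms(1) by blast
  qed (use assms(2) in auto)
qed

text \<open>A single choice covers all degrees, since M determines its own degree. Only multisets
  without 0 are constrained; at the others the values are arbitrary, whence the recurring hypothesis
  \<open>0 \<notin># M\<close>.\<close>

definition psum_coeff :: "series \<Rightarrow> nat multiset \<Rightarrow> qt" where
  "psum_coeff f = (SOME c. \<forall>m. mcoeff f m =
     (\<Sum>M\<in>multisets_of_sum (total_degree m). c M * mcoeff (psum_mset M) m))"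

lemma psum_coeff_expand:
  assumes "f \<in> Sym_hat"
  shows "mcoeff f m = (\<Sum>M\<in>multisets_of_sum (total_degree m). psum_coeff f M * mcoeff (psum_mset M) m)"
proof -
  define F where "F M = mcoeff f (SOME m. parts_mset m = M)" for M
  have F: "F (parts_mset m) = mcoeff f m" for m
  proof -
    have "parts_mset (SOME m'::npart. parts_mset m' = parts_mset m) = parts_mset m"
      by (rule someI[of _ m]) simp
    then show ?thesis using assms unfolding F_def Sym_hat_iff by blast
  qed
  have "\<forall>d. \<exists>c. \<forall>m. total_degree m = d \<longrightarrow>
      F (parts_mset m) = (\<Sum>M\<in>multisets_of_sum d. c M * mcoeff (psum_mset M) m)"
    using psum_expansion_degree by blast
  then obtain c where c: "\<And>m. F (parts_mset m) =
      (\<Sum>M\<in>multisets_of_sum (total_degree m). c (total_degree m) M * mcoeff (psum_mset M) m)"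
    by metis
  have "\<exists>c. \<forall>m. mcoeff f m = (\<Sum>M\<in>multisets_of_sum (total_degree m). c M * mcoeff (psum_mset M) m)"
  proof (intro exI allI)
    fix m
    show "mcoeff f m =
        (\<Sum>M\<in>multisets_of_sum (total_degree m). c (sum_mset M) M * mcoeff (psum_mset M) m)"
      using c[of m] F[of m] by (simp add: multisets_of_sumD cong: sum.cong_simp)
  qed
  from someI_ex[OF this] show ?thesis unfolding psum_coeff_def by blast
qed

text \<open>Uniqueness holds within each degree, so any valid expansion in degree d alone identifies
  the coefficients there. Linearity, the values on power sum products and the effect of homogeneous
  components all follow from this.\<close>

lemma psum_coeff_eqI:
  assumes "f \<in> Sym_hat" "M \<in> multisets_of_sum d"
    and "\<And>m. total_degree m = d \<Longrightarrow> mcoeff f m = (\<Sum>M\<in>multisets_of_sum d. c M * mcoeff (psum_mset M) m)"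
  shows "psum_coeff f M = c M"
proof -
  have "psum_coeff f M - c M = 0"
  proof (rule psum_expansion_unique[OF _ assms(2)])
    fix m :: npart assume "total_degree m = d"
    then show "(\<Sum>M\<in>multisets_of_sum d. (psum_coeff f M - c M) * mcoeff (psum_mset M) m) = 0"
      using assms(3) psum_coeff_expand[OF assms(1), of m]
      by (simp add: left_diff_distrib sum_subtractf)
  qed
  then show ?thesis by simp
qed

lemma psum_coeff_add:
  assumes "f \<in> Sym_hat" "g \<in> Sym_hat" "0 \<notin># M"
  shows "psum_coeff (f + g) M = psum_coeff f M + psum_coeff g M"
  by (rule psum_coeff_eqI[of _ _ "sum_mset M"])
    (use assms in \<open>auto simp: Sym_hat_closed multisets_of_sum_def psum_coeff_expand
       distrib_right sum.distrib\<close>)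

lemma Sym_hat_mconst_times: "f \<in> Sym_hat \<Longrightarrow> mconst c * f \<in> Sym_hat"
  by (simp add: Sym_hat_closed Sym_imp_Sym_hat mconst_in_Sym)

lemma psum_coeff_mconst_times:
  assumes "f \<in> Sym_hat" "0 \<notin># M"
  shows "psum_coeff (mconst c * f) M = c * psum_coeff f M"
  by (rule psum_coeff_eqI[of _ _ "sum_mset M"])
    (use assms in \<open>auto simp: Sym_hat_mconst_times multisets_of_sum_def psum_coeff_expand
       sum_distrib_left mult.assoc\<close>)

lemma psum_coeff_psum_mset:
  assumes "0 \<notin># M" "0 \<notin># M'"
  shows "psum_coeff (psum_mset M') M = (if M = M' then 1 else 0)"
proof (rule psum_coeff_eqI[of _ _ "sum_mset M"])
  fix m :: npart assume m: "total_degree m = sum_mset M"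
  have "(\<Sum>M\<in>multisets_of_sum (sum_mset M). (if M = M' then 1 else 0) * mcoeff (psum_mset M) m)
      = (\<Sum>M\<in>multisets_of_sum (sum_mset M). if M' = M then mcoeff (psum_mset M) m else 0)"
    by (rule sum.cong) auto
  also have "\<dots> = (if M' \<in> multisets_of_sum (sum_mset M) then mcoeff (psum_mset M') m else 0)"
    by simp
  also have "\<dots> = mcoeff (psum_mset M') m"
    using mcoeff_psum_mset_nonzero(1)[OF assms(2), of m] m assms
    by (auto simp: multisets_of_sum_def)
  finally show "mcoeff (psum_mset M') m =
      (\<Sum>M\<in>multisets_of_sum (sum_mset M). (if M = M' then 1 else 0) * mcoeff (psum_mset M) m)" ..
qed (use assms in \<open>auto simp: Sym_imp_Sym_hat multisets_of_sum_def\<close>)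

lemma psum_coeff_eq_0:
  assumes "f \<in> Sym_hat" "0 \<notin># M" "\<And>m. total_degree m = sum_mset M \<Longrightarrow> mcoeff f m = 0"
  shows "psum_coeff f M = 0"
  by (rule psum_coeff_eqI[of _ _ "sum_mset M" "\<lambda>_. 0"]) (use assms in \<open>auto simp: multisets_of_sum_def\<close>)

lemma mcoeff_hom_component: "mcoeff (hom_component k f) m = (if total_degree m = k then mcoeff f m else 0)"
  by (simp add: hom_component_def)

lemma hom_component_in_Sym:
  assumes "f \<in> Sym_hat"
  shows "hom_component k f \<in> Sym" "degree_le k (hom_component k f)"
proof -
  have "total_degree m = total_degree m'" if "parts_mset m = parts_mset m'" for m m' :: npart
    using that by (metis sum_mset_parts_mset)
  then have "hom_component k f \<in> Sym_hat"
    using assms unfolding Sym_hat_iff mcoeff_hom_component by metis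
  moreover show "degree_le k (hom_component k f)"
    by (simp add: degree_le_def mcoeff_hom_component)
  ultimately show "hom_component k f \<in> Sym" by (auto simp: Sym_iff)
qed

lemma psum_coeff_hom_component:
  assumes "f \<in> Sym_hat" "0 \<notin># M"
  shows "psum_coeff (hom_component k f) M = (if sum_mset M = k then psum_coeff f M else 0)"
proof (cases "sum_mset M = k")
  case True
  have "psum_coeff (hom_component k f) M = psum_coeff f M"
    by (rule psum_coeff_eqI[of _ _ k])
      (use True assms in \<open>auto simp: multisets_of_sum_def mcoeff_hom_component psum_coeff_expand
        hom_component_in_Sym Sym_imp_Sym_hat\<close>)
  then show ?thesis using True by simp
qed (use assms in \<open>auto intro!: psum_coeff_eq_0
       simp: hom_component_in_Sym Sym_imp_Sym_hat mcoeff_hom_component\<close>)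

definition multisets_of_sum_le :: "nat \<Rightarrow> nat multiset set" where
  "multisets_of_sum_le d = {M. 0 \<notin># M \<and> sum_mset M \<le> d}"

lemma finite_multisets_of_sum_le [simp]: "finite (multisets_of_sum_le d)"
proof -
  have "multisets_of_sum_le d = (\<Union>k\<le>d. multisets_of_sum k)"
    by (auto simp: multisets_of_sum_le_def multisets_of_sum_def)
  then show ?thesis by simp
qed

lemma psum_coeff_degree_le:
  assumes "f \<in> Sym" "degree_le d f" "0 \<notin># M" "psum_coeff f M \<noteq> 0"
  shows "M \<in> multisets_of_sum_le d"
proof (rule ccontr)
  assume "M \<notin> multisets_of_sum_le d"
  then have "d < sum_mset M" using assms by (simp add: multisets_of_sum_le_def)
  then have "psum_coeff f M = 0"
    using assms by (intro psum_coeff_eq_0) (auto simp: Sym_imp_Sym_hat degree_leD)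
  then show False using assms by simp
qed

lemma mcoeff_psum_expansion_le:
  assumes "f \<in> Sym_hat" "total_degree m \<le> d"
  shows "mcoeff f m = (\<Sum>M\<in>multisets_of_sum_le d. psum_coeff f M * mcoeff (psum_mset M) m)"
  unfolding psum_coeff_expand[OF assms(1)]
proof (rule sum.mono_neutral_left)
  show "\<forall>M\<in>multisets_of_sum_le d - multisets_of_sum (total_degree m).
      psum_coeff f M * mcoeff (psum_mset M) m = 0"
  proof
    fix M assume M: "M \<in> multisets_of_sum_le d - multisets_of_sum (total_degree m)"
    then have "mcoeff (psum_mset M) m = 0"
      using mcoeff_psum_mset_nonzero(1)[of M m] by (auto simp: multisets_of_sum_le_def multisets_of_sum_def)
    then show "psum_coeff f M * mcoeff (psum_mset M) m = 0" by simp
  qed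
  show "multisets_of_sum (total_degree m) \<subseteq> multisets_of_sum_le d"
    using assms(2) by (auto simp: multisets_of_sum_le_def multisets_of_sum_def)
qed simp

lemma Sym_psum_expansion:
  assumes "f \<in> Sym" "degree_le d f"
  shows "f = (\<Sum>M\<in>multisets_of_sum_le d. mconst (psum_coeff f M) * psum_mset M)"
proof (rule mps_eqI)
  fix m
  show "mcoeff f m = mcoeff (\<Sum>M\<in>multisets_of_sum_le d. mconst (psum_coeff f M) * psum_mset M) m"
  proof (cases "total_degree m \<le> d")
    case True
    then show ?thesis
      using mcoeff_psum_expansion_le assms(1) by (simp add: Sym_imp_Sym_hat)
  next
    case False
    then have "mcoeff (psum_mset M) m = 0" if "M \<in> multisets_of_sum_le d" for M
      using that mcoeff_psum_mset_nonzero(1)[of M m] by (auto simp: multisets_of_sum_le_def)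
    then show ?thesis using False assms(2) by (simp add: degree_leD)
  qed
qed

section \<open>The Macdonald scalar product\<close>

lemma Fract_power: "Fract a 1 ^ n = Fract (a ^ n) (1 :: 'a::idom)"
  by (induction n) (simp_all add: One_fract_def)

text \<open>In the iterated polynomial ring q is a constant polynomial in t, so the degree that
  refutes the equation has to be taken in the inner ring.\<close>

lemma qv_power_neq_1: "r \<noteq> 0 \<Longrightarrow> qv ^ r \<noteq> 1"
proof
  assume r: "r \<noteq> 0" and "qv ^ r = 1"
  then have "[:[:0, 1::rat:]:] ^ r = 1"
    by (simp add: qv_def Fract_power One_fract_def eq_fract)
  moreover have "[:p:] ^ r = [:p ^ r:]" for p :: "rat poly"
    by (induction r) (simp_all add: one_pCons)
  ultimately have "[:0, 1::rat:] ^ r = 1" by (simp add: one_pCons)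
  then have "degree ([:0, 1::rat:] ^ r) = 0" by simp
  then show False using r by (simp add: degree_power_eq)
qed

lemma tv_power_neq_1: "r \<noteq> 0 \<Longrightarrow> tv ^ r \<noteq> 1"
proof
  assume r: "r \<noteq> 0" and "tv ^ r = 1"
  then have "[:0, 1::rat poly:] ^ r = 1"
    by (simp add: tv_def Fract_power One_fract_def eq_fract)
  then have "degree ([:0, 1::rat poly:] ^ r) = 0" by simp
  then show False using r by (simp add: degree_power_eq)
qed

text \<open>The value of the scalar product of a power sum product with itself, with
  \<open>zee\<close> rewritten through the multiplicities \<open>count M r\<close>.\<close>

definition psum_norm :: "nat multiset \<Rightarrow> qt" where
  "psum_norm M = of_nat (\<Prod>r\<in>set_mset M. r ^ count M r * fact (count M r)) *
     (\<Prod>r\<in>#M. (1 - qv ^ r) / (1 - tv ^ r))"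

lemma zee_parts_mset: "zee l = (\<Prod>r\<in>set_mset (parts_mset l). r ^ count (parts_mset l) r * fact (count (parts_mset l) r))"
proof -
  have "card {i. lookup l i = r} = count (parts_mset l) r" if "r \<in> lookup l ` keys l" for r
  proof -
    have "r \<noteq> 0" using that by (auto simp: in_keys_iff)
    then have "{i. lookup l i = r} = lookup l -` {r} \<inter> keys l" by (auto simp: in_keys_iff)
    then show ?thesis by (simp add: parts_mset_def count_image_mset)
  qed
  moreover have "set_mset (parts_mset l) = lookup l ` keys l" by (simp add: parts_mset_def)
  ultimately show ?thesis by (simp add: zee_def Let_def)
qed

lemma psum_norm_parts_mset:
  "psum_norm (parts_mset l) = of_nat (zee l) *
     (\<Prod>i\<in>keys l. (1 - qv ^ lookup l i) / (1 - tv ^ lookup l i))"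
  unfolding psum_norm_def zee_parts_mset
  by (simp add: parts_mset_def prod_unfold_prod_mset multiset.map_comp comp_def)

text \<open>For positive r neither 1 - q^r nor 1 - t^r is 0; the denominators matter here as well,
  because a quotient by 0 would be 0.\<close>

lemma psum_norm_nonzero:
  assumes "0 \<notin># M"
  shows "psum_norm M \<noteq> 0"
proof -
  have "(1 - qv ^ r) / (1 - tv ^ r) \<noteq> 0" if "r \<in># M" for r
    using that assms qv_power_neq_1[of r] tv_power_neq_1[of r] by (metis divide_eq_0_iff eq_iff_diff_eq_0)
  then have "(\<Prod>r\<in>#M. (1 - qv ^ r) / (1 - tv ^ r)) \<noteq> 0"
    by (simp add: prod_mset_zero_iff image_iff)
  moreover have "(\<Prod>r\<in>set_mset M. r ^ count M r * fact (count M r)) \<noteq> 0"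
    using assms by (auto simp: prod_zero_iff)
  ultimately show ?thesis unfolding psum_norm_def by (simp only: mult_eq_0_iff of_nat_eq_0_iff) simp
qed

text \<open>The form that is diagonal in the power sum products. Summation over the support of f
  gives a finite range without mention of a degree.\<close>

definition power_sum_form :: "series \<Rightarrow> series \<Rightarrow> qt" where
  "power_sum_form f g = (if f \<in> Sym \<and> g \<in> Sym
     then \<Sum>M | 0 \<notin># M \<and> psum_coeff f M \<noteq> 0. psum_coeff f M * psum_coeff g M * psum_norm M
     else 0)"

lemma power_sum_form_eq:
  assumes "f \<in> Sym" "g \<in> Sym" "degree_le d f"
  shows "power_sum_form f g =
    (\<Sum>M\<in>multisets_of_sum_le d. psum_coeff f M * psum_coeff g M * psum_norm M)"
proof -
  have "(\<Sum>M | 0 \<notin># M \<and> psum_coeff f M \<noteq> 0. psum_coeff f M * psum_coeff g M * psum_norm M)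
      = (\<Sum>M\<in>multisets_of_sum_le d. psum_coeff f M * psum_coeff g M * psum_norm M)"
  proof (rule sum.mono_neutral_left)
    show "{M. 0 \<notin># M \<and> psum_coeff f M \<noteq> 0} \<subseteq> multisets_of_sum_le d"
      using assms psum_coeff_degree_le by blast
    show "finite (multisets_of_sum_le d)" by simp
  qed (auto simp: multisets_of_sum_le_def)
  then show ?thesis using assms by (simp add: power_sum_form_def)
qed

lemma common_degree_bound:
  assumes "f \<in> Sym" "g \<in> Sym"
  obtains d where "degree_le d f" "degree_le d g"
  using assms unfolding Sym_iff by (metis degree_le_mono nat_le_linear)

lemma degree_le_add: "degree_le d f \<Longrightarrow> degree_le d g \<Longrightarrow> degree_le d (f + g)"
  for f g :: "('v, 'a::comm_ring_1) mps"
  by (simp add: degree_le_def)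

lemma degree_le_mconst_times: "degree_le d f \<Longrightarrow> degree_le d (mconst c * f)"
  for f :: "('v, 'a::comm_ring_1) mps"
  by (simp add: degree_le_def)

lemma multisets_of_sum_leD: "M \<in> multisets_of_sum_le d \<Longrightarrow> 0 \<notin># M"
  by (simp add: multisets_of_sum_le_def)

lemma degree_le_psum_mset:
  assumes "0 \<notin># M"
  shows "degree_le (sum_mset M) (psum_mset M)"
  unfolding degree_le_def using mcoeff_psum_mset_nonzero(1)[OF assms] by (metis less_irrefl)

lemma power_sum_form_psum:
  assumes "0 \<notin># M" "0 \<notin># M'"
  shows "power_sum_form (psum_mset M) (psum_mset M') = (if M = M' then psum_norm M else 0)"
proof -
  let ?S = "multisets_of_sum_le (sum_mset M)"
  have "power_sum_form (psum_mset M) (psum_mset M') =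
      (\<Sum>K\<in>?S. psum_coeff (psum_mset M) K * psum_coeff (psum_mset M') K * psum_norm K)"
    using assms by (intro power_sum_form_eq degree_le_psum_mset) auto
  also have "\<dots> = (\<Sum>K\<in>?S. if K = M then (if M = M' then psum_norm M else 0) else 0)"
    by (rule sum.cong) (use assms in \<open>auto simp: psum_coeff_psum_mset multisets_of_sum_leD\<close>)
  also have "\<dots> = (if M = M' then psum_norm M else 0)"
  proof -
    have "M \<in> ?S" using assms by (simp add: multisets_of_sum_le_def)
    then show ?thesis by simp
  qed
  finally show ?thesis .
qed

lemma is_macdonald_form_power_sum_form: "is_macdonald_form power_sum_form"
  unfolding is_macdonald_form_def
proof (intro conjI ballI allI impI)
  fix f g h assume fgh: "f \<in> Sym" "g \<in> Sym" "h \<in> Sym"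
  note hat = fgh[THEN Sym_imp_Sym_hat]
  obtain d where d: "degree_le d f" "degree_le d g" using fgh common_degree_bound by blast
  then have d': "degree_le d (f + g)" by (rule degree_le_add)
  show "power_sum_form (f + g) h = power_sum_form f h + power_sum_form g h"
    using fgh d d' hat
    by (simp add: power_sum_form_eq[where d = d] psum_coeff_add multisets_of_sum_leD
        distrib_right sum.distrib)
  obtain e where e: "degree_le e h" using fgh by (auto simp: Sym_iff)
  show "power_sum_form h (f + g) = power_sum_form h f + power_sum_form h g"
    using fgh e hat
    by (simp add: power_sum_form_eq[where d = e] psum_coeff_add multisets_of_sum_leD
        distrib_left distrib_right sum.distrib)
next
  fix c f g assume fg: "f \<in> Sym" "g \<in> Sym"
  note hat = fg[THEN Sym_imp_Sym_hat]
  obtain d where d: "degree_le d f" using fg by (auto simp: Sym_iff)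
  then have d': "degree_le d (mconst c * f)" by (rule degree_le_mconst_times)
  show "power_sum_form (mconst c * f) g = c * power_sum_form f g"
    using fg d d' hat
    by (simp add: power_sum_form_eq[where d = d] psum_coeff_mconst_times multisets_of_sum_leD
        sum_distrib_left mult.assoc)
  show "power_sum_form f (mconst c * g) = c * power_sum_form f g"
    using fg d hat
    by (simp add: power_sum_form_eq[where d = d] psum_coeff_mconst_times multisets_of_sum_leD
        sum_distrib_left mult.left_commute[of c] mult.assoc)
next
  fix l m assume lm: "l \<in> partitions" "m \<in> partitions"
  then have "parts_mset l = parts_mset m \<longleftrightarrow> l = m" using parts_mset_inj_partitions by blast
  then show "power_sum_form (psum_part l) (psum_part m) = (if l = m then of_nat (zee l) *
           (\<Prod>i\<in>Poly_Mapping.keys l.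
              (1 - qv ^ Poly_Mapping.lookup l i) / (1 - tv ^ Poly_Mapping.lookup l i)) else 0)"
    by (simp add: psum_part_parts_mset power_sum_form_psum psum_norm_parts_mset)
qed (auto simp: power_sum_form_def)

text \<open>The parameter \<open>scale\<close> lets one statement cover scalar-valued maps, where it
  is multiplication, and series-valued maps, where it is multiplication by a constant
  series.\<close>

lemma linear_on_Sym_sum:
  fixes \<Phi> :: "series \<Rightarrow> 'b::comm_ring_1" and scale :: "qt \<Rightarrow> 'b \<Rightarrow> 'b"
  assumes add: "\<And>f g. f \<in> Sym \<Longrightarrow> g \<in> Sym \<Longrightarrow> \<Phi> (f + g) = \<Phi> f + \<Phi> g"
    and scale: "\<And>c f. f \<in> Sym \<Longrightarrow> \<Phi> (mconst c * f) = scale c (\<Phi> f)"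
    and h: "\<And>i. i \<in> S \<Longrightarrow> h i \<in> Sym" and S: "finite S"
  shows "\<Phi> (\<Sum>i\<in>S. mconst (c i) * h i) = (\<Sum>i\<in>S. scale (c i) (\<Phi> (h i)))"
proof -
  have "\<Phi> 0 + \<Phi> 0 = \<Phi> 0" using add[of 0 0] by simp
  then have \<Phi>0: "\<Phi> 0 = 0" by simp
  show ?thesis
    using S h by (induction S rule: finite_induct) (auto simp: add scale \<Phi>0)
qed

text \<open>Bilinearity reduces a form to its values on power sum products, and these are prescribed
  because every multiset of positive parts comes from a partition.\<close>

lemma macdonald_form_unique:
  assumes B: "is_macdonald_form B"
  shows "B = power_sum_form"
proof (intro ext)
  fix f g
  show "B f g = power_sum_form f g"
  proof (cases "f \<in> Sym \<and> g \<in> Sym")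
    case True
    obtain d where d: "degree_le d f" "degree_le d g" using True common_degree_bound by blast
    let ?S = "multisets_of_sum_le d"
    \<comment> \<open>Kept general in the form A, so that it applies to B and to the model
      alike.\<close>
    have expand: "A f g = (\<Sum>M\<in>?S. psum_coeff f M * (\<Sum>M'\<in>?S. psum_coeff g M' * A (psum_mset M) (psum_mset M')))"
      if A: "is_macdonald_form A" for A
    proof -
      have right: "A h g = (\<Sum>M'\<in>?S. psum_coeff g M' * A h (psum_mset M'))" if h: "h \<in> Sym" for h
        by (subst Sym_psum_expansion[of g d], use True d in simp, use d in simp,
            rule linear_on_Sym_sum[where scale = "(*)"])
          (use A h in \<open>auto simp: is_macdonald_form_def multisets_of_sum_leD\<close>)
      have "A f g = (\<Sum>M\<in>?S. psum_coeff f M * A (psum_mset M) g)"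
        by (subst Sym_psum_expansion[of f d], use True in simp, use d in simp,
            rule linear_on_Sym_sum[where scale = "(*)"])
          (use A True in \<open>auto simp: is_macdonald_form_def multisets_of_sum_leD\<close>)
      also have "\<dots> = (\<Sum>M\<in>?S. psum_coeff f M * (\<Sum>M'\<in>?S. psum_coeff g M' * A (psum_mset M) (psum_mset M')))"
        by (rule sum.cong) (auto simp: right multisets_of_sum_leD)
      finally show ?thesis .
    qed
    have "B (psum_mset M) (psum_mset M') = power_sum_form (psum_mset M) (psum_mset M')"
      if MM': "M \<in> ?S" "M' \<in> ?S" for M M'
    proof -
      obtain l where l: "l \<in> partitions" "parts_mset l = M"
        using partition_with_parts_mset[OF multisets_of_sum_leD[OF MM'(1)]] .
      obtain l' where l': "l' \<in> partitions" "parts_mset l' = M'"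
        using partition_with_parts_mset[OF multisets_of_sum_leD[OF MM'(2)]] .
      have "B (psum_part l) (psum_part l') = power_sum_form (psum_part l) (psum_part l')"
        using B is_macdonald_form_power_sum_form l(1) l'(1) by (simp add: is_macdonald_form_def)
      then show ?thesis by (simp add: psum_part_parts_mset l l')
    qed
    then have "(\<Sum>M\<in>?S. psum_coeff f M * (\<Sum>M'\<in>?S. psum_coeff g M' * B (psum_mset M) (psum_mset M')))
        = (\<Sum>M\<in>?S. psum_coeff f M * (\<Sum>M'\<in>?S. psum_coeff g M' * power_sum_form (psum_mset M) (psum_mset M')))"
      by (intro sum.cong refl arg_cong2[where f = "(*)"]) auto
    then show ?thesis
      using expand[OF B] expand[OF is_macdonald_form_power_sum_form] by simp
  next
    case False
    then show ?thesis using B by (auto simp: is_macdonald_form_def power_sum_form_def)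
  qed
qed

lemma macdonald_form_eq: "macdonald_form = power_sum_form"
  unfolding macdonald_form_def
  using is_macdonald_form_power_sum_form macdonald_form_unique by (rule the_equality)

text \<open>Each M belongs to exactly one degree, so summing first over degrees and then over M
  merges into one sum. A bound on f cuts it off although g may have unbounded degree.\<close>

lemma macdonald_pairing_eq:
  assumes f: "f \<in> Sym" "degree_le d f" and g: "g \<in> Sym_hat"
  shows "macdonald_pairing f g =
    (\<Sum>M\<in>multisets_of_sum_le d. psum_coeff f M * psum_coeff g M * psum_norm M)"
proof -
  have f': "f \<in> Sym_hat" using f by (simp add: Sym_imp_Sym_hat)
  let ?t = "\<lambda>M. psum_coeff f M * psum_coeff g M * psum_norm M"
  have form: "macdonald_form (hom_component k f) (hom_component k g)
      = (\<Sum>M\<in>multisets_of_sum_le d. if sum_mset M = k then ?t M else 0)" if "k \<le> d" for k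
  proof -
    have "degree_le d (hom_component k f)"
      using hom_component_in_Sym(2)[OF f'] that degree_le_mono by blast
    then have "macdonald_form (hom_component k f) (hom_component k g) = (\<Sum>M\<in>multisets_of_sum_le d.
        psum_coeff (hom_component k f) M * psum_coeff (hom_component k g) M * psum_norm M)"
      unfolding macdonald_form_eq using f' g by (intro power_sum_form_eq hom_component_in_Sym)
    also have "\<dots> = (\<Sum>M\<in>multisets_of_sum_le d. if sum_mset M = k then ?t M else 0)"
      by (rule sum.cong) (use f' g in \<open>auto simp: psum_coeff_hom_component multisets_of_sum_leD\<close>)
    finally show ?thesis .
  qed
  have "hom_component k f = 0" if "d < k" for k
    by (rule mps_eqI) (use f(2) that in \<open>auto simp: mcoeff_hom_component degree_leD\<close>)
  then have sub: "{k. hom_component k f \<noteq> 0} \<subseteq> {..d}"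
    using not_le by (metis (mono_tags, lifting) atMost_iff mem_Collect_eq subsetI)
  have zero: "macdonald_form 0 h = 0" for h
  proof -
    have "degree_le 0 (0 :: series)" by (simp add: degree_le_def)
    moreover have "psum_coeff 0 M = 0" if "0 \<notin># M" for M
      using that by (intro psum_coeff_eq_0) (auto simp: Sym_imp_Sym_hat)
    ultimately show ?thesis
      unfolding macdonald_form_eq by (auto simp: power_sum_form_def)
  qed
  have "macdonald_pairing f g = (\<Sum>k\<le>d. macdonald_form (hom_component k f) (hom_component k g))"
    unfolding macdonald_pairing_def by (rule sum.mono_neutral_left) (use sub in \<open>auto simp: zero\<close>)
  also have "\<dots> = (\<Sum>k\<le>d. \<Sum>M\<in>multisets_of_sum_le d. if sum_mset M = k then ?t M else 0)"
    by (simp add: form)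
  also have "\<dots> = (\<Sum>M\<in>multisets_of_sum_le d. \<Sum>k\<le>d. if sum_mset M = k then ?t M else 0)"
    by (rule sum.swap)
  also have "\<dots> = (\<Sum>M\<in>multisets_of_sum_le d. ?t M)"
    by (rule sum.cong) (auto simp: multisets_of_sum_le_def)
  finally show ?thesis .
qed

section \<open>The morphisms to symmetric polynomials\<close>

lemma mcoeff_restrict_vars:
  "mcoeff (restrict_vars N f) m = (if keys m \<subseteq> {..<N} then mcoeff f m else 0)"
  by (simp add: restrict_vars_def)

lemma keys_add_nat: "keys (a + b) = keys a \<union> keys b" for a b :: "'v \<Rightarrow>\<^sub>0 nat"
  by (auto simp: in_keys_iff lookup_add)

text \<open>Exponents are nonnegative, so a + b avoids the discarded variables exactly when a and b
  both do.\<close>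

lemma restrict_vars_mult: "restrict_vars N (f * g) = restrict_vars N f * restrict_vars N g"
proof (rule mps_eqI)
  fix m
  show "mcoeff (restrict_vars N (f * g)) m = mcoeff (restrict_vars N f * restrict_vars N g) m"
  proof (cases "keys m \<subseteq> {..<N}")
    case True
    then show ?thesis
      unfolding mcoeff_restrict_vars[of N "f * g"] mcoeff_times
      by (auto simp: mcoeff_restrict_vars keys_add_nat intro!: sum.cong)
  next
    case False
    then have "mcoeff (restrict_vars N f * restrict_vars N g) m = 0"
      unfolding mcoeff_times
      by (intro sum.neutral) (auto simp: mcoeff_restrict_vars keys_add_nat)
    then show ?thesis using False by (simp add: mcoeff_restrict_vars[of N "f * g"])
  qed
qed

lemma restrict_vars_psum:
  assumes "r \<noteq> 0"
  shows "restrict_vars N (psum r) = (\<Sum>i<N. mvar i ^ r)"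
proof (rule mps_eqI)
  fix m :: npart
  note inj = single_eq_single_iff[OF assms]
  show "mcoeff (restrict_vars N (psum r)) m = mcoeff (\<Sum>i<N. mvar i ^ r) m"
  proof (cases "\<exists>j. m = single j r")
    case True
    then show ?thesis
      using assms by (auto simp: mcoeff_restrict_vars mcoeff_psum mcoeff_mvar_power inj split: if_splits)
  next
    case False
    then show ?thesis
      using assms by (auto simp: mcoeff_restrict_vars mcoeff_psum mcoeff_mvar_power)
  qed
qed

lemma restrict_vars_in_Sym_poly:
  assumes "f \<in> Sym"
  shows "restrict_vars N f \<in> Sym_poly N"
proof -
  obtain d where d: "degree_le d f" using assms by (auto simp: Sym_iff)
  have "symmetric_in {..<N} (restrict_vars N f)"
    unfolding symmetric_in_def
  proof (intro allI impI)
    fix \<pi> and m :: npart assume \<pi>: "\<pi> permutes {..<N}"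
    have "keys (map_key \<pi> m) = \<pi> -` keys m" using \<pi> by (simp add: keys_map_key permutes_inj)
    moreover have "\<pi> -` keys m \<subseteq> {..<N} \<longleftrightarrow> keys m \<subseteq> {..<N}"
      using permutes_in_image[OF \<pi>] permutes_surj[OF \<pi>] by (metis subset_eq surj_def vimage_eq)
    moreover have "mcoeff f (map_key \<pi> m) = mcoeff f m"
      using assms parts_mset_map_key[OF permutes_bij[OF \<pi>], of m]
      unfolding Sym_iff Sym_hat_iff by blast
    ultimately show "mcoeff (restrict_vars N f) (map_key \<pi> m) = mcoeff (restrict_vars N f) m"
      by (simp add: mcoeff_restrict_vars)
  qed
  moreover have "finite (msupp (restrict_vars N f))"
  proof (rule finite_subset)
    \<comment> \<open>The surviving exponents have N coordinates, each at most the degree d, and so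
      fill part of a finite box.\<close>
    let ?c = "\<Sum>i<N. single i d"
    have c: "lookup ?c i = (if i < N then d else 0)" for i
      by (simp add: lookup_sum lookup_single when_def)
    show "msupp (restrict_vars N f) \<subseteq> {a. \<forall>i. lookup a i \<le> lookup ?c i}"
    proof safe
      fix m i assume "m \<in> msupp (restrict_vars N f)"
      then have m: "keys m \<subseteq> {..<N}" "mcoeff f m \<noteq> 0"
        by (auto simp: msupp_def mcoeff_restrict_vars split: if_splits)
      then have "total_degree m \<le> d" using d degree_leD not_le by metis
      then have "lookup m i \<le> d" using lookup_le_total_degree[of m i] by simp
      moreover have "lookup m i = 0" if "\<not> i < N" using m(1) that by (auto simp: in_keys_iff)
      ultimately show "lookup m i \<le> lookup ?c i" by (simp add: c)
    qed
  qed (rule finite_exponents_le)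
  moreover have "keys m \<subseteq> {..<N}" if "m \<in> msupp (restrict_vars N f)" for m
    using that by (simp add: msupp_def mcoeff_restrict_vars split: if_splits)
  ultimately show ?thesis by (simp add: Sym_poly_def)
qed

lemma Sym_poly_add:
  assumes "f \<in> Sym_poly N" "g \<in> Sym_poly N"
  shows "f + g \<in> Sym_poly N"
proof -
  have sub: "msupp (f + g) \<subseteq> msupp f \<union> msupp g" by (auto simp: msupp_def)
  then have "finite (msupp (f + g))"
    by (rule finite_subset) (use assms in \<open>simp add: Sym_poly_def\<close>)
  moreover have "symmetric_in {..<N} (f + g)"
    using assms by (simp add: Sym_poly_def symmetric_in_def)
  ultimately show ?thesis using assms sub by (fastforce simp: Sym_poly_def)
qed

lemma Sym_poly_mult:
  assumes "f \<in> Sym_poly N" "g \<in> Sym_poly N"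
  shows "f * g \<in> Sym_poly N"
proof -
  have sub: "msupp (f * g) \<subseteq> (\<lambda>p. fst p + snd p) ` (msupp f \<times> msupp g)"
  proof
    fix m assume "m \<in> msupp (f * g)"
    then have "(\<Sum>p | fst p + snd p = m. mcoeff f (fst p) * mcoeff g (snd p)) \<noteq> 0"
      by (simp add: msupp_def mcoeff_times)
    then obtain p where "fst p + snd p = m" "mcoeff f (fst p) * mcoeff g (snd p) \<noteq> 0"
      by (rule sum.not_neutral_contains_not_neutral) simp
    then show "m \<in> (\<lambda>p. fst p + snd p) ` (msupp f \<times> msupp g)"
      by (auto simp: msupp_def intro!: image_eqI[of _ _ p] simp: mem_Times_iff)
  qed
  then have "finite (msupp (f * g))"
    by (rule finite_subset) (use assms in \<open>simp add: Sym_poly_def\<close>)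
  moreover have "symmetric_in {..<N} (f * g)"
    using assms by (simp add: Sym_poly_def symmetric_in_mult)
  moreover have "keys m \<subseteq> {..<N}" if m: "m \<in> msupp (f * g)" for m
  proof -
    obtain a b where "m = a + b" "a \<in> msupp f" "b \<in> msupp g" using subsetD[OF sub m] by auto
    then show ?thesis using assms by (simp add: Sym_poly_def keys_add_nat)
  qed
  ultimately show ?thesis by (simp add: Sym_poly_def)
qed

lemma mconst_in_Sym_poly: "mconst c \<in> Sym_poly N"
proof -
  have "restrict_vars N (mconst c) = mconst c"
    by (rule mps_eqI) (simp add: mcoeff_restrict_vars mcoeff_mconst)
  then show ?thesis using restrict_vars_in_Sym_poly[OF mconst_in_Sym] by metis
qed

text \<open>The r-th power sum of x_1, ..., x_N, t^N, t^(N+1), ...: the constant is the geometric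
  series of the t^(i*r) with i \<ge> N.\<close>

definition shifted_psum :: "nat \<Rightarrow> nat \<Rightarrow> series" where
  "shifted_psum N r = (\<Sum>i<N. mvar i ^ r) + mconst (tv ^ (N * r) / (1 - tv ^ r))"

definition shifted_psum_mset :: "nat \<Rightarrow> nat multiset \<Rightarrow> series" where
  "shifted_psum_mset N M = prod_mset (image_mset (shifted_psum N) M)"

lemma shifted_psum_mset_in_Sym_poly: "0 \<notin># M \<Longrightarrow> shifted_psum_mset N M \<in> Sym_poly N"
proof (induction M)
  case empty
  then show ?case using mconst_in_Sym_poly[of 1 N] by (simp add: shifted_psum_mset_def)
next
  case (add r M)
  then have "shifted_psum N r \<in> Sym_poly N"
    using restrict_vars_in_Sym_poly[OF psum_in_Sym, of r N]
    by (simp add: shifted_psum_def restrict_vars_psum Sym_poly_add mconst_in_Sym_poly)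
  then show ?case using add by (simp add: shifted_psum_mset_def Sym_poly_mult)
qed

text \<open>The linear extension of the prescribed values on power sum products; that it respects
  multiplication has to be proved afterwards.\<close>

definition phi_map :: "nat \<Rightarrow> series \<Rightarrow> series" where
  "phi_map N f = (if f \<in> Sym
     then \<Sum>M | 0 \<notin># M \<and> psum_coeff f M \<noteq> 0. mconst (psum_coeff f M) * shifted_psum_mset N M
     else 0)"

lemma phi_map_eq:
  assumes "f \<in> Sym" "degree_le d f"
  shows "phi_map N f = (\<Sum>M\<in>multisets_of_sum_le d. mconst (psum_coeff f M) * shifted_psum_mset N M)"
proof -
  have "(\<Sum>M | 0 \<notin># M \<and> psum_coeff f M \<noteq> 0. mconst (psum_coeff f M) * shifted_psum_mset N M)
      = (\<Sum>M\<in>multisets_of_sum_le d. mconst (psum_coeff f M) * shifted_psum_mset N M)"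
  proof (rule sum.mono_neutral_left)
    show "{M. 0 \<notin># M \<and> psum_coeff f M \<noteq> 0} \<subseteq> multisets_of_sum_le d"
      using assms psum_coeff_degree_le by blast
    show "finite (multisets_of_sum_le d)" by simp
  qed (auto simp: multisets_of_sum_le_def)
  then show ?thesis using assms by (simp add: phi_map_def)
qed

lemma phi_map_psum_mset:
  assumes "0 \<notin># M"
  shows "phi_map N (psum_mset M) = shifted_psum_mset N M"
proof -
  let ?S = "multisets_of_sum_le (sum_mset M)"
  have "phi_map N (psum_mset M) = (\<Sum>K\<in>?S. mconst (psum_coeff (psum_mset M) K) * shifted_psum_mset N K)"
    using assms by (intro phi_map_eq degree_le_psum_mset) auto
  also have "\<dots> = (\<Sum>K\<in>?S. if K = M then shifted_psum_mset N M else 0)"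
    by (rule sum.cong) (use assms in \<open>auto simp: psum_coeff_psum_mset multisets_of_sum_leD\<close>)
  also have "\<dots> = shifted_psum_mset N M"
  proof -
    have "M \<in> ?S" using assms by (simp add: multisets_of_sum_le_def)
    then show ?thesis by simp
  qed
  finally show ?thesis .
qed

lemma phi_map_add:
  assumes "f \<in> Sym" "g \<in> Sym"
  shows "phi_map N (f + g) = phi_map N f + phi_map N g"
proof -
  obtain d where d: "degree_le d f" "degree_le d g" using assms common_degree_bound by blast
  then have "degree_le d (f + g)" by (rule degree_le_add)
  with assms d show ?thesis
    by (simp add: phi_map_eq[where d = d] psum_coeff_add Sym_imp_Sym_hat multisets_of_sum_leD
        mconst_add distrib_right sum.distrib)
qed

lemma phi_map_mconst_times:
  assumes "f \<in> Sym"
  shows "phi_map N (mconst c * f) = mconst c * phi_map N f"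
proof -
  obtain d where d: "degree_le d f" using assms by (auto simp: Sym_iff)
  then have "degree_le d (mconst c * f)" by (rule degree_le_mconst_times)
  with assms d show ?thesis
    by (simp add: phi_map_eq[where d = d] psum_coeff_mconst_times Sym_imp_Sym_hat multisets_of_sum_leD
        mconst_mult sum_distrib_left mult.assoc)
qed

text \<open>Expanding both arguments leaves products of power sum products. There multiplication is
  union of multisets, on both the source and the target side.\<close>

lemma phi_map_mult:
  assumes "f \<in> Sym" "g \<in> Sym"
  shows "phi_map N (f * g) = phi_map N f * phi_map N g"
proof -
  obtain d where d: "degree_le d f" "degree_le d g" using assms common_degree_bound by blast
  let ?S = "multisets_of_sum_le d"
  have g: "phi_map N (h * g) = (\<Sum>M\<in>?S. mconst (psum_coeff g M) * phi_map N (h * psum_mset M))"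
    if h: "h \<in> Sym" for h
  proof -
    have "h * g = h * (\<Sum>M\<in>?S. mconst (psum_coeff g M) * psum_mset M)"
      using Sym_psum_expansion assms(2) d(2) by metis
    also have "\<dots> = (\<Sum>M\<in>?S. mconst (psum_coeff g M) * (h * psum_mset M))"
      by (simp add: sum_distrib_left mult.left_commute)
    finally have "phi_map N (h * g) = phi_map N (\<Sum>M\<in>?S. mconst (psum_coeff g M) * (h * psum_mset M))"
      by simp
    also have "\<dots> = (\<Sum>M\<in>?S. mconst (psum_coeff g M) * phi_map N (h * psum_mset M))"
      by (rule linear_on_Sym_sum[where scale = "\<lambda>c x. mconst c * x"])
        (use h in \<open>auto simp: phi_map_add phi_map_mconst_times multisets_of_sum_leD\<close>)
    finally show ?thesis .
  qed
  have "f * g = (\<Sum>M\<in>?S. mconst (psum_coeff f M) * psum_mset M) * g"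
    using Sym_psum_expansion assms(1) d(1) by metis
  also have "\<dots> = (\<Sum>M\<in>?S. mconst (psum_coeff f M) * (psum_mset M * g))"
    by (simp add: sum_distrib_right mult.assoc)
  finally have "phi_map N (f * g) = phi_map N (\<Sum>M\<in>?S. mconst (psum_coeff f M) * (psum_mset M * g))"
    by simp
  also have "\<dots> = (\<Sum>M\<in>?S. mconst (psum_coeff f M) * phi_map N (psum_mset M * g))"
    by (rule linear_on_Sym_sum[where scale = "\<lambda>c x. mconst c * x"])
      (use assms in \<open>auto simp: phi_map_add phi_map_mconst_times multisets_of_sum_leD\<close>)
  also have "\<dots> = (\<Sum>M\<in>?S. mconst (psum_coeff f M) * (shifted_psum_mset N M * phi_map N g))"
  proof (rule sum.cong[OF refl])
    fix M assume M: "M \<in> ?S"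
    have "phi_map N (psum_mset M * g) =
        (\<Sum>M'\<in>?S. mconst (psum_coeff g M') * phi_map N (psum_mset M * psum_mset M'))"
      by (rule g) (use M in \<open>simp add: multisets_of_sum_leD\<close>)
    also have "\<dots> = (\<Sum>M'\<in>?S. mconst (psum_coeff g M') * (shifted_psum_mset N M * shifted_psum_mset N M'))"
    proof (rule sum.cong[OF refl])
      fix M' assume "M' \<in> ?S"
      then have "0 \<notin># M + M'" using M multisets_of_sum_leD by auto
      then show "mconst (psum_coeff g M') * phi_map N (psum_mset M * psum_mset M') =
          mconst (psum_coeff g M') * (shifted_psum_mset N M * shifted_psum_mset N M')"
        by (simp add: phi_map_psum_mset shifted_psum_mset_def flip: psum_mset_union)
    qed
    also have "\<dots> = shifted_psum_mset N M * phi_map N g"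
      using assms d by (simp add: phi_map_eq sum_distrib_left mult.left_commute)
    finally show "mconst (psum_coeff f M) * phi_map N (psum_mset M * g) =
        mconst (psum_coeff f M) * (shifted_psum_mset N M * phi_map N g)" by simp
  qed
  also have "\<dots> = phi_map N f * phi_map N g"
    using assms d by (simp add: phi_map_eq[of f d] sum_distrib_right mult.assoc)
  finally show ?thesis .
qed

lemma is_phi_phi_map: "is_phi N (phi_map N)"
  unfolding is_phi_def
proof (intro conjI allI ballI impI)
  fix f assume "f \<notin> Sym"
  then show "phi_map N f = 0" by (simp add: phi_map_def)
next
  fix f assume f: "f \<in> Sym"
  then obtain d where d: "degree_le d f" by (auto simp: Sym_iff)
  have "sum h S \<in> Sym_poly N" if "\<And>M. M \<in> S \<Longrightarrow> h M \<in> Sym_poly N" for h :: "nat multiset \<Rightarrow> series" and S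
    using that mconst_in_Sym_poly[of 0 N]
    by (induction S rule: infinite_finite_induct) (auto simp: Sym_poly_add)
  then show "phi_map N f \<in> Sym_poly N"
    by (simp add: phi_map_eq[OF f d] mconst_in_Sym_poly shifted_psum_mset_in_Sym_poly
        multisets_of_sum_leD Sym_poly_mult)
next
  show "phi_map N 1 = 1"
    using phi_map_psum_mset[of "{#}" N] by (simp add: shifted_psum_mset_def)
next
  fix n :: nat assume "1 \<le> n"
  then show "phi_map N (psum n) = (\<Sum>i<N. mvar i ^ n) + mconst (tv ^ (N * n) / (1 - tv ^ n))"
    using phi_map_psum_mset[of "{#n#}" N]
    by (simp add: shifted_psum_mset_def shifted_psum_def)
next
  fix f g assume "f \<in> Sym" "g \<in> Sym"
  then show "phi_map N (f + g) = phi_map N f + phi_map N g" "phi_map N (f * g) = phi_map N f * phi_map N g"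
    by (fact phi_map_add, fact phi_map_mult)
next
  fix c f assume "f \<in> Sym"
  then show "phi_map N (mconst c * f) = mconst c * phi_map N f" by (rule phi_map_mconst_times)
qed

text \<open>The power sums generate \<open>Sym\<close> as an algebra, by
  \<open>Sym_psum_expansion\<close>, so their images fix the morphism.\<close>

lemma is_phi_unique:
  assumes \<phi>: "is_phi N \<phi>"
  shows "\<phi> = phi_map N"
proof (rule ext)
  fix f
  have psum: "\<phi> (psum_mset M) = shifted_psum_mset N M" if "0 \<notin># M" for M
    using that
  proof (induction M)
    case empty
    then show ?case using \<phi> by (simp add: is_phi_def shifted_psum_mset_def)
  next
    case (add r M)
    then have "r \<ge> 1" "psum r \<in> Sym" "psum_mset M \<in> Sym" by (auto simp: psum_in_Sym)
    then have "\<phi> (psum r * psum_mset M) = \<phi> (psum r) * \<phi> (psum_mset M)" "\<phi> (psum r) = shifted_psum N r"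
      using \<phi> by (simp_all add: is_phi_def shifted_psum_def)
    then show ?case using add by (simp add: shifted_psum_mset_def)
  qed
  show "\<phi> f = phi_map N f"
  proof (cases "f \<in> Sym")
    case True
    then obtain d where d: "degree_le d f" by (auto simp: Sym_iff)
    have "\<phi> f = \<phi> (\<Sum>M\<in>multisets_of_sum_le d. mconst (psum_coeff f M) * psum_mset M)"
      using Sym_psum_expansion[OF True d] by simp
    also have "\<dots> = (\<Sum>M\<in>multisets_of_sum_le d. mconst (psum_coeff f M) * \<phi> (psum_mset M))"
      by (rule linear_on_Sym_sum[where scale = "\<lambda>c x. mconst c * x"])
        (use \<phi> in \<open>auto simp: is_phi_def multisets_of_sum_leD\<close>)
    also have "\<dots> = phi_map N f"
      by (simp add: phi_map_eq[OF True d] psum multisets_of_sum_leD)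
    finally show ?thesis .
  next
    case False
    then show ?thesis using \<phi> by (simp add: is_phi_def phi_map_def)
  qed
qed

lemma phi_eq: "phi N = phi_map N"
  unfolding phi_def using is_phi_phi_map is_phi_unique by (rule the_equality)

text \<open>Replacing a factor p_r by its shift constant lowers the degree, so in degree
  \<open>sum_mset M\<close> and above the constants are invisible. Covering the degrees above as
  well is what lets the induction discard them.\<close>

lemma mcoeff_shifted_psum_mset:
  assumes "0 \<notin># M" "sum_mset M \<le> total_degree m"
  shows "mcoeff (shifted_psum_mset N M) m = mcoeff (restrict_vars N (psum_mset M)) m"
  using assms
proof (induction M arbitrary: m)
  case empty
  then show ?case by (simp add: shifted_psum_mset_def mcoeff_restrict_vars mcoeff_one)
next
  case (add r M)
  then have r: "r \<noteq> 0" and M: "0 \<notin># M" by auto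
  let ?R = "restrict_vars N (psum r)" and ?S = "shifted_psum_mset N M"
  have "degree_le (sum_mset M) (psum_mset M)" using M by (rule degree_le_psum_mset)
  \<comment> \<open>This disposes of the constant of the factor r: the remaining factors have degree
    at most \<open>sum_mset M\<close>, which is below the degree of m because r is positive.\<close>
  then have "mcoeff ?S m = 0"
    using add.IH[OF M, of m] add.prems r by (auto simp: mcoeff_restrict_vars degree_leD)
  moreover have "mcoeff (?R * ?S) m = mcoeff (?R * restrict_vars N (psum_mset M)) m"
    unfolding mcoeff_times
  proof (rule sum.cong[OF refl], safe)
    fix a b assume m: "m = fst (a, b) + snd (a, b)"
    show "mcoeff ?R (fst (a, b)) * mcoeff ?S (snd (a, b)) =
        mcoeff ?R (fst (a, b)) * mcoeff (restrict_vars N (psum_mset M)) (snd (a, b))"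
    proof (cases "mcoeff ?R a = 0")
      case False
      then have "total_degree a = r"
        using r by (auto simp: mcoeff_restrict_vars mcoeff_psum split: if_splits)
      then have "sum_mset M \<le> total_degree b" using add.prems m by simp
      then show ?thesis using add.IH[OF M, of b] by simp
    qed simp
  qed
  ultimately show ?case
    by (simp add: shifted_psum_mset_def shifted_psum_def restrict_vars_mult
        restrict_vars_psum[OF r] distrib_right)
qed

lemma mcoeff_phi:
  assumes "f \<in> Sym" "degree_le d f" "d \<le> total_degree m"
  shows "mcoeff (phi N f) m = mcoeff (restrict_vars N f) m"
proof -
  let ?S = "multisets_of_sum_le d"
  have "mcoeff (phi N f) m = (\<Sum>M\<in>?S. psum_coeff f M * mcoeff (restrict_vars N (psum_mset M)) m)"
    unfolding phi_eq phi_map_eq[OF assms(1,2)] mcoeff_sum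
    by (rule sum.cong) (use assms(3) in \<open>auto simp: mcoeff_shifted_psum_mset multisets_of_sum_le_def\<close>)
  also have "\<dots> = mcoeff (restrict_vars N (\<Sum>M\<in>?S. mconst (psum_coeff f M) * psum_mset M)) m"
    by (simp add: mcoeff_restrict_vars)
  finally show ?thesis using Sym_psum_expansion[OF assms(1,2)] by simp
qed

section \<open>The interpolation basis and its dual\<close>

text \<open>A monomial of degree d has at most d variables, and sorting moves them to the first d
  places. Hence restriction to N \<ge> d variables preserves all information about a symmetric
  series in degree d.\<close>

lemma partition_rearrangement:
  fixes m :: npart
  obtains l where "l \<in> partitions" "parts_mset l = parts_mset m" "total_degree l = total_degree m"
    "keys l \<subseteq> {..<total_degree m}"
proof -
  obtain l where l: "l \<in> partitions" "parts_mset l = parts_mset m"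
    using partition_with_parts_mset[of "parts_mset m"] by auto
  then have "total_degree l = total_degree m" by (metis sum_mset_parts_mset)
  moreover have "keys l \<subseteq> {..<total_degree m}"
    using keys_partition[OF l(1)] plength_le_total_degree[of l] calculation by auto
  ultimately show ?thesis using l that by blast
qed

lemma Sym_hatD: "f \<in> Sym_hat \<Longrightarrow> parts_mset m = parts_mset m' \<Longrightarrow> mcoeff f m = mcoeff f m'"
  unfolding Sym_hat_iff by blast

lemma is_interpolation_polynomial_degree:
  assumes "is_interpolation_polynomial P N \<mu> f" "total_degree \<mu> < total_degree m"
  shows "mcoeff f m = 0"
proof (rule ccontr)
  assume "mcoeff f m \<noteq> 0"
  then have "m \<in> msupp f" by (simp add: msupp_def)
  moreover have "finite (msupp f)" "mpoly_degree f = total_degree \<mu>"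
    using assms(1) by (auto simp: is_interpolation_polynomial_def Sym_poly_def)
  ultimately have "total_degree m \<le> total_degree \<mu>"
    unfolding mpoly_degree_def by (metis Max_ge finite_imageI finite_insert image_eqI insertCI)
  then show False using assms(2) by simp
qed

text \<open>Let d be the least degree bound of f and suppose that it exceeds the size of \<mu>. In
  degree d the morphism is mere restriction, its image has no terms there, and for N \<ge> d every
  orbit of degree d is visible; so d - 1 is a bound too.\<close>

lemma interpolation_function_degree:
  assumes f: "f \<in> Sym"
    and interp: "\<And>N. N \<ge> plength \<mu> \<Longrightarrow> is_interpolation_polynomial P N \<mu> (phi N f)"
  shows "degree_le (total_degree \<mu>) f"
proof (rule ccontr)
  assume neg: "\<not> degree_le (total_degree \<mu>) f"
  define d where "d = (LEAST d. degree_le d f)"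
  have "\<exists>d. degree_le d f" using f by (simp add: Sym_iff)
  then have d: "degree_le d f" unfolding d_def by (rule LeastI_ex)
  then have less: "total_degree \<mu> < d" using neg degree_le_mono not_le by metis
  have "degree_le (d - 1) f"
    unfolding degree_le_def
  proof (intro allI impI)
    fix m :: npart assume "d - 1 < total_degree m"
    then consider "total_degree m = d" | "d < total_degree m" by linarith
    then show "mcoeff f m = 0"
    proof cases
      case 1
      obtain l where l: "parts_mset l = parts_mset m" "total_degree l = d" "keys l \<subseteq> {..<d}"
        using partition_rearrangement[of m] 1 by metis
      \<comment> \<open>Large enough to keep the variables of l and for the interpolation polynomial
        to exist.\<close>
      define N where "N = max d (plength \<mu>)"
      have "mcoeff (phi N f) l = mcoeff (restrict_vars N f) l"
        using f d l(2) by (intro mcoeff_phi) auto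
      moreover have "mcoeff (phi N f) l = 0"
        by (rule is_interpolation_polynomial_degree[OF interp]) (use l less in \<open>auto simp: N_def\<close>)
      moreover have "keys l \<subseteq> {..<N}" using l(3) by (auto simp: N_def)
      ultimately have "mcoeff f l = 0" by (simp add: mcoeff_restrict_vars)
      then show ?thesis using Sym_hatD[OF Sym_imp_Sym_hat[OF f] l(1)] by simp
    next
      case 2
      then show ?thesis using d by (simp add: degree_leD)
    qed
  qed
  then have "d \<le> d - 1" unfolding d_def by (rule Least_le)
  then show False using less by simp
qed

text \<open>With the degree bound known, the morphism is restriction in the degree of \<mu>, and an
  N that retains a representative of every orbit of that degree transfers the prescribed top
  component to f.\<close>

lemma interpolation_function_top:
  assumes f: "f \<in> Sym" and P: "P \<mu> \<in> Sym_hat"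
    and interp: "\<And>N. N \<ge> plength \<mu> \<Longrightarrow> is_interpolation_polynomial P N \<mu> (phi N f)"
    and m: "total_degree m = total_degree \<mu>"
  shows "mcoeff f m = mcoeff (P \<mu>) m"
proof -
  obtain l where l: "parts_mset l = parts_mset m" "total_degree l = total_degree \<mu>"
      "keys l \<subseteq> {..<total_degree \<mu>}"
    using partition_rearrangement[of m] m by metis
  define N where "N = max (total_degree \<mu>) (plength \<mu>)"
  have N: "is_interpolation_polynomial P N \<mu> (phi N f)" by (rule interp) (simp add: N_def)
  have keys: "keys l \<subseteq> {..<N}" using l(3) by (auto simp: N_def)
  have "degree_le (total_degree \<mu>) f" using f interp by (rule interpolation_function_degree)
  then have "mcoeff f l = mcoeff (phi N f) l"
    using mcoeff_phi[OF f, of _ l N] l(2) keys by (simp add: mcoeff_restrict_vars)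
  also have "\<dots> = mcoeff (hom_component (total_degree \<mu>) (phi N f)) l"
    using l(2) by (simp add: mcoeff_hom_component)
  also have "hom_component (total_degree \<mu>) (phi N f) = restrict_vars N (P \<mu>)"
    using N unfolding is_interpolation_polynomial_def by metis
  also have "mcoeff \<dots> l = mcoeff (P \<mu>) l"
    using keys by (simp add: mcoeff_restrict_vars)
  finally show ?thesis
    using Sym_hatD[OF Sym_imp_Sym_hat[OF f] l(1)] Sym_hatD[OF P l(1)] by simp
qed

section \<open>Unitriangularity and spanning\<close>

lemma finite_partitions_of_degree: "finite {l \<in> partitions. total_degree l = d}"
  by (rule finite_subset[OF _ finite_partitions_le[of d]]) auto

text \<open>At exponents that are partitions each \<open>msym\<close> is an indicator, because
  distinct partitions have distinct multisets of parts; the coefficients are then those of the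
  defining expansion.\<close>

lemma macdonald_functions_triangular:
  assumes "macdonald_functions P" and l: "l \<in> partitions"
  shows "P l \<in> Sym_hat" "mcoeff (P l) l = 1"
    and "\<And>l'. l' \<in> partitions \<Longrightarrow> mcoeff (P l) l' \<noteq> 0 \<Longrightarrow> l' = l \<or> dominance_le l' l"
proof -
  let ?D = "{m. m \<in> partitions \<and> dominance_le m l \<and> m \<noteq> l}"
  obtain u where P: "P l = msym l + (\<Sum>m | m \<in> partitions \<and> dominance_le m l \<and> m \<noteq> l. mconst (u m) * msym m)"
    using assms unfolding macdonald_functions_def by blast
  have coeff: "mcoeff (P l) m' = (if parts_mset m' = parts_mset l then 1 else 0) +
      (\<Sum>m\<in>?D. u m * (if parts_mset m' = parts_mset m then 1 else 0))" for m'
    by (simp add: P mcoeff_msym)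
  show "P l \<in> Sym_hat" unfolding Sym_hat_iff coeff by simp
  have "(\<Sum>m\<in>?D. u m * (if parts_mset l = parts_mset m then 1 else 0)) = 0"
    by (rule sum.neutral) (use l parts_mset_inj_partitions in auto)
  then show "mcoeff (P l) l = 1" by (simp add: coeff)
  fix l' assume l': "l' \<in> partitions" "mcoeff (P l) l' \<noteq> 0"
  show "l' = l \<or> dominance_le l' l"
  proof (rule ccontr)
    assume neg: "\<not> (l' = l \<or> dominance_le l' l)"
    then have "parts_mset l' \<noteq> parts_mset l" using l l' parts_mset_inj_partitions by blast
    moreover have "(\<Sum>m\<in>?D. u m * (if parts_mset l' = parts_mset m then 1 else 0)) = 0"
      by (rule sum.neutral) (use neg l' parts_mset_inj_partitions in force)
    ultimately show False using l' by (simp add: coeff)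
  qed
qed

text \<open>A numerical linear extension of the dominance order, as \<open>triangular_solve\<close>
  requires: the sum of all partial sums. Cutting off at the size loses nothing, since a partition of
  d has at most d parts.\<close>

definition dominance_rank :: "npart \<Rightarrow> nat" where
  "dominance_rank l = (\<Sum>k\<le>total_degree l. \<Sum>i<k. lookup l i)"

lemma dominance_rank_strict:
  assumes "dominance_le l' l" "l' \<noteq> l" "l \<in> partitions" "l' \<in> partitions"
  shows "dominance_rank l' < dominance_rank l"
proof -
  define d where "d = total_degree l"
  have deg: "total_degree l' = d" and le: "\<And>k. (\<Sum>i<k. lookup l' i) \<le> (\<Sum>i<k. lookup l i)"
    using assms(1) by (auto simp: dominance_le_def d_def)
  have "\<exists>k\<in>{..d}. (\<Sum>i<k. lookup l' i) < (\<Sum>i<k. lookup l i)"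
  proof (rule ccontr)
    assume "\<not> ?thesis"
    then have eq: "(\<Sum>i<k. lookup l' i) = (\<Sum>i<k. lookup l i)" if "k \<le> d" for k
      using le that by (meson antisym atMost_iff not_less)
    have "lookup l' i = lookup l i" for i
    proof (cases "i < d")
      case True
      then show ?thesis using eq[of i] eq[of "Suc i"] by simp
    next
      case False
      then have "i \<notin> keys l" "i \<notin> keys l'"
        using keys_partition[OF assms(3)] keys_partition[OF assms(4)] deg
          plength_le_total_degree[of l] plength_le_total_degree[of l'] by (auto simp: d_def)
      then show ?thesis by (simp add: in_keys_iff)
    qed
    then show False using assms(2) poly_mapping_eqI by metis
  qed
  then have "(\<Sum>k\<le>d. \<Sum>i<k. lookup l' i) < (\<Sum>k\<le>d. \<Sum>i<k. lookup l i)"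
    by (intro sum_strict_mono_ex1) (auto simp: le)
  then show ?thesis by (simp add: dominance_rank_def deg flip: d_def)
qed

text \<open>Descent on the degree. The P's of degree d form a unitriangular system and so match the
  degree d part of f; the corresponding I's have the same top components, and subtracting them
  leaves lower degree. The strict bound d makes d = 0 the case of the zero series.\<close>

lemma interpolation_functions_span:
  assumes P: "macdonald_functions P"
    and I: "\<And>\<mu>. \<mu> \<in> partitions \<Longrightarrow> I \<mu> \<in> Sym"
      "\<And>\<mu>. \<mu> \<in> partitions \<Longrightarrow> degree_le (total_degree \<mu>) (I \<mu>)"
      "\<And>\<mu> m. \<mu> \<in> partitions \<Longrightarrow> total_degree m = total_degree \<mu> \<Longrightarrow> mcoeff (I \<mu>) m = mcoeff (P \<mu>) m"
    and f: "f \<in> Sym" "\<And>m. d \<le> total_degree m \<Longrightarrow> mcoeff f m = 0"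
  shows "\<exists>a. f = (\<Sum>\<mu> | \<mu> \<in> partitions \<and> total_degree \<mu> < d. mconst (a \<mu>) * I \<mu>)"
  using f
proof (induction d arbitrary: f)
  case 0
  then have "f = 0" by (intro mps_eqI) simp
  then show ?case by simp
next
  case (Suc d)
  let ?S = "{l \<in> partitions. total_degree l = d}"
  let ?T = "{\<mu>. \<mu> \<in> partitions \<and> total_degree \<mu> < d}"
  have "\<exists>c. \<forall>l'\<in>?S. mcoeff f l' = (\<Sum>l\<in>?S. c l * mcoeff (P l) l')"
  proof (rule triangular_solve[where s = dominance_rank])
    fix l l' assume "l \<in> ?S" "l' \<in> ?S" "mcoeff (P l) l' \<noteq> 0"
    then show "l = l' \<or> dominance_rank l' < dominance_rank l"
      using macdonald_functions_triangular(3)[OF P] dominance_rank_strict by blast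
  next
    fix l assume "l \<in> ?S"
    then show "mcoeff (P l) l \<noteq> 0" using macdonald_functions_triangular(2)[OF P, of l] by simp
  qed (rule finite_partitions_of_degree)
  then obtain c where c: "\<And>l'. l' \<in> ?S \<Longrightarrow> mcoeff f l' = (\<Sum>l\<in>?S. c l * mcoeff (P l) l')" by blast
  \<comment> \<open>The coefficients found for the P's are reused for the I's, which differ from
    them only in lower degree.\<close>
  define g where "g = f + mconst (- 1) * (\<Sum>l\<in>?S. mconst (c l) * I l)"
  have coeff: "mcoeff g m = mcoeff f m - (\<Sum>l\<in>?S. c l * mcoeff (I l) m)" for m
    by (simp add: g_def)
  have "g \<in> Sym"
    unfolding g_def by (intro Sym_closed Sym_sum Sym_simps(3) Suc.prems(1) I(1)) simp
  moreover have "mcoeff g m = 0" if "d \<le> total_degree m" for m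
  proof (cases "total_degree m = d")
    case True
    obtain l' where l': "l' \<in> partitions" "parts_mset l' = parts_mset m" "total_degree l' = total_degree m"
      using partition_rearrangement[of m] by blast
    have "mcoeff g m = mcoeff g l'"
      using Sym_hatD[OF Sym_imp_Sym_hat[OF \<open>g \<in> Sym\<close>] l'(2)] by simp
    also have "\<dots> = mcoeff f l' - (\<Sum>l\<in>?S. c l * mcoeff (P l) l')"
      unfolding coeff using I(3) l'(3) True by simp
    also have "\<dots> = 0" using c l' True by simp
    finally show ?thesis .
  next
    case False
    then have "d < total_degree m" using that by simp
    then have "mcoeff (I l) m = 0" if "l \<in> ?S" for l
      using that I(2)[of l] degree_leD by auto
    then show ?thesis using False that Suc.prems(2) by (simp add: coeff)
  qed
  ultimately obtain a where a: "g = (\<Sum>\<mu>\<in>?T. mconst (a \<mu>) * I \<mu>)"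
    using Suc.IH by blast
  have fin: "finite ?T" by (rule finite_subset[OF _ finite_partitions_le[of d]]) auto
  \<comment> \<open>The two families of coefficients concern disjoint ranges of degree, so they
    combine into one function.\<close>
  let ?a = "\<lambda>\<mu>. if total_degree \<mu> < d then a \<mu> else c \<mu>"
  have "f = g + (\<Sum>l\<in>?S. mconst (c l) * I l)"
    by (rule mps_eqI) (simp add: coeff)
  also have "\<dots> = (\<Sum>\<mu>\<in>?T. mconst (?a \<mu>) * I \<mu>) + (\<Sum>\<mu>\<in>?S. mconst (?a \<mu>) * I \<mu>)"
    unfolding a by (intro arg_cong2[where f = "(+)"] sum.cong) auto
  also have "\<dots> = (\<Sum>\<mu>\<in>?T \<union> ?S. mconst (?a \<mu>) * I \<mu>)"
    by (rule sum.union_disjoint[symmetric]) (use fin finite_partitions_of_degree in auto)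
  also have "?T \<union> ?S = {\<mu>. \<mu> \<in> partitions \<and> total_degree \<mu> < Suc d}" by auto
  finally show ?case by (rule exI[of _ ?a])
qed

section \<open>Duality against power sums\<close>

lemma macdonald_pairing_linear:
  assumes "\<And>i. i \<in> S \<Longrightarrow> h i \<in> Sym" "finite S" "g \<in> Sym_hat"
  shows "macdonald_pairing (\<Sum>i\<in>S. mconst (c i) * h i) g = (\<Sum>i\<in>S. c i * macdonald_pairing (h i) g)"
proof (rule linear_on_Sym_sum[where \<Phi> = "\<lambda>f. macdonald_pairing f g" and scale = "(*)" and h = h])
  fix f f' assume f: "f \<in> Sym" "f' \<in> Sym"
  obtain d where d: "degree_le d f" "degree_le d f'" using f common_degree_bound by blast
  then have "degree_le d (f + f')" by (rule degree_le_add)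
  with f d assms(3) show "macdonald_pairing (f + f') g = macdonald_pairing f g + macdonald_pairing f' g"
    by (simp add: macdonald_pairing_eq[where d = d] psum_coeff_add Sym_imp_Sym_hat
        multisets_of_sum_leD distrib_right sum.distrib)
next
  fix c f assume f: "f \<in> Sym"
  obtain d where d: "degree_le d f" using f by (auto simp: Sym_iff)
  then have "degree_le d (mconst c * f)" by (rule degree_le_mconst_times)
  with f d assms(3) show "macdonald_pairing (mconst c * f) g = c * macdonald_pairing f g"
    by (simp add: macdonald_pairing_eq[where d = d] psum_coeff_mconst_times Sym_imp_Sym_hat
        multisets_of_sum_leD sum_distrib_left mult.assoc)
next
  show "\<And>i. i \<in> S \<Longrightarrow> h i \<in> Sym" by (rule assms(1))
  show "finite S" by (rule assms(2))
qed

lemma macdonald_pairing_psum_mset: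
  assumes "0 \<notin># M" "g \<in> Sym_hat"
  shows "macdonald_pairing (psum_mset M) g = psum_coeff g M * psum_norm M"
proof -
  let ?S = "multisets_of_sum_le (sum_mset M)"
  have "macdonald_pairing (psum_mset M) g = (\<Sum>K\<in>?S. psum_coeff (psum_mset M) K * psum_coeff g K * psum_norm K)"
    using assms by (intro macdonald_pairing_eq degree_le_psum_mset) auto
  also have "\<dots> = (\<Sum>K\<in>?S. if K = M then psum_coeff g M * psum_norm M else 0)"
    by (rule sum.cong) (use assms in \<open>auto simp: psum_coeff_psum_mset multisets_of_sum_leD\<close>)
  also have "\<dots> = psum_coeff g M * psum_norm M"
  proof -
    have "M \<in> ?S" using assms by (simp add: multisets_of_sum_le_def)
    then show ?thesis by simp
  qed
  finally show ?thesis .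
qed

text \<open>Pairing an expansion of \<open>psum_mset M\<close> in the I's with
  \<open>H \<nu>\<close> isolates one coefficient, while the diagonal form evaluates the same
  pairing as \<open>psum_coeff (H \<nu>) M * psum_norm M\<close>. If \<nu> is larger than M it does
  not occur in the expansion, so \<open>H \<nu>\<close> has no terms of degree below its
  size.\<close>

lemma psum_mset_dual_expansion:
  assumes span: "\<And>f d. f \<in> Sym \<Longrightarrow> degree_le d f \<Longrightarrow>
      \<exists>a. f = (\<Sum>\<mu> | \<mu> \<in> partitions \<and> total_degree \<mu> \<le> d. mconst (a \<mu>) * I \<mu>)"
    and I: "\<And>\<mu>. \<mu> \<in> partitions \<Longrightarrow> I \<mu> \<in> Sym"
    and H: "dual_functions I H" and M: "0 \<notin># M"
  shows "psum_mset M = (\<Sum>\<mu> | \<mu> \<in> partitions \<and> total_degree \<mu> \<le> sum_mset M.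
      mconst (psum_coeff (H \<mu>) M * psum_norm M) * I \<mu>)"
    and "\<And>\<nu>. \<nu> \<in> partitions \<Longrightarrow> sum_mset M < total_degree \<nu> \<Longrightarrow> psum_coeff (H \<nu>) M = 0"
proof -
  let ?S = "{\<mu>. \<mu> \<in> partitions \<and> total_degree \<mu> \<le> sum_mset M}"
  have fin: "finite ?S" using finite_partitions_le by simp
  obtain a where a: "psum_mset M = (\<Sum>\<mu>\<in>?S. mconst (a \<mu>) * I \<mu>)"
    using span[OF psum_mset_in_Sym degree_le_psum_mset] M by blast
  have coeff: "psum_coeff (H \<nu>) M * psum_norm M = (if \<nu> \<in> ?S then a \<nu> else 0)" if \<nu>: "\<nu> \<in> partitions" for \<nu>
  proof -
    have "H \<nu> \<in> Sym_hat" using H \<nu> by (simp add: dual_functions_def)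
    then have "psum_coeff (H \<nu>) M * psum_norm M = macdonald_pairing (psum_mset M) (H \<nu>)"
      using M by (simp add: macdonald_pairing_psum_mset)
    also have "\<dots> = (\<Sum>\<mu>\<in>?S. a \<mu> * macdonald_pairing (I \<mu>) (H \<nu>))"
      unfolding a by (rule macdonald_pairing_linear) (use I fin \<open>H \<nu> \<in> Sym_hat\<close> in auto)
    also have "\<dots> = (\<Sum>\<mu>\<in>?S. if \<mu> = \<nu> then a \<nu> else 0)"
      by (rule sum.cong) (use H \<nu> in \<open>auto simp: dual_functions_def\<close>)
    also have "\<dots> = (if \<nu> \<in> ?S then a \<nu> else 0)" using fin by simp
    finally show ?thesis .
  qed
  have "(\<Sum>\<mu>\<in>?S. mconst (a \<mu>) * I \<mu>) = (\<Sum>\<mu>\<in>?S. mconst (psum_coeff (H \<mu>) M * psum_norm M) * I \<mu>)"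
    by (rule sum.cong) (auto simp: coeff)
  with a show "psum_mset M = (\<Sum>\<mu>\<in>?S. mconst (psum_coeff (H \<mu>) M * psum_norm M) * I \<mu>)" by simp
  fix \<nu> assume "\<nu> \<in> partitions" "sum_mset M < total_degree \<nu>"
  then show "psum_coeff (H \<nu>) M = 0" using coeff[of \<nu>] psum_norm_nonzero[OF M] by simp
qed

section \<open>Two alphabets\<close>

text \<open>\<open>map_key h\<close> forgets exponents outside the range of h. On exponents
  supported in that range it is a bijection; this is surjectivity, and \<open>map_key_eqD\<close> is
  injectivity.\<close>

lemma map_key_extension:
  assumes "inj h"
  obtains a' where "keys a' \<subseteq> range h" "map_key h a' = (a :: 'v \<Rightarrow>\<^sub>0 nat)"
proof
  let ?f = "\<lambda>w. if w \<in> range h then lookup a (inv h w) else 0"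
  have "{w. ?f w \<noteq> 0} \<subseteq> h ` keys a"
    using assms by (auto simp: in_keys_iff split: if_splits)
  then have "finite {w. ?f w \<noteq> 0}" by (rule finite_subset) simp
  then have f: "lookup (Abs_poly_mapping ?f) = ?f" by (simp add: Abs_poly_mapping_inverse)
  show "keys (Abs_poly_mapping ?f) \<subseteq> range h"
    by (auto simp: in_keys_iff f split: if_splits)
  show "map_key h (Abs_poly_mapping ?f) = a"
    by (rule poly_mapping_eqI) (simp add: map_key.rep_eq assms f)
qed

lemma map_key_eqD:
  assumes "inj h" "map_key h a = map_key h b" "keys a \<subseteq> range h" "keys b \<subseteq> range h"
  shows "a = b"
proof (rule poly_mapping_eqI)
  fix w
  show "lookup a w = lookup b w"
  proof (cases "w \<in> range h")
    case True
    then obtain v where "w = h v" by blast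
    moreover have "lookup (map_key h a) v = lookup (map_key h b) v" using assms(2) by simp
    ultimately show ?thesis using assms(1) by (simp add: map_key.rep_eq)
  next
    case False
    then have "w \<notin> keys a" "w \<notin> keys b" using assms by auto
    then show ?thesis by (simp add: in_keys_iff)
  qed
qed

lemma mcoeff_mrename:
  "mcoeff (mrename h f) m = (if keys m \<subseteq> range h then mcoeff f (map_key h m) else 0)"
  by (simp add: mrename_def)

lemma mrename_mult:
  fixes f g :: "('v, 'a::comm_ring_1) mps"
  assumes "inj h"
  shows "mrename h (f * g) = mrename h f * mrename h g"
proof (rule mps_eqI)
  fix m
  show "mcoeff (mrename h (f * g)) m = mcoeff (mrename h f * mrename h g) m"
  proof (cases "keys m \<subseteq> range h")
    case True
    let ?S = "{p. fst p + snd p = m}"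
    let ?h = "\<lambda>p. (map_key h (fst p), map_key h (snd p))"
    have keys: "keys (fst p) \<subseteq> range h" "keys (snd p) \<subseteq> range h" if "p \<in> ?S" for p
      using that True by (auto simp: keys_add_nat)
    have "inj_on ?h ?S"
    proof (rule inj_onI)
      fix p p' assume "p \<in> ?S" "p' \<in> ?S" "?h p = ?h p'"
      then show "p = p'"
        using map_key_eqD[OF assms, of "fst p" "fst p'"] map_key_eqD[OF assms, of "snd p" "snd p'"] keys
        by (intro prod_eqI) blast+
    qed
    moreover have "?h ` ?S = {p. fst p + snd p = map_key h m}"
    proof (intro set_eqI iffI)
      fix p assume "p \<in> ?h ` ?S"
      then show "p \<in> {p. fst p + snd p = map_key h m}"
        using assms by (auto simp: map_key_plus)
    next
      fix p assume p: "p \<in> {p. fst p + snd p = map_key h m}"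
      obtain a where a: "keys a \<subseteq> range h" "map_key h a = fst p" using map_key_extension[OF assms] .
      obtain b where b: "keys b \<subseteq> range h" "map_key h b = snd p" using map_key_extension[OF assms] .
      have "a + b = m"
        by (rule map_key_eqD[OF assms]) (use a b p True assms in \<open>auto simp: keys_add_nat map_key_plus\<close>)
      then show "p \<in> ?h ` ?S" using a b by (intro image_eqI[of _ _ "(a, b)"]) auto
    qed
    ultimately have "mcoeff (f * g) (map_key h m)
        = (\<Sum>p\<in>?S. mcoeff f (map_key h (fst p)) * mcoeff g (map_key h (snd p)))"
      unfolding mcoeff_times by (simp add: sum.reindex flip: \<open>?h ` ?S = _\<close>)
    also have "\<dots> = mcoeff (mrename h f * mrename h g) m"
      unfolding mcoeff_times by (rule sum.cong) (use keys in \<open>auto simp: mcoeff_mrename\<close>)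
    finally show ?thesis using True by (simp add: mcoeff_mrename)
  next
    case False
    then have "mcoeff (mrename h f * mrename h g) m = 0"
      unfolding mcoeff_times
      by (intro sum.neutral) (auto simp: mcoeff_mrename keys_add_nat)
    then show ?thesis using False by (simp add: mcoeff_mrename)
  qed
qed

abbreviation xpart :: "('v + 'w \<Rightarrow>\<^sub>0 nat) \<Rightarrow> ('v \<Rightarrow>\<^sub>0 nat)" where "xpart \<equiv> map_key Inl"
abbreviation ypart :: "('v + 'w \<Rightarrow>\<^sub>0 nat) \<Rightarrow> ('w \<Rightarrow>\<^sub>0 nat)" where "ypart \<equiv> map_key Inr"

lemma lookup_xpart [simp]: "lookup (xpart m) i = lookup m (Inl i)"
  and lookup_ypart [simp]: "lookup (ypart m) j = lookup m (Inr j)"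
  by (simp_all add: map_key.rep_eq)

lemma exponent_sum_eqI:
  fixes a b :: "'v + 'w \<Rightarrow>\<^sub>0 nat"
  assumes "xpart a = xpart b" "ypart a = ypart b"
  shows "a = b"
proof (rule poly_mapping_eqI)
  fix v
  have "lookup (xpart a) i = lookup (xpart b) i" "lookup (ypart a) j = lookup (ypart b) j" for i j
    using assms by simp_all
  then show "lookup a v = lookup b v" by (cases v) simp_all
qed

lemma total_degree_xpart_ypart:
  fixes m :: "'v + 'w \<Rightarrow>\<^sub>0 nat"
  shows "total_degree m = total_degree (xpart m) + total_degree (ypart m)"
proof -
  have "keys m = keys (xpart m) <+> keys (ypart m)"
  proof (rule set_eqI)
    fix v :: "'v + 'w"
    show "v \<in> keys m \<longleftrightarrow> v \<in> keys (xpart m) <+> keys (ypart m)"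
      by (cases v) (auto simp: in_keys_iff)
  qed
  then show ?thesis
    unfolding total_degree_def by (simp add: sum.Plus)
qed

text \<open>The alphabets are disjoint, so m splits in exactly one way into an x-monomial and a
  y-monomial, and the convolution has a single term.\<close>

lemma mcoeff_in_x_times_in_y:
  "mcoeff (in_x f * in_y g) m = mcoeff f (xpart m) * mcoeff g (ypart m)"
proof -
  obtain a :: "nat + nat \<Rightarrow>\<^sub>0 nat" where a: "keys a \<subseteq> range Inl" "xpart a = xpart m"
    using map_key_extension[OF inj_Inl] .
  obtain b :: "nat + nat \<Rightarrow>\<^sub>0 nat" where b: "keys b \<subseteq> range Inr" "ypart b = ypart m"
    using map_key_extension[OF inj_Inr] .
  have y0: "ypart a = 0" if "keys a \<subseteq> range Inl" for a :: "nat + nat \<Rightarrow>\<^sub>0 nat"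
    using that by (intro poly_mapping_eqI) (auto simp: in_keys_iff subset_iff image_iff)
  have x0: "xpart b = 0" if "keys b \<subseteq> range Inr" for b :: "nat + nat \<Rightarrow>\<^sub>0 nat"
    using that by (intro poly_mapping_eqI) (auto simp: in_keys_iff subset_iff image_iff)
  have m: "a + b = m"
    by (rule exponent_sum_eqI) (simp_all add: map_key_plus a b x0 y0)
  have "mcoeff (in_x f * in_y g) m = (\<Sum>p\<in>{(a, b)}. mcoeff (in_x f) (fst p) * mcoeff (in_y g) (snd p))"
    unfolding mcoeff_times
  proof (rule sum.mono_neutral_right)
    show "\<forall>p\<in>{p. fst p + snd p = m} - {(a, b)}. mcoeff (in_x f) (fst p) * mcoeff (in_y g) (snd p) = 0"
    proof (rule ballI, rule ccontr)
      fix p assume p: "p \<in> {p. fst p + snd p = m} - {(a, b)}"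
        and "mcoeff (in_x f) (fst p) * mcoeff (in_y g) (snd p) \<noteq> 0"
      then have keys: "keys (fst p) \<subseteq> range Inl" "keys (snd p) \<subseteq> range Inr"
        by (auto simp: in_x_def in_y_def mcoeff_mrename split: if_splits)
      then have "xpart (fst p) = xpart m" "ypart (snd p) = ypart m"
        using p x0 y0 map_key_plus[of Inl "fst p" "snd p"] map_key_plus[of Inr "fst p" "snd p"] by auto
      then have "fst p = a" "snd p = b"
        using a b keys map_key_eqD[of Inl "fst p" a] map_key_eqD[of Inr "snd p" b] by auto
      then show False using p by (auto simp: prod_eq_iff)
    qed
  qed (use m in auto)
  then show ?thesis using a b by (simp add: in_x_def in_y_def mcoeff_mrename)
qed

section \<open>The kernel\<close>

definition psum_xy :: "nat multiset \<Rightarrow> (nat + nat, qt) mps" where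
  "psum_xy M = in_x (psum_mset M) * in_y (psum_mset M)"

lemma mcoeff_psum_xy:
  "mcoeff (psum_xy M) m = mcoeff (psum_mset M) (xpart m) * mcoeff (psum_mset M) (ypart m)"
  by (simp add: psum_xy_def mcoeff_in_x_times_in_y)

lemma psum_xy_add_mset: "psum_xy (add_mset r M) = psum_xy {#r#} * psum_xy M"
  by (simp add: psum_xy_def in_x_def in_y_def mrename_mult mult_ac)

lemma mcoeff_psum_xy_nonzero:
  assumes "0 \<notin># M" "mcoeff (psum_xy M) m \<noteq> 0"
  shows "total_degree m = 2 * sum_mset M" "total_degree (xpart m) = sum_mset M"
    "total_degree (ypart m) = sum_mset M"
  using assms mcoeff_psum_mset_nonzero(1)[of M "xpart m"] mcoeff_psum_mset_nonzero(1)[of M "ypart m"]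
  by (simp_all add: mcoeff_psum_xy total_degree_xpart_ypart[of m])

definition kernel_part :: "nat \<Rightarrow> (nat + nat, qt) mps" where
  "kernel_part n = (\<Sum>M\<in>multisets_of_sum n. mconst (1 / psum_norm M) * psum_xy M)"

text \<open>Since \<open>kernel_part n\<close> is homogeneous of degree \<open>2 * n\<close>, these truncations lose nothing.\<close>

definition cauchy_kernel :: "(nat + nat, qt) mps" where
  "cauchy_kernel = Abs_mps (\<lambda>m. mcoeff (\<Sum>n\<le>total_degree m. kernel_part n) m)"

text \<open>For r \<ge> 1 this is r divided by \<open>psum_norm {#r#}\<close>. The kernel is the
  exponential of the sum of \<open>cauchy_coeff r\<close> / r times p_r(x) p_r(y).\<close>

definition cauchy_coeff :: "nat \<Rightarrow> qt" where
  "cauchy_coeff r = (1 - tv ^ r) / (1 - qv ^ r)"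

text \<open>The Euler derivative of the logarithm of the kernel: p_r(x) p_r(y) has total degree 2 *
  r in the two alphabets jointly, which cancels the 1/r and leaves the factor 2.\<close>

definition kernel_log :: "(nat + nat, qt) mps" where
  "kernel_log = Abs_mps (\<lambda>m. mcoeff (\<Sum>r\<in>{1..total_degree m}. mconst (2 * cauchy_coeff r) * psum_xy {#r#}) m)"

lemma mcoeff_kernel_part_nonzero:
  assumes "mcoeff (kernel_part n) m \<noteq> 0"
  shows "total_degree m = 2 * n"
proof -
  have "(\<Sum>M\<in>multisets_of_sum n. 1 / psum_norm M * mcoeff (psum_xy M) m) \<noteq> 0"
    using assms by (simp add: kernel_part_def)
  then obtain M where "M \<in> multisets_of_sum n" "1 / psum_norm M * mcoeff (psum_xy M) m \<noteq> 0"
    by (rule sum.not_neutral_contains_not_neutral)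
  then show ?thesis using mcoeff_psum_xy_nonzero(1)[of M m] by (simp add: multisets_of_sum_def)
qed

lemma mcoeff_kernel:
  assumes "total_degree m \<le> d"
  shows "mcoeff cauchy_kernel m = mcoeff (\<Sum>n\<le>d. kernel_part n) m"
proof -
  have "(\<Sum>n\<le>total_degree m. mcoeff (kernel_part n) m) = (\<Sum>n\<le>d. mcoeff (kernel_part n) m)"
    by (rule sum.mono_neutral_left) (use assms mcoeff_kernel_part_nonzero in force)+
  then show ?thesis by (simp add: cauchy_kernel_def)
qed

lemma mcoeff_kernel_log:
  assumes "total_degree m \<le> d"
  shows "mcoeff kernel_log m = mcoeff (\<Sum>r\<in>{1..d}. mconst (2 * cauchy_coeff r) * psum_xy {#r#}) m"
proof -
  have "mcoeff (psum_xy {#r#}) m = 0" if "total_degree m < r" for r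
    using mcoeff_psum_xy_nonzero(1)[of "{#r#}" m] that by force
  then have "(\<Sum>r\<in>{1..total_degree m}. 2 * cauchy_coeff r * mcoeff (psum_xy {#r#}) m)
      = (\<Sum>r\<in>{1..d}. 2 * cauchy_coeff r * mcoeff (psum_xy {#r#}) m)"
    by (intro sum.mono_neutral_left) (use assms in auto)
  then show ?thesis by (simp add: kernel_log_def)
qed

lemma psum_norm_add_mset:
  "psum_norm (add_mset r M) =
     of_nat (r * Suc (count M r)) * ((1 - qv ^ r) / (1 - tv ^ r)) * psum_norm M"
proof -
  define z where "z M s = s ^ count M s * fact (count M s)" for M and s :: nat
  let ?S = "insert r (set_mset M)"
  have "(\<Prod>s\<in>set_mset M. z M s) = (\<Prod>s\<in>?S. z M s)"
    by (rule prod.mono_neutral_left) (auto simp: z_def not_in_iff)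
  also have "\<dots> = z M r * (\<Prod>s\<in>?S - {r}. z M s)" by (rule prod.remove) auto
  finally have M: "(\<Prod>s\<in>set_mset M. z M s) = z M r * (\<Prod>s\<in>?S - {r}. z M s)" .
  have "(\<Prod>s\<in>?S. z (add_mset r M) s) = z (add_mset r M) r * (\<Prod>s\<in>?S - {r}. z (add_mset r M) s)"
    by (rule prod.remove) auto
  also have "z (add_mset r M) r = r * Suc (count M r) * z M r" by (simp add: z_def algebra_simps)
  also have "(\<Prod>s\<in>?S - {r}. z (add_mset r M) s) = (\<Prod>s\<in>?S - {r}. z M s)"
    by (rule prod.cong) (auto simp: z_def)
  finally have "(\<Prod>s\<in>set_mset (add_mset r M). z (add_mset r M) s)
      = r * Suc (count M r) * (\<Prod>s\<in>set_mset M. z M s)"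
    by (simp add: M)
  then show ?thesis
    unfolding psum_norm_def z_def[symmetric] by (simp only: of_nat_mult) simp
qed

text \<open>Deleting one part r removes the factor r * \<open>count M r\<close> * (1 - q^r) / (1 -
  t^r) from the norm; \<open>cauchy_coeff r\<close> absorbs the part with q and t, and an integer
  remains.\<close>

lemma cauchy_coeff_over_norm:
  assumes "0 \<notin># M" "r \<in># M"
  shows "cauchy_coeff r / psum_norm (M - {#r#}) = of_nat (r * count M r) / psum_norm M"
proof -
  define M' where "M' = M - {#r#}"
  have M: "M = add_mset r M'" using assms by (simp add: M'_def)
  have r: "r \<noteq> 0" and M': "0 \<notin># M'" using assms by (auto simp: M)
  have "psum_norm M' \<noteq> 0" using M' by (rule psum_norm_nonzero)
  moreover have "1 - qv ^ r \<noteq> 0" "1 - tv ^ r \<noteq> 0"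
    using qv_power_neq_1[OF r] tv_power_neq_1[OF r] by auto
  moreover have "(of_nat (r * Suc (count M' r)) :: qt) \<noteq> 0" using r by (simp only: of_nat_eq_0_iff) simp
  moreover have "count M r = Suc (count M' r)" by (simp add: M)
  moreover have "b / a / p = k / (k * (a / b) * p)" if "a \<noteq> 0" "b \<noteq> 0" "p \<noteq> 0" "k \<noteq> 0" for a b p k :: qt
    using that by (simp add: field_simps)
  ultimately show ?thesis
    unfolding M'_def[symmetric] cauchy_coeff_def by (simp only: M psum_norm_add_mset)
qed

lemma sum_mset_eq_sum_count: "sum_mset M = (\<Sum>r\<in>set_mset M. r * count M r)" for M :: "nat multiset"
proof (induction M)
  case (add r M)
  have "(\<Sum>s\<in>set_mset M. s * count M s) = (\<Sum>s\<in>insert r (set_mset M). s * count M s)"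
    by (rule sum.mono_neutral_left) (auto simp: not_in_iff)
  moreover have "(\<Sum>s\<in>insert r (set_mset M). s * count (add_mset r M) s)
      = (\<Sum>s\<in>insert r (set_mset M). s * count M s + (if s = r then r else 0))"
    by (rule sum.cong) auto
  ultimately show ?case using add by (simp add: sum.distrib)
qed (simp add: sum_mset.empty)

text \<open>The analogue of Newton's identities. The coefficient of \<open>psum_xy M\<close> on the
  right is the sum over distinct parts of r * \<open>count M r\<close>, divided by the norm, and
  that sum is n.\<close>

lemma kernel_part_recurrence:
  "mconst (of_nat n) * kernel_part n =
     (\<Sum>r\<in>{1..n}. mconst (cauchy_coeff r) * psum_xy {#r#} * kernel_part (n - r))"
proof -
  have "(\<Sum>r\<in>{1..n}. mconst (cauchy_coeff r) * psum_xy {#r#} * kernel_part (n - r))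
      = (\<Sum>r\<in>{1..n}. \<Sum>M\<in>multisets_of_sum (n - r).
           mconst (cauchy_coeff r / psum_norm M) * psum_xy (add_mset r M))"
    unfolding kernel_part_def sum_distrib_left
  proof (intro sum.cong refl)
    fix r M
    show "mconst (cauchy_coeff r) * psum_xy {#r#} * (mconst (1 / psum_norm M) * psum_xy M) =
        mconst (cauchy_coeff r / psum_norm M) * psum_xy (add_mset r M)"
      using mconst_mult[of "cauchy_coeff r" "1 / psum_norm M", where 'v = "nat + nat"]
      by (simp add: psum_xy_add_mset[of r M] mult_ac)
  qed
  also have "\<dots> = (\<Sum>(r, M)\<in>Sigma {1..n} (\<lambda>r. multisets_of_sum (n - r)).
      mconst (cauchy_coeff r / psum_norm M) * psum_xy (add_mset r M))"
    by (rule sum.Sigma) auto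
  \<comment> \<open>Inserting r turns the pairs into multisets of sum n with one marked part. Marks
    are values, not occurrences; the multiplicity enters later through the norm.\<close>
  also have "\<dots> = (\<Sum>(M, r)\<in>Sigma (multisets_of_sum n) set_mset.
      mconst (cauchy_coeff r / psum_norm (M - {#r#})) * psum_xy M)"
  proof (rule sum.reindex_bij_witness[of _ "\<lambda>(M, r). (r, M - {#r#})" "\<lambda>(r, M). (add_mset r M, r)"])
    fix p assume "p \<in> Sigma {1..n} (\<lambda>r. multisets_of_sum (n - r))"
    then show "(case p of (r, M) \<Rightarrow> (add_mset r M, r)) \<in> Sigma (multisets_of_sum n) set_mset"
      by (auto simp: multisets_of_sum_def)
  next
    fix p assume "p \<in> Sigma (multisets_of_sum n) set_mset"
    then obtain M r where p: "p = (M, r)" and M: "M \<in> multisets_of_sum n" and r: "r \<in># M" by auto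
    define M' where "M' = M - {#r#}"
    have "M = add_mset r M'" using r by (simp add: M'_def)
    then have "0 \<notin># M'" "r \<noteq> 0" "r + sum_mset M' = n" using M by (auto simp: multisets_of_sum_def)
    then have "(r, M') \<in> Sigma {1..n} (\<lambda>r. multisets_of_sum (n - r))" by (auto simp: multisets_of_sum_def)
    then show "(case p of (M, r) \<Rightarrow> (r, M - {#r#})) \<in> Sigma {1..n} (\<lambda>r. multisets_of_sum (n - r))"
      by (simp add: p M'_def)
  qed auto
  also have "\<dots> = (\<Sum>M\<in>multisets_of_sum n. \<Sum>r\<in>set_mset M.
      mconst (cauchy_coeff r / psum_norm (M - {#r#})) * psum_xy M)"
    by (rule sum.Sigma[symmetric]) auto
  also have "\<dots> = (\<Sum>M\<in>multisets_of_sum n. mconst (of_nat n) * (mconst (1 / psum_norm M) * psum_xy M))"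
  proof (rule sum.cong[OF refl])
    fix M assume M: "M \<in> multisets_of_sum n"
    have "(\<Sum>r\<in>set_mset M. mconst (cauchy_coeff r / psum_norm (M - {#r#})) * psum_xy M)
        = mconst (\<Sum>r\<in>set_mset M. cauchy_coeff r / psum_norm (M - {#r#})) * psum_xy M"
      by (simp add: mconst_sum sum_distrib_right)
    also have "(\<Sum>r\<in>set_mset M. cauchy_coeff r / psum_norm (M - {#r#}))
        = (\<Sum>r\<in>set_mset M. of_nat (r * count M r) / psum_norm M)"
      by (rule sum.cong) (use M in \<open>auto simp: cauchy_coeff_over_norm multisets_of_sumD simp del: of_nat_mult\<close>)
    also have "\<dots> = of_nat (\<Sum>r\<in>set_mset M. r * count M r) / psum_norm M"
      by (simp only: of_nat_sum sum_divide_distrib)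
    also have "\<dots> = of_nat n * (1 / psum_norm M)"
      using M by (simp add: multisets_of_sumD flip: sum_mset_eq_sum_count)
    finally show "(\<Sum>r\<in>set_mset M. mconst (cauchy_coeff r / psum_norm (M - {#r#})) * psum_xy M)
        = mconst (of_nat n) * (mconst (1 / psum_norm M) * psum_xy M)"
      by (simp only: mconst_mult mult.assoc)
  qed
  also have "\<dots> = mconst (of_nat n) * kernel_part n"
    by (simp add: kernel_part_def sum_distrib_left)
  finally show ?thesis ..
qed

lemma euler_kernel_part: "euler (kernel_part n) = mconst 2 * (mconst (of_nat n) * kernel_part n)"
proof (rule mps_eqI)
  fix m
  show "mcoeff (euler (kernel_part n)) m = mcoeff (mconst 2 * (mconst (of_nat n) * kernel_part n)) m"
    using mcoeff_kernel_part_nonzero[of n m] by (cases "mcoeff (kernel_part n) m = 0") auto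
qed

text \<open>At a fixed m both series may be cut off at the degree of m. Grouped by n = r + k, the
  product becomes the recurrence for \<open>kernel_part n\<close>, on which \<open>euler\<close>
  acts as 2 * n.\<close>

lemma euler_kernel: "euler cauchy_kernel = kernel_log * cauchy_kernel"
proof (rule mps_eqI)
  fix m :: "nat + nat \<Rightarrow>\<^sub>0 nat"
  define d where "d = total_degree m"
  let ?X = "\<lambda>r. mconst (2 * cauchy_coeff r) * psum_xy {#r#}"
  have "mcoeff (kernel_log * cauchy_kernel) m = mcoeff ((\<Sum>r\<in>{1..d}. ?X r) * (\<Sum>k\<le>d. kernel_part k)) m"
    unfolding mcoeff_times
  proof (rule sum.cong[OF refl])
    fix p assume "p \<in> {p. fst p + snd p = m}"
    then have "total_degree (fst p + snd p) = d" by (simp add: d_def)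
    then have "total_degree (fst p) \<le> d" "total_degree (snd p) \<le> d" by auto
    then show "mcoeff kernel_log (fst p) * mcoeff cauchy_kernel (snd p) =
        mcoeff (\<Sum>r\<in>{1..d}. ?X r) (fst p) * mcoeff (\<Sum>k\<le>d. kernel_part k) (snd p)"
      by (simp only: mcoeff_kernel_log mcoeff_kernel)
  qed
  also have "\<dots> = (\<Sum>(r, k)\<in>{1..d} \<times> {..d}. mcoeff (?X r * kernel_part k) m)"
    by (simp add: sum_product sum.cartesian_product split_def)
  \<comment> \<open>A nonzero term has degree d = 2 * (r + k), so the pairs with r + k > d
    contribute nothing.\<close>
  also have "\<dots> = (\<Sum>(r, k)\<in>{p \<in> {1..d} \<times> {..d}. fst p + snd p \<le> d}. mcoeff (?X r * kernel_part k) m)"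
  proof (rule sum.mono_neutral_right)
    have zero: "mcoeff (?X r * kernel_part k) m = 0" if "r \<noteq> 0" "d < r + k" for r k
    proof (rule ccontr)
      assume "mcoeff (?X r * kernel_part k) m \<noteq> 0"
      then obtain p where p: "fst p + snd p = m" "mcoeff (?X r) (fst p) * mcoeff (kernel_part k) (snd p) \<noteq> 0"
        unfolding mcoeff_times using sum.not_neutral_contains_not_neutral by blast
      then have "total_degree (fst p) = 2 * r" "total_degree (snd p) = 2 * k"
        using that mcoeff_psum_xy_nonzero(1)[of "{#r#}" "fst p"] mcoeff_kernel_part_nonzero[of k "snd p"]
        by auto
      then have "d = 2 * r + 2 * k" using p(1) total_degree_add[of "fst p" "snd p"] by (simp add: d_def)
      then show False using that by simp
    qed
    show "\<forall>p\<in>{1..d} \<times> {..d} - {p \<in> {1..d} \<times> {..d}. fst p + snd p \<le> d}.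
        (case p of (r, k) \<Rightarrow> mcoeff (?X r * kernel_part k) m) = 0"
    proof
      fix p assume "p \<in> {1..d} \<times> {..d} - {p \<in> {1..d} \<times> {..d}. fst p + snd p \<le> d}"
      then have "fst p \<noteq> 0" "d < fst p + snd p" by auto
      then show "(case p of (r, k) \<Rightarrow> mcoeff (?X r * kernel_part k) m) = 0"
        unfolding split_def by (rule zero)
    qed
  qed auto
  also have "\<dots> = (\<Sum>(n, r)\<in>Sigma {..d} (\<lambda>n. {1..n}). mcoeff (?X r * kernel_part (n - r)) m)"
    by (rule sum.reindex_bij_witness[of _ "\<lambda>(n, r). (r, n - r)" "\<lambda>(r, k). (r + k, r)"]) auto
  also have "\<dots> = (\<Sum>n\<le>d. mcoeff (\<Sum>r\<in>{1..n}. ?X r * kernel_part (n - r)) m)"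
    unfolding mcoeff_sum by (rule sum.Sigma[symmetric]) auto
  also have "\<dots> = (\<Sum>n\<le>d. mcoeff (euler (kernel_part n)) m)"
  proof (rule sum.cong[OF refl])
    fix n
    have "(\<Sum>r\<in>{1..n}. ?X r * kernel_part (n - r)) =
        mconst 2 * (\<Sum>r\<in>{1..n}. mconst (cauchy_coeff r) * psum_xy {#r#} * kernel_part (n - r))"
      by (simp add: sum_distrib_left mconst_mult mult.assoc)
    then show "mcoeff (\<Sum>r\<in>{1..n}. ?X r * kernel_part (n - r)) m = mcoeff (euler (kernel_part n)) m"
      by (simp only: euler_kernel_part kernel_part_recurrence)
  qed
  also have "\<dots> = mcoeff (euler cauchy_kernel) m"
    using mcoeff_kernel[of m d] by (simp add: d_def sum_distrib_left)
  finally show "mcoeff (euler cauchy_kernel) m = mcoeff (kernel_log * cauchy_kernel) m" ..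
qed

lemma mcoeff_kernel_0: "mcoeff cauchy_kernel 0 = 1"
proof -
  have "multisets_of_sum 0 = {{#}}"
  proof -
    have "M = {#}" if "0 \<notin># M" "sum_mset M = 0" for M :: "nat multiset"
      using that by (cases M) auto
    then show ?thesis by (auto simp: multisets_of_sum_def)
  qed
  then show ?thesis
    by (simp add: cauchy_kernel_def kernel_part_def mcoeff_psum_xy mcoeff_one psum_norm_def)
qed

section \<open>The Cauchy product\<close>

definition diag_exponent :: "nat \<Rightarrow> nat \<Rightarrow> nat \<Rightarrow> (nat + nat \<Rightarrow>\<^sub>0 nat)" where
  "diag_exponent i j k = single (Inl i) k + single (Inr j) k"

lemma diag_exponent_0 [simp]: "diag_exponent i j 0 = 0"
  by (simp add: diag_exponent_def)

lemma diag_exponent_add: "diag_exponent i j k + diag_exponent i j l = diag_exponent i j (k + l)"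
  by (simp add: diag_exponent_def single_add ac_simps)

lemma total_degree_diag_exponent [simp]: "total_degree (diag_exponent i j k) = 2 * k"
  by (simp add: diag_exponent_def)

lemma lookup_diag_exponent:
  "lookup (diag_exponent i j k) (Inl i') = (if i' = i then k else 0)"
  "lookup (diag_exponent i j k) (Inr j') = (if j' = j then k else 0)"
  by (simp_all add: diag_exponent_def lookup_add lookup_single when_def)

lemma diag_exponent_eqD:
  assumes "diag_exponent i j k = diag_exponent i' j' k'"
  shows "k = k'" "k \<noteq> 0 \<Longrightarrow> i = i'" "k \<noteq> 0 \<Longrightarrow> j = j'"
proof -
  show "k = k'" using arg_cong[OF assms, of total_degree] by simp
  show "k \<noteq> 0 \<Longrightarrow> i = i'" using arg_cong[OF assms, of "\<lambda>m. lookup m (Inl i)"]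
    by (simp add: lookup_diag_exponent split: if_splits)
  show "k \<noteq> 0 \<Longrightarrow> j = j'" using arg_cong[OF assms, of "\<lambda>m. lookup m (Inr j)"]
    by (simp add: lookup_diag_exponent split: if_splits)
qed

text \<open>The series F(x_i y_j). The exponent of (x_i y_j)^k has total degree 2 * k, so halving
  the degree recovers k.\<close>

definition diag_series :: "nat \<Rightarrow> nat \<Rightarrow> qt fps \<Rightarrow> (nat + nat, qt) mps" where
  "diag_series i j F = Abs_mps (\<lambda>m. if \<exists>k. m = diag_exponent i j k
     then fps_nth F (total_degree m div 2) else 0)"

lemma mcoeff_diag_series [simp]: "mcoeff (diag_series i j F) (diag_exponent i j k) = fps_nth F k"
  by (auto simp: diag_series_def)

lemma mcoeff_diag_series_other:
  "(\<And>k. m \<noteq> diag_exponent i j k) \<Longrightarrow> mcoeff (diag_series i j F) m = 0"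
  by (simp add: diag_series_def)

lemma diag_series_mult: "diag_series i j (F * G) = diag_series i j F * diag_series i j G"
proof (rule mps_eqI)
  fix m
  let ?e = "diag_exponent i j"
  let ?t = "\<lambda>p. mcoeff (diag_series i j F) (fst p) * mcoeff (diag_series i j G) (snd p)"
  have nz: "\<exists>k l. p = (?e k, ?e l)" if "?t p \<noteq> 0" for p
    using that mcoeff_diag_series_other[of "fst p"] mcoeff_diag_series_other[of "snd p"]
    by (metis mult_eq_0_iff prod.collapse)
  show "mcoeff (diag_series i j (F * G)) m = mcoeff (diag_series i j F * diag_series i j G) m"
  proof (cases "\<exists>n. m = ?e n")
    case True
    then obtain n where m: "m = ?e n" ..
    let ?h = "\<lambda>k. (?e k, ?e (n - k))"
    have "inj_on ?h {0..n}" by (auto simp: inj_on_def dest: diag_exponent_eqD)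
    then have "(\<Sum>p\<in>?h ` {0..n}. ?t p) = (\<Sum>k=0..n. fps_nth F k * fps_nth G (n - k))"
      by (simp add: sum.reindex)
    moreover have "mcoeff (diag_series i j F * diag_series i j G) m = (\<Sum>p\<in>?h ` {0..n}. ?t p)"
      unfolding mcoeff_times
    proof (rule sum.mono_neutral_right)
      show "\<forall>p\<in>{p. fst p + snd p = m} - ?h ` {0..n}. ?t p = 0"
      proof (rule ballI, rule ccontr)
        fix p assume p: "p \<in> {p. fst p + snd p = m} - ?h ` {0..n}" and "?t p \<noteq> 0"
        then obtain k l where kl: "p = (?e k, ?e l)" using nz by blast
        then have "?e (k + l) = ?e n" using p by (simp add: m diag_exponent_add)
        then have "k + l = n" by (rule diag_exponent_eqD)
        then have "p = ?h k" "k \<in> {0..n}" using kl by auto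
        then show False using p by blast
      qed
    qed (auto simp: m diag_exponent_add)
    ultimately show ?thesis by (simp add: m fps_mult_nth)
  next
    case False
    have "?t p = 0" if p: "fst p + snd p = m" for p
    proof (rule ccontr)
      assume "?t p \<noteq> 0"
      then obtain k l where "p = (?e k, ?e l)" using nz by blast
      then have "m = ?e (k + l)" using p by (simp add: diag_exponent_add)
      then show False using False by blast
    qed
    then have "mcoeff (diag_series i j F * diag_series i j G) m = 0"
      unfolding mcoeff_times by (intro sum.neutral) auto
    then show ?thesis using False by (simp add: mcoeff_diag_series_other)
  qed
qed

text \<open>On functions of z = x_i y_j the Euler operator is 2 z d/dz, since z has degree
  2.\<close>

lemma euler_diag_series: "euler (diag_series i j F) = diag_series i j (fps_const 2 * (fps_X * fps_deriv F))"
proof (rule mps_eqI)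
  fix m
  have "fps_nth (fps_const 2 * (fps_X * fps_deriv F)) k = of_nat (2 * k) * fps_nth F k" for k
    unfolding fps_mult_fps_X_deriv_shift by simp
  then show "mcoeff (euler (diag_series i j F)) m = mcoeff (diag_series i j (fps_const 2 * (fps_X * fps_deriv F))) m"
    by (cases "\<exists>k. m = diag_exponent i j k") (auto simp: mcoeff_diag_series_other simp del: of_nat_mult)
qed

lemma cauchy_factor_eq: "cauchy_factor i j = diag_series i j qpoch_ratio"
proof -
  have power: "(mvar (Inl i) * mvar (Inr j)) ^ k =
      (Abs_mps (\<lambda>m. if m = diag_exponent i j k then 1 else 0) :: (nat + nat, qt) mps)" for k
    unfolding power_mult_distrib mvar_power monomial_mult_monomial diag_exponent_def
    by (simp cong: if_cong)
  let ?f = "\<lambda>k. mconst (fps_nth qpoch_ratio k) * (mvar (Inl i) * mvar (Inr j)) ^ k :: (nat + nat, qt) mps"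
  have coeff: "mcoeff (?f k) m = (if m = diag_exponent i j k then fps_nth qpoch_ratio k else 0)" for k m
    by (simp add: power)
  have sub: "{k. mcoeff (?f k) m \<noteq> 0} \<subseteq> {total_degree m div 2}" for m
    unfolding coeff by (auto split: if_splits)
  have "?f sums diag_series i j qpoch_ratio"
  proof (rule sums_mps)
    fix m
    show "finite {k. mcoeff (?f k) m \<noteq> 0}" using sub finite_subset by blast
    have "(\<Sum>k | mcoeff (?f k) m \<noteq> 0. mcoeff (?f k) m) = (\<Sum>k\<in>{total_degree m div 2}. mcoeff (?f k) m)"
      by (rule sum.mono_neutral_left) (use sub in auto)
    also have "\<dots> = mcoeff (diag_series i j qpoch_ratio) m"
      unfolding coeff by (cases "\<exists>k. m = diag_exponent i j k") (auto simp: mcoeff_diag_series_other)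
    finally show "mcoeff (diag_series i j qpoch_ratio) m =
        (\<Sum>k | mcoeff (?f k) m \<noteq> 0. mcoeff (?f k) m)" ..
  qed
  then show ?thesis
    unfolding cauchy_factor_def fps_subst_def by (rule sums_unique[symmetric])
qed

definition cauchy_log :: "qt fps" where
  "cauchy_log = Abs_fps (\<lambda>r. if r = 0 then 0 else cauchy_coeff r)"

text \<open>With E = exp(- L), the logarithm of the ratio is L(z) - L(tz), whose coefficient at z^r
  is (1 - t^r) / (r (1 - q^r)); z d/dz removes the 1/r.\<close>

lemma qpoch_ratio_log_derivative:
  "fps_X * fps_deriv qpoch_ratio = cauchy_log * qpoch_ratio" "fps_nth qpoch_ratio 0 = 1"
proof -
  define L :: "qt fps" where "L = Abs_fps (\<lambda>m. if m = 0 then 0 else 1 / of_nat m * (1 / (1 - qv ^ m)))"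
  define T where "T = fps_const tv * fps_X"
  define E where "E = qpoch_inf"
  define E' where "E' = fps_compose E T"
  have E: "E = fps_compose (fps_exp 1) (- L)" by (simp add: E_def qpoch_inf_def L_def)
  have L0: "fps_nth (- L) 0 = 0" by (simp add: L_def)
  have T0: "fps_nth T 0 = 0" by (simp add: T_def)
  have dE: "fps_deriv E = - (fps_deriv L * E)"
    unfolding E fps_compose_deriv[OF L0] by (simp add: mult.commute)
  have dE': "fps_deriv E' = - (fps_compose (fps_deriv L) T * fps_const tv * E')"
    unfolding E'_def fps_compose_deriv[OF T0] dE fps_compose_uminus fps_compose_mult_distrib[OF T0]
    by (simp add: T_def mult_ac)
  have E0: "fps_nth E 0 = 1" by (simp add: E)
  then have E0': "fps_nth E' 0 = 1" by (simp add: E'_def)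
  have ratio: "qpoch_ratio = E' * inverse E"
    unfolding qpoch_ratio_def E'_def E_def T_def using E0 by (simp add: fps_divide_unit E_def)
  show "fps_nth qpoch_ratio 0 = 1" by (simp add: ratio E0 E0')
  have mult: "qpoch_ratio * E = E'"
    using E0 by (simp add: ratio mult.assoc inverse_mult_eq_1)
  have "fps_deriv qpoch_ratio * E + qpoch_ratio * fps_deriv E = fps_deriv E'"
    using arg_cong[OF mult, of fps_deriv] by (simp add: add.commute)
  then have "fps_deriv qpoch_ratio * E + qpoch_ratio * - (fps_deriv L * E)
      = - (fps_compose (fps_deriv L) T * fps_const tv * (qpoch_ratio * E))"
    by (simp only: dE dE' mult)
  then have "fps_deriv qpoch_ratio * E = - (fps_compose (fps_deriv L) T * fps_const tv * (qpoch_ratio * E))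
      - qpoch_ratio * - (fps_deriv L * E)"
    by (simp only: eq_diff_eq)
  then have "fps_deriv qpoch_ratio * E =
      (fps_deriv L - fps_compose (fps_deriv L) T * fps_const tv) * qpoch_ratio * E"
    by (simp add: algebra_simps)
  \<comment> \<open>E has constant term 1, hence is nonzero and can be cancelled.\<close>
  then have deriv: "fps_deriv qpoch_ratio = (fps_deriv L - fps_compose (fps_deriv L) T * fps_const tv) * qpoch_ratio"
    using E0 by (metis mult_right_cancel fps_zero_nth zero_neq_one)
  have "fps_X * (fps_deriv L - fps_compose (fps_deriv L) T * fps_const tv) = cauchy_log"
  proof (rule fps_ext)
    fix n
    show "fps_nth (fps_X * (fps_deriv L - fps_compose (fps_deriv L) T * fps_const tv)) n = fps_nth cauchy_log n"
    proof (cases n)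
      case 0
      then show ?thesis by (simp add: cauchy_log_def)
    next
      case (Suc k)
      have "(of_nat (Suc k) :: qt) \<noteq> 0" by (simp del: of_nat_Suc)
      then have dL: "fps_nth (fps_deriv L) k = 1 / (1 - qv ^ Suc k)"
        by (simp add: L_def del: of_nat_Suc)
      have "fps_nth (fps_compose (fps_deriv L) T) k = tv ^ k * (1 / (1 - qv ^ Suc k))"
        unfolding T_def fps_compose_linear fps_nth_Abs_fps dL ..
      then show ?thesis
        by (simp add: Suc dL cauchy_log_def cauchy_coeff_def diff_divide_distrib
            mult.commute del: fps_deriv_nth)
    qed
  qed
  then show "fps_X * fps_deriv qpoch_ratio = cauchy_log * qpoch_ratio"
    unfolding deriv by (simp flip: mult.assoc)
qed

lemma euler_cauchy_factor:
  "euler (cauchy_factor i j) = diag_series i j (fps_const 2 * cauchy_log) * cauchy_factor i j"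
  by (simp add: cauchy_factor_eq euler_diag_series qpoch_ratio_log_derivative(1) mult.assoc
      flip: diag_series_mult)

text \<open>The condition k \<noteq> 0 matters: the exponent 0 is diagonal for every pair i, j,
  whereas a nonzero diagonal exponent determines both indices.\<close>

lemma mcoeff_cauchy_log_diag:
  "mcoeff (diag_series i j (fps_const 2 * cauchy_log)) m =
     (if \<exists>k. k \<noteq> 0 \<and> m = diag_exponent i j k then 2 * cauchy_coeff (total_degree m div 2) else 0)"
proof -
  have two: "fps_nth (fps_const 2 * cauchy_log) k = (if k = 0 then 0 else 2 * cauchy_coeff k)" for k
    by (simp add: cauchy_log_def)
  show ?thesis
  proof (cases "\<exists>k. m = diag_exponent i j k")
    case True
    then obtain k where m: "m = diag_exponent i j k" ..
    have "k' = k" if "m = diag_exponent i j k'" for k'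
      using diag_exponent_eqD(1)[of i j k' i j k] that m by simp
    then have "(\<exists>k'. k' \<noteq> 0 \<and> m = diag_exponent i j k') \<longleftrightarrow> k \<noteq> 0"
      using m by blast
    then show ?thesis
      using mcoeff_diag_series[of i j "fps_const 2 * cauchy_log" k] two[of k] by (simp add: m)
  next
    case False
    then have "mcoeff (diag_series i j (fps_const 2 * cauchy_log)) m = 0"
      by (intro mcoeff_diag_series_other) blast
    then show ?thesis using False by auto
  qed
qed

text \<open>\<open>has_prod_log_derivative\<close> is applied to the product over j, giving S i, and
  then to the product over i, giving R. A monomial (x_i y_j)^k with k \<noteq> 0 determines i and j,
  so each coefficient receives at most one contribution at either stage.\<close>

lemma cauchy_product_eq_kernel:
  fixes K
  defines "K \<equiv> prodinf (\<lambda>i. prodinf (\<lambda>j. cauchy_factor i j))"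
  shows "K = cauchy_kernel"
proof -
  define A where "A i j = diag_series i j (fps_const 2 * cauchy_log)" for i j
  define S where "S i = Abs_mps (\<lambda>m. if \<exists>j k. k \<noteq> 0 \<and> m = diag_exponent i j k
      then 2 * cauchy_coeff (total_degree m div 2) else 0)" for i
  define R where "R = Abs_mps (\<lambda>m. if \<exists>i j k. k \<noteq> 0 \<and> m = diag_exponent i j k
      then 2 * cauchy_coeff (total_degree m div 2) else 0)"
  have coeff_nz: "2 * cauchy_coeff k \<noteq> 0" if "k \<noteq> 0" for k
    using qv_power_neq_1[OF that] tv_power_neq_1[OF that] by (auto simp: cauchy_coeff_def)
  have nz: "\<And>i j m. mcoeff (A i j) m \<noteq> 0 \<longleftrightarrow> (\<exists>k. k \<noteq> 0 \<and> m = diag_exponent i j k)"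
    "\<And>i m. mcoeff (S i) m \<noteq> 0 \<longleftrightarrow> (\<exists>j k. k \<noteq> 0 \<and> m = diag_exponent i j k)"
    using coeff_nz by (auto simp: A_def S_def mcoeff_cauchy_log_diag)
  have row: "euler (prodinf (\<lambda>j. cauchy_factor i j)) = S i * prodinf (\<lambda>j. cauchy_factor i j) \<and>
      mcoeff (prodinf (\<lambda>j. cauchy_factor i j)) 0 = 1" for i
  proof (rule has_prod_log_derivative[where A = "A i"])
    show "euler (cauchy_factor i j) = A i j * cauchy_factor i j" for j
      by (simp add: A_def euler_cauchy_factor)
    show "mcoeff (cauchy_factor i j) 0 = 1" for j
      using mcoeff_diag_series[of i j qpoch_ratio 0] qpoch_ratio_log_derivative(2)
      by (simp add: cauchy_factor_eq)
    show "mcoeff (A i j) 0 = 0" for j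
      using mcoeff_diag_series[of i j "fps_const 2 * cauchy_log" 0] by (simp add: A_def cauchy_log_def)
    fix m
    have cases: "{j. mcoeff (A i j) m \<noteq> 0} = {} \<or> (\<exists>j. {j. mcoeff (A i j) m \<noteq> 0} = {j})"
    proof -
      have "j = j'" if jj': "mcoeff (A i j) m \<noteq> 0" "mcoeff (A i j') m \<noteq> 0" for j j'
      proof -
        obtain k where k: "k \<noteq> 0" "m = diag_exponent i j k"
          using iffD1[OF nz(1) jj'(1)] by (elim exE conjE)
        obtain k' where "m = diag_exponent i j' k'"
          using iffD1[OF nz(1) jj'(2)] by (elim exE conjE)
        with k(2) have "diag_exponent i j k = diag_exponent i j' k'" by simp
        then show ?thesis using k(1) by (rule diag_exponent_eqD(3))
      qed
      then show ?thesis by blast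
    qed
    then show "finite {j. mcoeff (A i j) m \<noteq> 0}" by auto
    show "mcoeff (S i) m = (\<Sum>j | mcoeff (A i j) m \<noteq> 0. mcoeff (A i j) m)"
      using cases
    proof
      assume "\<exists>j. {j. mcoeff (A i j) m \<noteq> 0} = {j}"
      then obtain j where j: "{j. mcoeff (A i j) m \<noteq> 0} = {j}" ..
      then have k: "\<exists>k. k \<noteq> 0 \<and> m = diag_exponent i j k" using nz(1) by blast
      then have jk: "\<exists>j k. k \<noteq> 0 \<and> m = diag_exponent i j k" by blast
      have "mcoeff (S i) m = mcoeff (A i j) m"
        unfolding A_def S_def mcoeff_cauchy_log_diag mcoeff_Abs_mps if_P[OF k] if_P[OF jk] ..
      then show ?thesis by (simp add: j)
    next
      assume e: "{j. mcoeff (A i j) m \<noteq> 0} = {}"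
      then have "\<not> (\<exists>j k. k \<noteq> 0 \<and> m = diag_exponent i j k)" using nz(1) by blast
      then have "mcoeff (S i) m = 0" using nz(2) by blast
      then show ?thesis by (simp add: e)
    qed
  qed
  have "euler K = R * K \<and> mcoeff K 0 = 1"
    unfolding K_def
  proof (rule has_prod_log_derivative[where A = S])
    show "mcoeff (S i) 0 = 0" for i
    proof (rule ccontr)
      assume "mcoeff (S i) 0 \<noteq> 0"
      then obtain j k where "k \<noteq> 0" "0 = diag_exponent i j k" using nz(2) by blast
      then show False using total_degree_diag_exponent[of i j k] by simp
    qed
    fix m
    have cases: "{i. mcoeff (S i) m \<noteq> 0} = {} \<or> (\<exists>i. {i. mcoeff (S i) m \<noteq> 0} = {i})"
    proof -
      have "i = i'" if ii': "mcoeff (S i) m \<noteq> 0" "mcoeff (S i') m \<noteq> 0" for i i'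
      proof -
        obtain j k where k: "k \<noteq> 0" "m = diag_exponent i j k"
          using iffD1[OF nz(2) ii'(1)] by (elim exE conjE)
        obtain j' k' where "m = diag_exponent i' j' k'"
          using iffD1[OF nz(2) ii'(2)] by (elim exE conjE)
        with k(2) have "diag_exponent i j k = diag_exponent i' j' k'" by simp
        then show ?thesis using k(1) by (rule diag_exponent_eqD(2))
      qed
      then show ?thesis by blast
    qed
    then show "finite {i. mcoeff (S i) m \<noteq> 0}" by auto
    show "mcoeff R m = (\<Sum>i | mcoeff (S i) m \<noteq> 0. mcoeff (S i) m)"
      using cases
    proof
      assume "\<exists>i. {i. mcoeff (S i) m \<noteq> 0} = {i}"
      then obtain i where i: "{i. mcoeff (S i) m \<noteq> 0} = {i}" ..
      then have jk: "\<exists>j k. k \<noteq> 0 \<and> m = diag_exponent i j k" using nz(2) by blast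
      then have ijk: "\<exists>i j k. k \<noteq> 0 \<and> m = diag_exponent i j k" by blast
      have "mcoeff R m = mcoeff (S i) m"
        unfolding S_def R_def mcoeff_Abs_mps if_P[OF jk] if_P[OF ijk] ..
      then show ?thesis by (simp add: i)
    next
      assume e: "{i. mcoeff (S i) m \<noteq> 0} = {}"
      then have "\<not> (\<exists>i j k. k \<noteq> 0 \<and> m = diag_exponent i j k)" using nz(2) by blast
      then have "mcoeff R m = 0" unfolding R_def mcoeff_Abs_mps by (rule if_not_P)
      then show ?thesis by (simp add: e)
    qed
  qed (use row in auto)
  \<comment> \<open>Summing x_i^r y_j^r over all pairs gives p_r(x) p_r(y); here the product over
    pairs turns into power sums.\<close>
  moreover have "R = kernel_log"
  proof (rule mps_eqI)
    fix m :: "nat + nat \<Rightarrow>\<^sub>0 nat"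
    have pp: "mcoeff (psum_xy {#r#}) m = (if \<exists>i j. m = diag_exponent i j r then 1 else 0)" if "r \<noteq> 0" for r
    proof -
      have "(\<exists>i. xpart m = single i r) \<and> (\<exists>j. ypart m = single j r) \<longleftrightarrow> (\<exists>i j. m = diag_exponent i j r)"
      proof -
        have "xpart (diag_exponent i j r) = single i r" "ypart (diag_exponent i j r) = single j r" for i j
          by (auto intro!: poly_mapping_eqI simp: lookup_diag_exponent lookup_single when_def)
        then show ?thesis using exponent_sum_eqI by metis
      qed
      moreover have "mcoeff (psum_xy {#r#}) m =
          (if (\<exists>i. xpart m = single i r) \<and> (\<exists>j. ypart m = single j r) then 1 else 0)"
        using that by (simp add: mcoeff_psum_xy mcoeff_psum)
      ultimately show ?thesis by (simp only:)
    qed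
    show "mcoeff R m = mcoeff kernel_log m"
    proof (cases "\<exists>i j k. k \<noteq> 0 \<and> m = diag_exponent i j k")
      case True
      then obtain i j k where k: "k \<noteq> 0" "m = diag_exponent i j k" by blast
      have "mcoeff kernel_log m = (\<Sum>r\<in>{1..total_degree m}. 2 * cauchy_coeff r * mcoeff (psum_xy {#r#}) m)"
        by (simp add: kernel_log_def)
      also have "\<dots> = (\<Sum>r\<in>{k}. 2 * cauchy_coeff r * mcoeff (psum_xy {#r#}) m)"
      proof (rule sum.mono_neutral_right)
        show "\<forall>r\<in>{1..total_degree m} - {k}. 2 * cauchy_coeff r * mcoeff (psum_xy {#r#}) m = 0"
        proof
          fix r assume r: "r \<in> {1..total_degree m} - {k}"
          have "r = k" if "m = diag_exponent i' j' r" for i' j'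
            by (rule diag_exponent_eqD(1)[of i' j' r i j k]) (use that k(2) in simp)
          then have "\<not> (\<exists>i j. m = diag_exponent i j r)" using r by blast
          then show "2 * cauchy_coeff r * mcoeff (psum_xy {#r#}) m = 0" using r by (simp add: pp)
        qed
      qed (use k in auto)
      also have "\<dots> = 2 * cauchy_coeff k"
      proof -
        have "\<exists>i j. m = diag_exponent i j k" using k(2) by blast
        then show ?thesis by (simp add: pp[OF k(1)])
      qed
      also have "\<dots> = mcoeff R m"
        unfolding R_def mcoeff_Abs_mps if_P[OF True] by (simp add: k(2))
      finally show ?thesis ..
    next
      case False
      have "mcoeff (psum_xy {#r#}) m = 0" if "r \<noteq> 0" for r
        unfolding pp[OF that] by (rule if_not_P) (use False that in blast)
      then have "mcoeff kernel_log m = 0" by (simp add: kernel_log_def)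
      then show ?thesis unfolding R_def mcoeff_Abs_mps if_not_P[OF False] by simp
    qed
  qed
  ultimately have K: "euler K = kernel_log * K" "mcoeff K 0 = mcoeff cauchy_kernel 0"
    by (simp_all add: mcoeff_kernel_0)
  have log0: "mcoeff kernel_log 0 = 0" by (simp add: kernel_log_def)
  show ?thesis
    by (rule mps_eqI, rule log_derivative_local[OF K(1) euler_kernel K(2) log0]) simp
qed

text \<open>\<open>kernel_part n\<close> is homogeneous of degree n in the y-variables alone, so the
  y-degree of m selects one n.\<close>

lemma mcoeff_kernel_expand:
  "mcoeff cauchy_kernel m = (\<Sum>M\<in>multisets_of_sum (total_degree (ypart m)).
     mcoeff (psum_mset M) (xpart m) * mcoeff (psum_mset M) (ypart m) / psum_norm M)"
proof -
  let ?d = "total_degree (ypart m)"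
  have "mcoeff (kernel_part n) m = 0" if "n \<noteq> ?d" for n
    unfolding kernel_part_def mcoeff_sum
  proof (rule sum.neutral, rule ballI)
    fix M assume "M \<in> multisets_of_sum n"
    then have "mcoeff (psum_xy M) m = 0"
      using mcoeff_psum_xy_nonzero(3)[of M m] that by (auto simp: multisets_of_sum_def)
    then show "mcoeff (mconst (1 / psum_norm M) * psum_xy M) m = 0" by simp
  qed
  moreover have "?d \<le> total_degree m" by (simp add: total_degree_xpart_ypart[of m])
  ultimately have "(\<Sum>n\<le>total_degree m. mcoeff (kernel_part n) m) = (\<Sum>n\<in>{?d}. mcoeff (kernel_part n) m)"
    by (intro sum.mono_neutral_right) auto
  then show ?thesis
    by (simp add: cauchy_kernel_def kernel_part_def mcoeff_psum_xy)
qed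

theorem proposition3p2:
  fixes P I H :: "npart \<Rightarrow> series" and IN :: "nat \<Rightarrow> npart \<Rightarrow> series"
  assumes "macdonald_functions P"
    and "\<And>N \<mu>. \<mu> \<in> partitions_upto N \<Longrightarrow> is_interpolation_polynomial P N \<mu> (IN N \<mu>)"
    and "interpolation_functions IN I"
    and "dual_functions I H"
  shows "((\<lambda>\<mu>. in_x (I \<mu>) * in_y (H \<mu>)) has_sum
           prodinf (\<lambda>i. prodinf (\<lambda>j. cauchy_factor i j))) partitions"
proof -
  have Sym: "I \<mu> \<in> Sym" if "\<mu> \<in> partitions" for \<mu>
    using assms(3) that by (simp add: interpolation_functions_def)
  have interp: "is_interpolation_polynomial P N \<mu> (phi N (I \<mu>))"
    if "\<mu> \<in> partitions" "N \<ge> plength \<mu>" for N \<mu>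
    using assms(2)[of \<mu> N] assms(3) that by (simp add: interpolation_functions_def partitions_upto_def)
  have degree: "degree_le (total_degree \<mu>) (I \<mu>)" if "\<mu> \<in> partitions" for \<mu>
    using interpolation_function_degree[OF Sym interp] that by blast
  have top: "mcoeff (I \<mu>) m = mcoeff (P \<mu>) m"
    if "\<mu> \<in> partitions" "total_degree m = total_degree \<mu>" for \<mu> m
    by (rule interpolation_function_top[where P = P, OF Sym _ interp])
      (use that macdonald_functions_triangular(1)[OF assms(1)] in simp_all)
  have span: "\<exists>a. f = (\<Sum>\<mu> | \<mu> \<in> partitions \<and> total_degree \<mu> \<le> d. mconst (a \<mu>) * I \<mu>)"
    if f: "f \<in> Sym" "degree_le d f" for f d
  proof -
    have "\<exists>a. f = (\<Sum>\<mu> | \<mu> \<in> partitions \<and> total_degree \<mu> < Suc d. mconst (a \<mu>) * I \<mu>)"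
      by (rule interpolation_functions_span[OF assms(1) Sym degree top f(1)])
        (use f(2) in \<open>simp_all add: degree_le_def\<close>)
    then show ?thesis by (simp only: less_Suc_eq_le)
  qed
  have expand: "psum_mset M = (\<Sum>\<mu> | \<mu> \<in> partitions \<and> total_degree \<mu> \<le> sum_mset M.
      mconst (psum_coeff (H \<mu>) M * psum_norm M) * I \<mu>)" if "0 \<notin># M" for M
    by (rule psum_mset_dual_expansion(1)) (fact span, fact Sym, fact assms(4), fact that)
  have vanish: "psum_coeff (H \<nu>) M = 0"
    if "0 \<notin># M" "\<nu> \<in> partitions" "sum_mset M < total_degree \<nu>" for M \<nu>
    by (rule psum_mset_dual_expansion(2)[where I = I])
      (fact span, fact Sym, fact assms(4), fact that(1), fact that(2), fact that(3))
  have H: "H \<mu> \<in> Sym_hat" if "\<mu> \<in> partitions" for \<mu>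
    using assms(4) that by (simp add: dual_functions_def)
  \<comment> \<open>\<open>I \<mu>\<close> is inhomogeneous, so the x-degree of m does not bound
    \<mu>. The y-degree does, because \<open>H \<mu>\<close> starts in degree equal to the size of
    \<mu>.\<close>
  let ?T = "\<lambda>m. {\<mu>. \<mu> \<in> partitions \<and> total_degree \<mu> \<le> total_degree (ypart m)}"
  have H_coeff: "mcoeff (H \<mu>) (ypart m) = (\<Sum>M\<in>multisets_of_sum (total_degree (ypart m)).
      psum_coeff (H \<mu>) M * mcoeff (psum_mset M) (ypart m))" if "\<mu> \<in> partitions" for \<mu> m
    using psum_coeff_expand[OF H[OF that]] .
  show ?thesis
    unfolding cauchy_product_eq_kernel
  proof (rule has_sum_mps[where T = ?T])
    fix m :: "nat + nat \<Rightarrow>\<^sub>0 nat"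
    let ?d = "total_degree (ypart m)"
    show "finite (?T m)" using finite_partitions_le by simp
    show "?T m \<subseteq> partitions" by blast
    {
      fix \<mu> assume \<mu>: "\<mu> \<in> partitions" "\<mu> \<notin> ?T m"
      then have "psum_coeff (H \<mu>) M = 0" if "M \<in> multisets_of_sum ?d" for M
        using vanish[of M \<mu>] \<mu> that by (auto simp: multisets_of_sum_def)
      then have "mcoeff (H \<mu>) (ypart m) = 0" unfolding H_coeff[OF \<mu>(1)] by simp
      then show "mcoeff (in_x (I \<mu>) * in_y (H \<mu>)) m = 0" by (simp add: mcoeff_in_x_times_in_y)
    }
    have "(\<Sum>\<mu>\<in>?T m. mcoeff (in_x (I \<mu>) * in_y (H \<mu>)) m)
        = (\<Sum>\<mu>\<in>?T m. \<Sum>M\<in>multisets_of_sum ?d.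
            mcoeff (I \<mu>) (xpart m) * (psum_coeff (H \<mu>) M * mcoeff (psum_mset M) (ypart m)))"
      by (rule sum.cong) (auto simp: mcoeff_in_x_times_in_y H_coeff sum_distrib_left)
    also have "\<dots> = (\<Sum>M\<in>multisets_of_sum ?d. \<Sum>\<mu>\<in>?T m.
            mcoeff (I \<mu>) (xpart m) * (psum_coeff (H \<mu>) M * mcoeff (psum_mset M) (ypart m)))"
      by (rule sum.swap)
    also have "\<dots> = (\<Sum>M\<in>multisets_of_sum ?d.
            mcoeff (psum_mset M) (xpart m) * mcoeff (psum_mset M) (ypart m) / psum_norm M)"
    proof (rule sum.cong[OF refl])
      fix M assume "M \<in> multisets_of_sum ?d"
      then have M: "0 \<notin># M" "sum_mset M = ?d" by (simp_all add: multisets_of_sum_def)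
      \<comment> \<open>All M here have sum ?d, so the dual expansions of the different
        \<open>psum_mset M\<close> run over the same partitions \<open>?T m\<close>; that is what
        permits the exchange of sums.\<close>
      have "mcoeff (psum_mset M) (xpart m) =
          (\<Sum>\<mu>\<in>?T m. psum_coeff (H \<mu>) M * psum_norm M * mcoeff (I \<mu>) (xpart m))"
        using arg_cong[OF expand[OF M(1)], of "\<lambda>f. mcoeff f (xpart m)"] by (simp add: M(2))
      then have E: "mcoeff (psum_mset M) (xpart m) / psum_norm M =
          (\<Sum>\<mu>\<in>?T m. mcoeff (I \<mu>) (xpart m) * psum_coeff (H \<mu>) M)"
        using psum_norm_nonzero[OF M(1)] by (simp add: sum_divide_distrib mult_ac)
      have "(\<Sum>\<mu>\<in>?T m. mcoeff (I \<mu>) (xpart m) * (psum_coeff (H \<mu>) M * mcoeff (psum_mset M) (ypart m)))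
          = mcoeff (psum_mset M) (xpart m) / psum_norm M * mcoeff (psum_mset M) (ypart m)"
        unfolding E by (simp add: sum_distrib_right mult.assoc)
      then show "(\<Sum>\<mu>\<in>?T m. mcoeff (I \<mu>) (xpart m) * (psum_coeff (H \<mu>) M * mcoeff (psum_mset M) (ypart m)))
          = mcoeff (psum_mset M) (xpart m) * mcoeff (psum_mset M) (ypart m) / psum_norm M"
        by simp
    qed
    also have "\<dots> = mcoeff cauchy_kernel m" by (rule mcoeff_kernel_expand[symmetric])
    finally show "mcoeff cauchy_kernel m = (\<Sum>\<mu>\<in>?T m. mcoeff (in_x (I \<mu>) * in_y (H \<mu>)) m)" ..
  qed
qed

end
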